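(* Let $\beta>2$ be fixed and let $X_1,X_2,\ldots$ be i.i.d. random variables with a normal distribution $\mathrm{N}(\mu,\sigma^2)$ for some $\mu\in\mathbb{R}$, $\sigma^2>0$. Let $$T_{n,\beta}=n\int_{-\infty}^{\infty}\left(M_n(t)-M_0(t)\right)^2 e^{-\beta t^2}\,dt ,$$ where $M_n$ is the empirical moment generating function of the scaled residuals of $X_1,\ldots,X_n$ and $M_0(t)=e^{t^2/2}$. Then, as $n\to\infty$, $T_{n,\beta}$ converges in distribution to $$\|W\|^2=\int_{\mathbb{R}}W^2(t)\,e^{-\beta t^2}\,dt,$$ where $W$ is a centred Gaussian random element of the Hilbert space $\mathcal{H}=L^2(\mathbb{R},\mathcal{B},e^{-\beta t^2}\,dt)$ with covariance kernel $$K(s,t)=e^{(t^2+s^2)/2}\left(e^{ts}-1-ts-\frac{t^2s^2}{2}\right),\quad s,t\in\mathbb{R}.$$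
   Context: Put $\overline{X}_n=n^{-1}\sum_{j=1}^n X_j$, $S_n^2=n^{-1}\sum_{j=1}^n (X_j-\overline{X}_n)^2$, $S_n=\sqrt{S_n^2}$. The scaled residuals are $Y_{n,j}=(X_j-\overline{X}_n)/S_n$, $j=1,\ldots,n$ (defined almost surely for $n\ge2$), and $M_n(t)=\frac1n\sum_{j=1}^n \exp(tY_{n,j})$, $t\in\mathbb{R}$. $\mathcal{B}$ is the Borel $\sigma$-field on $\mathbb{R}$. $\mathcal{H}$ is the separable Hilbert space of (equivalence classes of) measurable functions $f:\mathbb{R}\to\mathbb{R}$ with $\int_{\mathbb{R}} f^2(t)e^{-\beta t^2}\,dt<\infty$, with inner product $\langle f,g\rangle=\int_{\mathbb{R}} f(t)g(t)e^{-\beta t^2}\,dt$ and norm $\|f\|=\langle f,f\rangle^{1/2}$. A centred Gaussian element $W$ of $\mathcal{H}$ has covariance kernel $K$ if, for all $f,g\in\mathcal{H}$, $\langle W,f\rangle$ is a centred (possibly degenerate) normal random variable and $\mathbb{E}[\langle W,f\rangle\langle W,g\rangle]=\int_{\mathbb{R}}\int_{\mathbb{R}}K(s,t)f(s)g(t)e^{-\beta s^2}e^{-\beta t^2}\,ds\,dt$. *)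

theory Defs
  imports "HOL-Probability.Probability"
begin

text \<open>A sample is a sequence \<open>x\<close>, of which only \<open>x 1, \<dots>, x n\<close> are used. The variance has the factor
  \<open>1 / n\<close>. If the sample is constant, in particular if \<open>n = 1\<close>, all scaled residuals are \<open>0\<close>
  by the convention \<open>a / 0 = 0\<close>.\<close>

definition sample_mean :: "(nat \<Rightarrow> real) \<Rightarrow> nat \<Rightarrow> real" where
  "sample_mean x n = (\<Sum>j=1..n. x j) / real n"

definition sample_var :: "(nat \<Rightarrow> real) \<Rightarrow> nat \<Rightarrow> real" where
  "sample_var x n = (\<Sum>j=1..n. (x j - sample_mean x n)\<^sup>2) / real n"

definition scaled_residual :: "(nat \<Rightarrow> real) \<Rightarrow> nat \<Rightarrow> nat \<Rightarrow> real" where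
  "scaled_residual x n j = (x j - sample_mean x n) / sqrt (sample_var x n)"

definition emp_mgf :: "(nat \<Rightarrow> real) \<Rightarrow> nat \<Rightarrow> real \<Rightarrow> real" where
  "emp_mgf x n t = (\<Sum>j=1..n. exp (t * scaled_residual x n j)) / real n"

definition std_normal_mgf :: "real \<Rightarrow> real" where
  "std_normal_mgf t = exp (t\<^sup>2 / 2)"

definition T_stat :: "real \<Rightarrow> (nat \<Rightarrow> real) \<Rightarrow> nat \<Rightarrow> real" where
  "T_stat \<beta> x n = real n * (LINT t|lborel. (emp_mgf x n t - std_normal_mgf t)\<^sup>2 * exp (- \<beta> * t\<^sup>2))"

text \<open>Elements are represented by functions instead of classes modulo almost-everywhere equality,
  so \<open>wnorm\<close> is only a seminorm. Its open sets are unions of equivalence classes, hence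
  \<open>borel_wL2\<close> corresponds exactly to the Borel sets of the quotient.\<close>

definition wL2 :: "real \<Rightarrow> (real \<Rightarrow> real) set" where
  "wL2 \<beta> = {f \<in> borel_measurable borel. integrable lborel (\<lambda>t. (f t)\<^sup>2 * exp (- \<beta> * t\<^sup>2))}"

definition winner :: "real \<Rightarrow> (real \<Rightarrow> real) \<Rightarrow> (real \<Rightarrow> real) \<Rightarrow> real" where
  "winner \<beta> f g = (LINT t|lborel. f t * g t * exp (- \<beta> * t\<^sup>2))"

definition wnorm :: "real \<Rightarrow> (real \<Rightarrow> real) \<Rightarrow> real" where
  "wnorm \<beta> f = sqrt (winner \<beta> f f)"

definition wopen :: "real \<Rightarrow> (real \<Rightarrow> real) set \<Rightarrow> bool" where
  "wopen \<beta> U \<longleftrightarrow> U \<subseteq> wL2 \<beta> \<and>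
     (\<forall>f\<in>U. \<exists>r>0. \<forall>g\<in>wL2 \<beta>. wnorm \<beta> (\<lambda>t. g t - f t) < r \<longrightarrow> g \<in> U)"

definition borel_wL2 :: "real \<Rightarrow> (real \<Rightarrow> real) measure" where
  "borel_wL2 \<beta> = sigma (wL2 \<beta>) {U. wopen \<beta> U}"

definition centred_normal :: "'b measure \<Rightarrow> ('b \<Rightarrow> real) \<Rightarrow> bool" where
  "centred_normal N Z \<longleftrightarrow> Z \<in> borel_measurable N \<and>
     ((AE \<omega> in N. Z \<omega> = 0) \<or>
      (\<exists>\<sigma>>0. distributed N lborel Z (\<lambda>x. ennreal (normal_density 0 \<sigma> x))))"

definition centred_gaussian_element ::
    "real \<Rightarrow> (real \<Rightarrow> real \<Rightarrow> real) \<Rightarrow> 'b measure \<Rightarrow> ('b \<Rightarrow> real \<Rightarrow> real) \<Rightarrow> bool" where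
  "centred_gaussian_element \<beta> K N W \<longleftrightarrow>
     W \<in> measurable N (borel_wL2 \<beta>) \<and>
     (\<forall>f\<in>wL2 \<beta>. centred_normal N (\<lambda>\<omega>. winner \<beta> (W \<omega>) f)) \<and>
     (\<forall>f\<in>wL2 \<beta>. \<forall>g\<in>wL2 \<beta>.
        (LINT \<omega>|N. winner \<beta> (W \<omega>) f * winner \<beta> (W \<omega>) g) =
        (LINT t|lborel. LINT s|lborel.
           K s t * f s * g t * exp (- \<beta> * s\<^sup>2) * exp (- \<beta> * t\<^sup>2)))"

definition K_cov :: "real \<Rightarrow> real \<Rightarrow> real" where
  "K_cov s t = exp ((t\<^sup>2 + s\<^sup>2) / 2) * (exp (t * s) - 1 - t * s - t\<^sup>2 * s\<^sup>2 / 2)"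

end

theory Submission
  imports Defs
begin

text \<open>Put \<open>h(x, t) = exp (t x) - exp (t\<^sup>2 / 2) (1 + t x + t\<^sup>2 (x\<^sup>2 - 1) / 2)\<close>. For standard normal
  \<open>X\<close> the functions \<open>h(X, \<cdot>)\<close> are centred with covariance kernel \<open>K\<close>. A Taylor expansion of the scaled
  residuals around the \<open>X\<^sub>j\<close> shows that \<open>\<surd>n (M\<^sub>n - M\<^sub>0)\<close> differs from \<open>Z\<^sub>n = n\<^sup>-\<^sup>1\<^sup>/\<^sup>2 \<Sum>\<^sub>j h(X\<^sub>j, \<cdot>)\<close> by a term
  whose weighted norm tends to \<open>0\<close> in probability; here \<open>\<beta> > 2\<close> makes the second moments of
  \<open>exp (t X)\<close> integrable, with some room for the random change of scale.

  The limit of \<open>\<parallel>Z\<^sub>n\<parallel>\<^sup>2\<close> is found from Laplace transforms. The norm is approximated by averages over finitely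
  many cells, uniformly in \<open>n\<close> because the second moments of \<open>Z\<^sub>n\<close> do not depend on \<open>n\<close>. For finitely many
  coordinates \<open>V\<^sub>i\<close> one has \<open>E exp (- s\<^sup>2 / 2 \<Sum> V\<^sub>i\<^sup>2) = E exp (\<i> s \<Sum> G\<^sub>i V\<^sub>i)\<close> with independent standard normal
  \<open>G\<^sub>i\<close>, so the one-dimensional central limit theorem suffices, and the same identity determines the Laplace
  transform of \<open>\<parallel>W\<parallel>\<^sup>2\<close> from the covariance of \<open>W\<close>.

  A Gaussian element exists since \<open>K(s, t) = \<Sum>\<^sub>k \<psi>\<^sub>k(s) \<psi>\<^sub>k(t)\<close> with
  \<open>\<psi>\<^sub>k(t) = exp (t\<^sup>2 / 2) t\<^sup>k / \<surd>k!\<close> for \<open>k \<ge> 3\<close>: take \<open>W = \<Sum>\<^sub>k G\<^sub>k \<psi>\<^sub>k\<close>.\<close>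

section \<open>Square integrable functions\<close>

text \<open>The function subtracted in \<open>h\<close> is the projection of
  \<open>exp (t * x)\<close> onto polynomials in \<open>x\<close> of degree at most 2 under the
  standard normal law: in the Hermite expansion
  \<open>exp (t x) = exp (t^2 / 2) * sum_k He_k(x) t^k / k!\<close> the constant term is
  \<open>M_0\<close>, and estimating mean and variance removes the components of degree 1 and 2.
  Hence \<open>K\<close> carries the exponential series of \<open>s t\<close> without its first
  three terms, and the functions \<open>\<psi>\<close> begin at degree 3.

  The obstacle is that the limit lives in an infinite-dimensional space while only one-dimensional
  characteristic functions are used. Statistic and limit are nonnegative reals, so their Laplace
  transforms decide weak convergence. The passage to finitely many coordinates is controlled by an
  exact identity: the expected energy lost in it is the same for all sample sizes. This takes the
  place of tightness in the Hilbert space.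

  The limit statement covers every representation of \<open>W\<close> on any probability space, so
  the law of its norm has to follow from the covariance identity alone; existence of
  \<open>W\<close> is a separate construction.\<close>

definition sq_integrable :: "'a measure \<Rightarrow> ('a \<Rightarrow> real) \<Rightarrow> bool" where
  "sq_integrable M f \<longleftrightarrow> f \<in> borel_measurable M \<and> integrable M (\<lambda>x. (f x)\<^sup>2)"

lemma sq_integrable_square: "sq_integrable M f \<Longrightarrow> integrable M (\<lambda>x. (f x)\<^sup>2)"
  by (simp add: sq_integrable_def)

lemma sq_integrable_mult:
  assumes "sq_integrable M f" "sq_integrable M g"
  shows "integrable M (\<lambda>x. f x * g x)"
proof (rule Bochner_Integration.integrable_bound)
  show "integrable M (\<lambda>x. (f x)\<^sup>2 + (g x)\<^sup>2)"
    using assms by (auto simp: sq_integrable_def)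
  show "(\<lambda>x. f x * g x) \<in> borel_measurable M"
    using assms by (auto simp: sq_integrable_def)
  have "\<bar>a * b\<bar> \<le> a\<^sup>2 + b\<^sup>2" for a b :: real
    using sum_squares_bound[of a b] sum_squares_bound[of a "-b"] zero_le_power2[of a] zero_le_power2[of b]
    unfolding abs_le_iff by simp
  then show "AE x in M. norm (f x * g x) \<le> norm ((f x)\<^sup>2 + (g x)\<^sup>2)"
    by (intro AE_I2) (simp add: abs_mult)
qed

lemma sq_integrable_cmult: "sq_integrable M f \<Longrightarrow> sq_integrable M (\<lambda>x. c * f x)"
  by (auto simp: sq_integrable_def power_mult_distrib)

lemma sq_integrable_add:
  assumes "sq_integrable M f" "sq_integrable M g"
  shows "sq_integrable M (\<lambda>x. f x + g x)"
proof -
  have "integrable M (\<lambda>x. (f x)\<^sup>2 + (g x)\<^sup>2 + 2 * (f x * g x))"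
    using assms sq_integrable_mult[OF assms] by (auto simp: sq_integrable_def)
  then show ?thesis
    using assms by (auto simp: sq_integrable_def power2_sum mult.assoc)
qed

lemma sq_integrable_diff:
  assumes "sq_integrable M f" "sq_integrable M g"
  shows "sq_integrable M (\<lambda>x. f x - g x)"
  using sq_integrable_add[OF assms(1) sq_integrable_cmult[OF assms(2), of "-1"]] by simp

lemma sq_integrable_zero: "sq_integrable M (\<lambda>x. 0)"
  by (simp add: sq_integrable_def)

lemma sq_integrable_sum:
  "(\<And>i. i \<in> I \<Longrightarrow> sq_integrable M (f i)) \<Longrightarrow> sq_integrable M (\<lambda>x. \<Sum>i\<in>I. f i x)"
  by (induction I rule: infinite_finite_induct) (auto intro: sq_integrable_zero sq_integrable_add)

lemma sq_integrable_bound: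
  assumes "sq_integrable M g" "f \<in> borel_measurable M" "\<And>x. \<bar>f x\<bar> \<le> \<bar>g x\<bar>"
  shows "sq_integrable M f"
  unfolding sq_integrable_def
proof
  show "integrable M (\<lambda>x. (f x)\<^sup>2)"
    by (rule Bochner_Integration.integrable_bound[OF sq_integrable_square[OF assms(1)]])
      (use assms in \<open>auto simp: abs_le_square_iff\<close>)
qed fact

lemma Cauchy_Schwarz_sq_integrable:
  assumes f: "sq_integrable M f" and g: "sq_integrable M g"
  shows "(\<integral>x. f x * g x \<partial>M)\<^sup>2 \<le> (\<integral>x. (f x)\<^sup>2 \<partial>M) * (\<integral>x. (g x)\<^sup>2 \<partial>M)"
proof -
  let ?A = "\<integral>x. (f x)\<^sup>2 \<partial>M" and ?B = "\<integral>x. f x * g x \<partial>M" and ?C = "\<integral>x. (g x)\<^sup>2 \<partial>M"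
  note [simp] = sq_integrable_square[OF f] sq_integrable_square[OF g] sq_integrable_mult[OF f g]
  have pos: "0 \<le> s\<^sup>2 * ?A - 2 * s * r * ?B + r\<^sup>2 * ?C" for r s
  proof -
    have "0 \<le> (\<integral>x. (s * f x - r * g x)\<^sup>2 \<partial>M)" by simp
    also have "(\<integral>x. (s * f x - r * g x)\<^sup>2 \<partial>M)
        = (\<integral>x. s\<^sup>2 * (f x)\<^sup>2 - 2 * s * r * (f x * g x) + r\<^sup>2 * (g x)\<^sup>2 \<partial>M)"
      by (rule Bochner_Integration.integral_cong) (auto simp: power2_diff power_mult_distrib)
    also have "\<dots> = s\<^sup>2 * ?A - 2 * s * r * ?B + r\<^sup>2 * ?C" by simp
    finally show ?thesis .
  qed
  have C0: "?C \<ge> 0" by simp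
  show ?thesis
  proof (cases "?C = 0")
    case True
    have "?B = 0"
    proof (rule ccontr)
      assume B: "?B \<noteq> 0"
      \<comment> \<open>With \<open>?C = 0\<close> the form is affine in the coefficient of
        \<open>g\<close>; this value makes it equal to -1.\<close>
      from pos[of 1 "(?A + 1) / (2 * ?B)"] B True show False by simp
    qed
    with True show ?thesis by simp
  next
    case False
    with C0 have "?C > 0" by linarith
    \<comment> \<open>The coefficients \<open>?C\<close> and \<open>?B\<close> turn the form into
      \<open>?C\<close> times the determinant.\<close>
    have "0 \<le> ?C\<^sup>2 * ?A - 2 * ?C * ?B * ?B + ?B\<^sup>2 * ?C" by (rule pos)
    also have "\<dots> = ?C * (?A * ?C - ?B\<^sup>2)" by (simp add: power2_eq_square algebra_simps)
    finally show ?thesis using \<open>?C > 0\<close> by (simp add: zero_le_mult_iff)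
  qed
qed

lemma L2_triangle:
  assumes f: "sq_integrable M f" and g: "sq_integrable M g"
  shows "sqrt (\<integral>x. (f x + g x)\<^sup>2 \<partial>M) \<le> sqrt (\<integral>x. (f x)\<^sup>2 \<partial>M) + sqrt (\<integral>x. (g x)\<^sup>2 \<partial>M)"
proof (rule real_le_lsqrt)
  let ?A = "\<integral>x. (f x)\<^sup>2 \<partial>M" and ?B = "\<integral>x. f x * g x \<partial>M" and ?C = "\<integral>x. (g x)\<^sup>2 \<partial>M"
  note [simp] = sq_integrable_square[OF f] sq_integrable_square[OF g] sq_integrable_mult[OF f g]
  have "(\<integral>x. (f x + g x)\<^sup>2 \<partial>M) = (\<integral>x. (f x)\<^sup>2 + 2 * (f x * g x) + (g x)\<^sup>2 \<partial>M)"
    by (rule Bochner_Integration.integral_cong) (auto simp: power2_sum)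
  also have "\<dots> = ?A + 2 * ?B + ?C" by simp
  also have "?B \<le> sqrt ?A * sqrt ?C"
    unfolding real_sqrt_mult[symmetric]
    by (rule real_le_rsqrt) (rule Cauchy_Schwarz_sq_integrable[OF f g])
  finally show "(\<integral>x. (f x + g x)\<^sup>2 \<partial>M) \<le> (sqrt ?A + sqrt ?C)\<^sup>2"
    by (simp add: power2_sum)
qed auto

lemma L2_triangle_diff:
  assumes f: "sq_integrable M f" and g: "sq_integrable M g"
  shows "\<bar>sqrt (\<integral>x. (f x)\<^sup>2 \<partial>M) - sqrt (\<integral>x. (g x)\<^sup>2 \<partial>M)\<bar> \<le> sqrt (\<integral>x. (f x - g x)\<^sup>2 \<partial>M)"
  using L2_triangle[OF sq_integrable_diff[OF f g] g] L2_triangle[OF sq_integrable_diff[OF g f] f]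
  by (simp add: power2_commute[of "g _" "f _"])

text \<open>Expanding the square, orthonormality collapses the double sum to its diagonal. The
  equality, rather than Bessel's inequality, is what later turns convergence of projections into
  convergence of the sums of squared coefficients.\<close>

lemma Bessel_identity:
  assumes J: "finite J" and e: "\<And>i. i \<in> J \<Longrightarrow> sq_integrable M (e i)"
    and on: "\<And>i j. i \<in> J \<Longrightarrow> j \<in> J \<Longrightarrow> (\<integral>x. e i x * e j x \<partial>M) = (if i = j then 1 else 0)"
    and f: "sq_integrable M f"
  shows "(\<integral>x. (f x - (\<Sum>i\<in>J. (\<integral>y. f y * e i y \<partial>M) * e i x))\<^sup>2 \<partial>M)
    = (\<integral>x. (f x)\<^sup>2 \<partial>M) - (\<Sum>i\<in>J. (\<integral>y. f y * e i y \<partial>M)\<^sup>2)"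
proof -
  let ?c = "\<lambda>i. \<integral>y. f y * e i y \<partial>M"
  have ii: "i \<in> J \<Longrightarrow> j \<in> J \<Longrightarrow> integrable M (\<lambda>x. e i x * e j x)" for i j
    by (intro sq_integrable_mult e)
  have fi: "i \<in> J \<Longrightarrow> integrable M (\<lambda>x. f x * e i x)" for i
    by (intro sq_integrable_mult e f)
  have "(\<integral>x. (f x - (\<Sum>i\<in>J. ?c i * e i x))\<^sup>2 \<partial>M)
    = (\<integral>x. (f x)\<^sup>2 - 2 * (\<Sum>i\<in>J. ?c i * (f x * e i x)) + (\<Sum>i\<in>J. \<Sum>j\<in>J. ?c i * ?c j * (e i x * e j x)) \<partial>M)"
    by (rule Bochner_Integration.integral_cong)
      (auto simp: power2_eq_square algebra_simps sum_distrib_left sum_distrib_right sum_product)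
  also have "\<dots> = (\<integral>x. (f x)\<^sup>2 \<partial>M) - 2 * (\<Sum>i\<in>J. ?c i * (\<integral>x. f x * e i x \<partial>M))
      + (\<Sum>i\<in>J. \<Sum>j\<in>J. ?c i * ?c j * (\<integral>x. e i x * e j x \<partial>M))"
  proof -
    have 1: "integrable M (\<lambda>x. \<Sum>i\<in>J. ?c i * (f x * e i x))"
      by (intro Bochner_Integration.integrable_sum integrable_mult_right fi)
    have 2: "integrable M (\<lambda>x. \<Sum>i\<in>J. \<Sum>j\<in>J. ?c i * ?c j * (e i x * e j x))"
      by (intro Bochner_Integration.integrable_sum integrable_mult_right ii)
    have "(\<integral>x. (\<Sum>i\<in>J. ?c i * (f x * e i x)) \<partial>M) = (\<Sum>i\<in>J. ?c i * (\<integral>x. f x * e i x \<partial>M))"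
      by (subst Bochner_Integration.integral_sum) (auto intro!: integrable_mult_right fi)
    moreover have "(\<integral>x. (\<Sum>i\<in>J. \<Sum>j\<in>J. ?c i * ?c j * (e i x * e j x)) \<partial>M)
       = (\<Sum>i\<in>J. \<Sum>j\<in>J. ?c i * ?c j * (\<integral>x. e i x * e j x \<partial>M))"
      by (subst Bochner_Integration.integral_sum, intro Bochner_Integration.integrable_sum integrable_mult_right ii, assumption+)
        (intro sum.cong refl, subst Bochner_Integration.integral_sum,
          auto intro!: integrable_mult_right ii)
    ultimately show ?thesis
      using 1 2 sq_integrable_square[OF f] by simp
  qed
  also have "(\<Sum>i\<in>J. \<Sum>j\<in>J. ?c i * ?c j * (\<integral>x. e i x * e j x \<partial>M)) = (\<Sum>i\<in>J. (?c i)\<^sup>2)"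
    by (intro sum.cong refl) (simp add: on J if_distrib[of "\<lambda>x. _ * x"] sum.delta power2_eq_square cong: sum.cong if_cong)
  finally show ?thesis by (simp add: power2_eq_square)
qed

section \<open>The weighted space\<close>

text \<open>Absorbing the weight into the measure makes \<open>wL2\<close> an ordinary space of
  square integrable functions, so that the general lemmas above and the theorems on product measures
  apply.\<close>

definition wmeasure :: "real \<Rightarrow> real measure" where
  "wmeasure \<beta> = density lborel (\<lambda>t. ennreal (exp (- \<beta> * t\<^sup>2)))"

lemma sets_wmeasure [simp, measurable_cong]: "sets (wmeasure \<beta>) = sets borel"
  and space_wmeasure [simp]: "space (wmeasure \<beta>) = UNIV"
  by (simp_all add: wmeasure_def)

lemma measurable_wmeasure [simp]: "borel_measurable (wmeasure \<beta>) = borel_measurable borel"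
  by (rule measurable_cong_sets) simp_all

lemma integrable_wmeasure:
  fixes f :: "real \<Rightarrow> real"
  assumes "f \<in> borel_measurable borel"
  shows "integrable (wmeasure \<beta>) f \<longleftrightarrow> integrable lborel (\<lambda>t. f t * exp (- \<beta> * t\<^sup>2))"
  unfolding wmeasure_def by (subst integrable_density) (use assms in \<open>auto simp: mult.commute\<close>)

lemma integral_wmeasure:
  fixes f :: "real \<Rightarrow> real"
  assumes "f \<in> borel_measurable borel"
  shows "(\<integral>t. f t \<partial>wmeasure \<beta>) = (\<integral>t. f t * exp (- \<beta> * t\<^sup>2) \<partial>lborel)"
  unfolding wmeasure_def by (subst integral_density) (use assms in \<open>auto simp: mult.commute\<close>)

lemma wL2_iff: "f \<in> wL2 \<beta> \<longleftrightarrow> sq_integrable (wmeasure \<beta>) f"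
  by (auto simp: wL2_def sq_integrable_def integrable_wmeasure)

lemma wL2_measurable: "f \<in> wL2 \<beta> \<Longrightarrow> f \<in> borel_measurable borel"
  by (simp add: wL2_def)

lemma winner_eq:
  assumes "f \<in> borel_measurable borel" "g \<in> borel_measurable borel"
  shows "winner \<beta> f g = (\<integral>t. f t * g t \<partial>wmeasure \<beta>)"
  unfolding winner_def using assms by (subst integral_wmeasure) auto

lemma wnorm_eq:
  assumes "f \<in> borel_measurable borel"
  shows "wnorm \<beta> f = sqrt (\<integral>t. (f t)\<^sup>2 \<partial>wmeasure \<beta>)"
  unfolding wnorm_def using assms by (simp add: winner_eq power2_eq_square)

lemma wnorm_square:
  assumes "f \<in> borel_measurable borel"
  shows "(wnorm \<beta> f)\<^sup>2 = (\<integral>t. (f t)\<^sup>2 \<partial>wmeasure \<beta>)"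
  using assms by (simp add: wnorm_eq)

section \<open>Gaussian integrals and membership in the weighted space\<close>

lemma has_integral_exp_quadratic:
  assumes "a > 0"
  shows "has_bochner_integral lborel (\<lambda>t::real. exp (c * t - a * t\<^sup>2)) (sqrt (pi / a) * exp (c\<^sup>2 / (4 * a)))"
proof -
  \<comment> \<open>Completing the square exhibits the integrand as a multiple of the normal density
    with mean \<open>c / (2 * a)\<close> and standard deviation \<open>s\<close>.\<close>
  define s where "s = sqrt (1 / (2 * a))"
  have s: "s > 0" "s\<^sup>2 = 1 / (2 * a)" using assms by (auto simp: s_def)
  have "has_bochner_integral lborel (normal_density (c / (2 * a)) s) 1"
    using s by (simp add: has_bochner_integral_iff)
  then have "has_bochner_integral lborel
      (\<lambda>t. sqrt (pi / a) * exp (c\<^sup>2 / (4 * a)) * normal_density (c / (2 * a)) s t)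
      (sqrt (pi / a) * exp (c\<^sup>2 / (4 * a)) * 1)"
    by (rule has_bochner_integral_mult_right)
  moreover have "sqrt (pi / a) * exp (c\<^sup>2 / (4 * a)) * normal_density (c / (2 * a)) s t
      = exp (c * t - a * t\<^sup>2)" for t
  proof -
    have eq: "2 * pi * s\<^sup>2 = pi / a" by (simp add: s)
    have one: "sqrt (pi / a) / sqrt (2 * pi * s\<^sup>2) = 1"
      unfolding eq using assms by simp
    have "sqrt (pi / a) * exp (c\<^sup>2 / (4 * a)) * normal_density (c / (2 * a)) s t
      = exp (c\<^sup>2 / (4 * a)) * exp (- (t - c / (2 * a))\<^sup>2 / (2 * s\<^sup>2))"
    proof -
      have "sqrt (pi / a) * exp (c\<^sup>2 / (4 * a)) * normal_density (c / (2 * a)) s t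
        = (sqrt (pi / a) / sqrt (2 * pi * s\<^sup>2)) * exp (c\<^sup>2 / (4 * a)) * exp (- (t - c / (2 * a))\<^sup>2 / (2 * s\<^sup>2))"
        by (simp add: normal_density_def)
      then show ?thesis by (simp only: one mult_1)
    qed
    also have "\<dots> = exp (c\<^sup>2 / (4 * a) - (t - c / (2 * a))\<^sup>2 * a)"
      using assms by (simp add: s exp_add[symmetric])
    also have "c\<^sup>2 / (4 * a) - (t - c / (2 * a))\<^sup>2 * a = c * t - a * t\<^sup>2"
      using assms by (simp add: power2_eq_square field_simps)
    finally show ?thesis .
  qed
  ultimately show ?thesis by simp
qed

lemma integrable_exp_abs_quadratic:
  assumes "a > 0"
  shows "integrable lborel (\<lambda>t::real. exp (c * \<bar>t\<bar> - a * t\<^sup>2))"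
proof (rule Bochner_Integration.integrable_bound)
  show "integrable lborel (\<lambda>t::real. exp (c * t - a * t\<^sup>2) + exp ((- c) * t - a * t\<^sup>2))"
    using has_integral_exp_quadratic[OF assms, of c] has_integral_exp_quadratic[OF assms, of "- c"]
    by (intro Bochner_Integration.integrable_add) (simp_all add: has_bochner_integral_iff)
  show "AE t in lborel. norm (exp (c * \<bar>t\<bar> - a * t\<^sup>2))
      \<le> norm (exp (c * t - a * t\<^sup>2) + exp ((- c) * t - a * t\<^sup>2))"
  proof (intro AE_I2)
    fix t
    have "exp (c * \<bar>t\<bar> - a * t\<^sup>2) \<le> exp (c * t - a * t\<^sup>2) + exp ((- c) * t - a * t\<^sup>2)"
      by (cases "t \<ge> 0") auto
    then show "norm (exp (c * \<bar>t\<bar> - a * t\<^sup>2))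
        \<le> norm (exp (c * t - a * t\<^sup>2) + exp ((- c) * t - a * t\<^sup>2))"
      by simp
  qed
qed simp

lemma integrable_wmeasure_exp:
  assumes "a < \<beta>"
  shows "integrable (wmeasure \<beta>) (\<lambda>t. exp (c * \<bar>t\<bar> + a * t\<^sup>2))"
  using integrable_exp_abs_quadratic[of "\<beta> - a" c] assms
  by (subst integrable_wmeasure) (auto simp: exp_add[symmetric] algebra_simps)

lemma exp_quadratic_in_wL2:
  assumes "2 * a < \<beta>"
  shows "(\<lambda>t. exp (c * \<bar>t\<bar> + a * t\<^sup>2)) \<in> wL2 \<beta>"
  using integrable_wmeasure_exp[OF assms, of "2 * c"]
  by (auto simp: wL2_iff sq_integrable_def power2_eq_square[of "exp _"] exp_add[symmetric] algebra_simps)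

lemma finite_measure_wmeasure: "\<beta> > 0 \<Longrightarrow> finite_measure (wmeasure \<beta>)"
  using integrable_wmeasure_exp[of 0 \<beta> 0] by (auto intro!: finite_measureI
    simp: integrable_iff_bounded ennreal_mult_less_top top.not_eq_extremum)

text \<open>The weight never vanishes, so a null interval would have length zero. This keeps the
  normalising constants of the cell functions away from zero.\<close>

lemma emeasure_wmeasure_pos:
  assumes "a < b"
  shows "emeasure (wmeasure \<beta>) {a..<b} > 0"
proof -
  have pos: "\<not> (AE t in lborel. t \<notin> {a..<b})"
  proof
    assume "AE t in lborel. t \<notin> {a..<b}"
    then have "emeasure lborel {a..<b} = 0"
      by (subst (asm) AE_iff_measurable[of "{a..<b}"]) auto
    then show False using assms by simp
  qed
  have "emeasure (wmeasure \<beta>) {a..<b} \<noteq> 0"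
  proof
    assume "emeasure (wmeasure \<beta>) {a..<b} = 0"
    then have "{a..<b} \<in> null_sets (wmeasure \<beta>)" by (auto simp: null_sets_def)
    then have "AE t in lborel. t \<in> {a..<b} \<longrightarrow> ennreal (exp (- \<beta> * t\<^sup>2)) = 0"
      unfolding wmeasure_def by (subst (asm) null_sets_density_iff) auto
    then show False using pos by simp
  qed
  then show ?thesis by (simp add: zero_less_iff_neq_zero)
qed

section \<open>Averaging over cells\<close>

definition cell :: "nat \<Rightarrow> int \<Rightarrow> real set" where
  "cell m i = {t. \<lfloor>real m * t\<rfloor> = i}"

text \<open>For \<open>m > 0\<close> cells have length \<open>1 / m\<close>, so about
  \<open>m^2\<close> of them on each side of the origin fill a window of radius about
  \<open>m\<close>: one parameter both refines the mesh and exhausts the line.\<close>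

definition cells :: "nat \<Rightarrow> int set" where
  "cells m = {- (int m)\<^sup>2..(int m)\<^sup>2}"

definition cell_fun :: "real \<Rightarrow> nat \<Rightarrow> int \<Rightarrow> real \<Rightarrow> real" where
  "cell_fun \<beta> m i t = indicator (cell m i) t / sqrt (measure (wmeasure \<beta>) (cell m i))"

definition coef :: "real \<Rightarrow> nat \<Rightarrow> int \<Rightarrow> (real \<Rightarrow> real) \<Rightarrow> real" where
  "coef \<beta> m i f = winner \<beta> f (cell_fun \<beta> m i)"

text \<open>For \<open>m > 0\<close> this is the orthogonal projection onto the span of the
  normalised indicators: the weighted mean of \<open>f\<close> on each listed cell and zero outside
  the window.\<close>

definition cell_avg :: "real \<Rightarrow> nat \<Rightarrow> (real \<Rightarrow> real) \<Rightarrow> real \<Rightarrow> real" where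
  "cell_avg \<beta> m f t = (\<Sum>i\<in>cells m. coef \<beta> m i f * cell_fun \<beta> m i t)"

lemma finite_cells [simp]: "finite (cells m)"
  by (simp add: cells_def)

lemma cell_borel [measurable]: "cell m i \<in> sets borel"
  unfolding cell_def by measurable

lemma cell_eq: "m > 0 \<Longrightarrow> cell m i = {real_of_int i / real m..<(real_of_int i + 1) / real m}"
  by (auto simp: cell_def floor_eq_iff field_simps)

lemma cell_fun_borel [measurable]: "cell_fun \<beta> m i \<in> borel_measurable borel"
  unfolding cell_fun_def[abs_def] by measurable

lemma measure_cell_pos:
  assumes "\<beta> > 0" "m > 0"
  shows "measure (wmeasure \<beta>) (cell m i) > 0"
proof -
  interpret finite_measure "wmeasure \<beta>" using assms by (rule_tac finite_measure_wmeasure)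
  have "emeasure (wmeasure \<beta>) (cell m i) > 0"
    unfolding cell_eq[OF assms(2)] using assms(2)
    by (intro emeasure_wmeasure_pos) (simp add: divide_strict_right_mono)
  then show ?thesis by (simp add: emeasure_eq_measure)
qed

lemma cell_fun_wL2:
  assumes "\<beta> > 0"
  shows "cell_fun \<beta> m i \<in> wL2 \<beta>"
proof -
  interpret finite_measure "wmeasure \<beta>" using assms by (rule finite_measure_wmeasure)
  have "integrable (wmeasure \<beta>) (\<lambda>t. indicator (cell m i) t / measure (wmeasure \<beta>) (cell m i))"
    by (intro Bochner_Integration.integrable_divide integrable_real_indicator) (auto simp: emeasure_eq_measure)
  then show ?thesis
    unfolding wL2_iff sq_integrable_def cell_fun_def[abs_def]
    by (auto simp: power_divide power2_eq_square indicator_times_eq_if[symmetric] indicator_inter_arith[symmetric])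
qed

lemma cell_fun_orthonormal:
  assumes "\<beta> > 0" "m > 0"
  shows "(\<integral>t. cell_fun \<beta> m i t * cell_fun \<beta> m j t \<partial>wmeasure \<beta>) = (if i = j then 1 else 0)"
proof -
  interpret finite_measure "wmeasure \<beta>" using assms by (rule_tac finite_measure_wmeasure)
  have "cell_fun \<beta> m i t * cell_fun \<beta> m j t
      = (if i = j then indicator (cell m i) t / measure (wmeasure \<beta>) (cell m i) else 0)" for t
    by (auto simp: cell_fun_def cell_def indicator_def power2_eq_square[symmetric])
  then have "(\<integral>t. cell_fun \<beta> m i t * cell_fun \<beta> m j t \<partial>wmeasure \<beta>)
      = (\<integral>t. (if i = j then indicator (cell m i) t / measure (wmeasure \<beta>) (cell m i) else 0) \<partial>wmeasure \<beta>)"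
    by (simp only:)
  then show ?thesis
    using measure_cell_pos[OF assms, of i] by (cases "i = j") simp_all
qed

lemma coef_eq: "f \<in> wL2 \<beta> \<Longrightarrow> coef \<beta> m i f = (\<integral>t. f t * cell_fun \<beta> m i t \<partial>wmeasure \<beta>)"
  unfolding coef_def by (rule winner_eq) (auto intro: wL2_measurable)

lemma cell_avg_wL2: "\<beta> > 0 \<Longrightarrow> cell_avg \<beta> m f \<in> wL2 \<beta>"
  unfolding cell_avg_def[abs_def] wL2_iff
  by (intro sq_integrable_sum sq_integrable_cmult) (auto simp: wL2_iff[symmetric] cell_fun_wL2)

lemma cell_avg_Bessel:
  assumes "\<beta> > 0" "m > 0" "f \<in> wL2 \<beta>"
  shows "(wnorm \<beta> (\<lambda>t. f t - cell_avg \<beta> m f t))\<^sup>2 = (wnorm \<beta> f)\<^sup>2 - (\<Sum>i\<in>cells m. (coef \<beta> m i f)\<^sup>2)"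
proof -
  have [measurable]: "f \<in> borel_measurable borel" "cell_avg \<beta> m f \<in> borel_measurable borel"
    using assms cell_avg_wL2 by (auto simp: wL2_def)
  have "(\<integral>x. (f x - (\<Sum>i\<in>cells m. (\<integral>y. f y * cell_fun \<beta> m i y \<partial>wmeasure \<beta>) * cell_fun \<beta> m i x))\<^sup>2 \<partial>wmeasure \<beta>)
    = (\<integral>x. (f x)\<^sup>2 \<partial>wmeasure \<beta>) - (\<Sum>i\<in>cells m. (\<integral>y. f y * cell_fun \<beta> m i y \<partial>wmeasure \<beta>)\<^sup>2)"
    by (rule Bessel_identity)
      (use assms in \<open>auto simp: wL2_iff[symmetric] cell_fun_wL2 cell_fun_orthonormal\<close>)
  then show ?thesis
    using assms by (simp add: wnorm_square cell_avg_def coef_eq)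
qed

lemma Bessel_inequality:
  assumes "\<beta> > 0" "m > 0" "f \<in> wL2 \<beta>"
  shows "(\<Sum>i\<in>cells m. (coef \<beta> m i f)\<^sup>2) \<le> (wnorm \<beta> f)\<^sup>2"
  using cell_avg_Bessel[OF assms] zero_le_power2[of "wnorm \<beta> (\<lambda>t. f t - cell_avg \<beta> m f t)"] by linarith

lemma cell_avg_diff:
  assumes "\<beta> > 0" "f \<in> wL2 \<beta>" "g \<in> wL2 \<beta>"
  shows "cell_avg \<beta> m (\<lambda>t. f t - g t) t = cell_avg \<beta> m f t - cell_avg \<beta> m g t"
proof -
  have "coef \<beta> m i (\<lambda>t. f t - g t) = coef \<beta> m i f - coef \<beta> m i g" for i
    using assms sq_integrable_mult[of "wmeasure \<beta>" _ "cell_fun \<beta> m i"]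
      cell_fun_wL2[OF assms(1), of m i]
    by (simp add: coef_eq wL2_iff sq_integrable_diff left_diff_distrib)
  then show ?thesis
    by (simp add: cell_avg_def left_diff_distrib sum_subtractf)
qed

text \<open>On the cell of \<open>t\<close> the projection is constant and equals the weighted mean
  of \<open>g\<close> there, so it inherits every bound valid on the cell. Taking
  \<open>a = 0\<close> gives boundedness, and \<open>a = g t\<close> gives pointwise
  convergence.\<close>

lemma cell_avg_near:
  assumes \<beta>: "\<beta> > 0" "m > 0" and g: "g \<in> wL2 \<beta>"
    and i: "\<lfloor>real m * t\<rfloor> \<in> cells m"
    and near: "\<And>s. s \<in> cell m \<lfloor>real m * t\<rfloor> \<Longrightarrow> \<bar>g s - a\<bar> \<le> \<epsilon>"
  shows "\<bar>cell_avg \<beta> m g t - a\<bar> \<le> \<epsilon>"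
proof -
  interpret finite_measure "wmeasure \<beta>" using \<beta> by (rule_tac finite_measure_wmeasure)
  define i where "i = \<lfloor>real m * t\<rfloor>"
  define p where "p = measure (wmeasure \<beta>) (cell m i)"
  have p: "p > 0" unfolding p_def by (rule measure_cell_pos[OF \<beta>])
  have [measurable]: "g \<in> borel_measurable borel" using g by (auto simp: wL2_def)
  have int_c: "integrable (wmeasure \<beta>) (\<lambda>s. c * indicator (cell m i) s)" for c :: real
    by (intro integrable_mult_right integrable_real_indicator) (auto simp: emeasure_eq_measure)
  have int_g: "integrable (wmeasure \<beta>) (\<lambda>s. g s * indicator (cell m i) s)"
  proof -
    have "integrable (wmeasure \<beta>) (\<lambda>s. sqrt p * (g s * cell_fun \<beta> m i s))"
      by (intro integrable_mult_right sq_integrable_mult) (use g \<beta> in \<open>auto simp: wL2_iff[symmetric] cell_fun_wL2\<close>)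
    then show ?thesis using p by (simp add: cell_fun_def p_def[symmetric] mult.assoc)
  qed
  have "cell_avg \<beta> m g t = coef \<beta> m i g * cell_fun \<beta> m i t"
  proof -
    have "cell_avg \<beta> m g t = (\<Sum>j\<in>cells m. if j = i then coef \<beta> m i g * cell_fun \<beta> m i t else 0)"
      unfolding cell_avg_def by (rule sum.cong) (auto simp: cell_fun_def cell_def i_def)
    also have "\<dots> = coef \<beta> m i g * cell_fun \<beta> m i t"
      using i by (simp add: i_def)
    finally show ?thesis .
  qed
  also have "\<dots> = (\<integral>s. g s * indicator (cell m i) s \<partial>wmeasure \<beta>) / p"
  proof -
    have "t \<in> cell m i" by (simp add: cell_def i_def)
    then show ?thesis using g p by (simp add: coef_eq cell_fun_def p_def[symmetric])
  qed
  finally have "cell_avg \<beta> m g t - a = (\<integral>s. (g s - a) * indicator (cell m i) s \<partial>wmeasure \<beta>) / p"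
    using p int_g int_c[of a] by (simp add: left_diff_distrib diff_divide_distrib p_def)
  also have "\<bar>\<dots>\<bar> \<le> (\<integral>s. \<bar>(g s - a) * indicator (cell m i) s\<bar> \<partial>wmeasure \<beta>) / p"
    using p by (simp add: divide_right_mono)
  also have "(\<integral>s. \<bar>(g s - a) * indicator (cell m i) s\<bar> \<partial>wmeasure \<beta>) \<le> (\<integral>s. \<epsilon> * indicator (cell m i) s \<partial>wmeasure \<beta>)"
    using int_g int_c[of a] int_c[of \<epsilon>] near
    by (intro integral_mono) (auto simp: left_diff_distrib i_def split: split_indicator)
  also have "\<dots> = \<epsilon> * p" by (simp add: p_def)
  finally show ?thesis using p by (simp add: divide_right_mono)
qed

lemma bounded_wL2:
  assumes "\<beta> > 0" "g \<in> borel_measurable borel" "\<And>t. \<bar>g t\<bar> \<le> B"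
  shows "g \<in> wL2 \<beta>"
proof -
  have "(\<lambda>t. B * exp (0 * \<bar>t\<bar> + 0 * t\<^sup>2)) \<in> wL2 \<beta>"
    using exp_quadratic_in_wL2[of 0 \<beta> 0] assms(1) unfolding wL2_iff by (intro sq_integrable_cmult) auto
  then show ?thesis unfolding wL2_iff
    by (rule sq_integrable_bound) (use assms in \<open>auto intro: order.trans[OF _ abs_ge_self]\<close>)
qed

lemma cell_avg_bounded:
  assumes \<beta>: "\<beta> > 0" "m > 0" and g: "g \<in> borel_measurable borel" "\<And>t. \<bar>g t\<bar> \<le> B"
  shows "\<bar>cell_avg \<beta> m g t\<bar> \<le> B"
proof (cases "\<lfloor>real m * t\<rfloor> \<in> cells m")
  case True
  then show ?thesis
    using cell_avg_near[OF \<beta> bounded_wL2[OF \<beta>(1) g] True, of 0 B] g by simp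
next
  case False
  then have "cell_avg \<beta> m g t = 0"
    unfolding cell_avg_def by (intro sum.neutral) (auto simp: cell_fun_def cell_def indicator_def)
  then show ?thesis using g(2)[of 0] by simp
qed

lemma cell_avg_continuous:
  assumes \<beta>: "\<beta> > 0" and g: "continuous_on UNIV g" "\<And>t. \<bar>g t\<bar> \<le> B"
  shows "(\<lambda>m. cell_avg \<beta> m g t) \<longlonglongrightarrow> g t"
proof (rule LIMSEQ_I)
  fix r :: real assume "r > 0"
  have gb: "g \<in> borel_measurable borel" using g(1) by (rule borel_measurable_continuous_onI)
  have "isCont g t" using g(1) by (simp add: continuous_on_eq_continuous_at)
  then obtain \<delta> where \<delta>: "\<delta> > 0" "\<And>s. dist s t < \<delta> \<Longrightarrow> dist (g s) (g t) < r / 2"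
    using \<open>r > 0\<close> unfolding continuous_at_eps_delta by (metis half_gt_zero)
  \<comment> \<open>The first bound makes cells shorter than \<open>\<delta>\<close>; the second
    puts \<open>t\<close> into the window, with one unit to spare for rounding.\<close>
  obtain k :: nat where k: "real k > 1 / \<delta>" "real k > \<bar>t\<bar> + 1"
    using reals_Archimedean2[of "max (1/\<delta>) (\<bar>t\<bar> + 1)"] by auto
  show "\<exists>no. \<forall>m\<ge>no. norm (cell_avg \<beta> m g t - g t) < r"
  proof (intro exI allI impI)
    fix m assume "m \<ge> k"
    then have m: "real m > 1 / \<delta>" "real m > \<bar>t\<bar> + 1" using k by linarith+
    then have m0: "m > 0" by (cases m) auto
    have "real m * (\<bar>t\<bar> + 1) \<le> real m * real m"
      using m by (intro mult_left_mono) auto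
    then have "\<bar>real m * t\<bar> + real m \<le> (real m)\<^sup>2"
      by (simp add: abs_mult power2_eq_square distrib_left)
    moreover have "real m \<ge> 1" using m0 by simp
    ultimately have "\<bar>real m * t\<bar> + 1 \<le> (real m)\<^sup>2" by linarith
    then have "\<bar>real_of_int \<lfloor>real m * t\<rfloor>\<bar> \<le> (real m)\<^sup>2" by linarith
    then have "real_of_int \<bar>\<lfloor>real m * t\<rfloor>\<bar> \<le> real_of_int ((int m)\<^sup>2)" by simp
    then have "\<bar>\<lfloor>real m * t\<rfloor>\<bar> \<le> (int m)\<^sup>2" by (simp only: of_int_le_iff)
    then have i: "\<lfloor>real m * t\<rfloor> \<in> cells m" by (auto simp: cells_def)
    have "\<bar>cell_avg \<beta> m g t - g t\<bar> \<le> r / 2"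
    proof (rule cell_avg_near[OF \<beta> m0 bounded_wL2[OF \<beta> gb g(2)] i])
      fix s assume "s \<in> cell m \<lfloor>real m * t\<rfloor>"
      then have "\<bar>real m * s - real m * t\<bar> < 1" by (auto simp: cell_def) linarith
      then have "real m * \<bar>s - t\<bar> < 1" by (simp add: right_diff_distrib[symmetric] abs_mult)
      moreover have "real m * \<delta> > 1" using m(1) \<delta>(1) by (simp add: field_simps)
      ultimately have "real m * \<bar>s - t\<bar> < real m * \<delta>" by linarith
      then have "\<bar>s - t\<bar> < \<delta>" using m0 by simp
      then show "\<bar>g s - g t\<bar> \<le> r / 2" using \<delta>(2)[of s] by (simp add: dist_real_def)
    qed
    then show "norm (cell_avg \<beta> m g t - g t) < r" using \<open>r > 0\<close> by simp
  qed
qed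

lemma cell_avg_continuous_L2:
  assumes \<beta>: "\<beta> > 0" and g: "continuous_on UNIV g" "\<And>t. \<bar>g t\<bar> \<le> B"
  shows "(\<lambda>m. wnorm \<beta> (\<lambda>t. g t - cell_avg \<beta> m g t)) \<longlonglongrightarrow> 0"
proof -
  interpret finite_measure "wmeasure \<beta>" using \<beta> by (rule finite_measure_wmeasure)
  have gb [measurable]: "g \<in> borel_measurable borel" using g(1) by (rule borel_measurable_continuous_onI)
  have [measurable]: "cell_avg \<beta> m g \<in> borel_measurable borel" for m
    using cell_avg_wL2[OF \<beta>] by (auto simp: wL2_def)
  \<comment> \<open>The index is shifted because the cells are intervals of positive measure only
    for a positive parameter.\<close>
  have "(\<lambda>m. \<integral>t. (g t - cell_avg \<beta> (Suc m) g t)\<^sup>2 \<partial>wmeasure \<beta>) \<longlonglongrightarrow> (\<integral>t. 0 \<partial>wmeasure \<beta>)"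
  proof (rule integral_dominated_convergence[where w = "\<lambda>_. (2 * B)\<^sup>2"])
    show "AE t in wmeasure \<beta>. (\<lambda>m. (g t - cell_avg \<beta> (Suc m) g t)\<^sup>2) \<longlonglongrightarrow> 0"
    proof (intro AE_I2)
      fix t
      have "(\<lambda>m. (g t - cell_avg \<beta> (Suc m) g t)\<^sup>2) \<longlonglongrightarrow> (g t - g t)\<^sup>2"
        by (intro tendsto_intros LIMSEQ_Suc cell_avg_continuous[OF \<beta> g])
      then show "(\<lambda>m. (g t - cell_avg \<beta> (Suc m) g t)\<^sup>2) \<longlonglongrightarrow> 0" by simp
    qed
    show "AE t in wmeasure \<beta>. norm ((g t - cell_avg \<beta> (Suc m) g t)\<^sup>2) \<le> (2 * B)\<^sup>2" for m
    proof (intro AE_I2)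
      fix t
      have "\<bar>g t - cell_avg \<beta> (Suc m) g t\<bar> \<le> 2 * B"
        using g(2)[of t] cell_avg_bounded[OF \<beta> _ gb g(2), of "Suc m" t] by linarith
      then show "norm ((g t - cell_avg \<beta> (Suc m) g t)\<^sup>2) \<le> (2 * B)\<^sup>2"
        using abs_le_square_iff[of "g t - cell_avg \<beta> (Suc m) g t" "2 * B"] by simp
    qed
  qed auto
  then have "(\<lambda>m. sqrt (\<integral>t. (g t - cell_avg \<beta> (Suc m) g t)\<^sup>2 \<partial>wmeasure \<beta>)) \<longlonglongrightarrow> sqrt 0"
    by (intro tendsto_real_sqrt) simp
  then have "(\<lambda>m. wnorm \<beta> (\<lambda>t. g t - cell_avg \<beta> (Suc m) g t)) \<longlonglongrightarrow> 0"
    by (simp add: wnorm_eq)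
  then show ?thesis by (rule LIMSEQ_imp_Suc)
qed

section \<open>Density of continuous functions and convergence of the projections\<close>

lemma wnorm_triangle_diff:
  assumes "f \<in> wL2 \<beta>" "g \<in> wL2 \<beta>" "h \<in> wL2 \<beta>"
  shows "wnorm \<beta> (\<lambda>t. f t - h t) \<le> wnorm \<beta> (\<lambda>t. f t - g t) + wnorm \<beta> (\<lambda>t. g t - h t)"
proof -
  have [measurable]: "f \<in> borel_measurable borel" "g \<in> borel_measurable borel" "h \<in> borel_measurable borel"
    using assms by (auto simp: wL2_def)
  show ?thesis
    using L2_triangle[of "wmeasure \<beta>" "\<lambda>t. f t - g t" "\<lambda>t. g t - h t"] assms
    by (simp add: wnorm_eq wL2_iff sq_integrable_diff)
qed

lemma truncation_approximation:
  assumes \<beta>: "\<beta> > 0" and f: "f \<in> wL2 \<beta>" and "\<epsilon> > 0"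
  obtains B where "wnorm \<beta> (\<lambda>t. f t - max (- B) (min B (f t))) < \<epsilon>" "B > 0"
proof -
  have [measurable]: "f \<in> borel_measurable borel" using f by (auto simp: wL2_def)
  have "(\<lambda>n. \<integral>t. (f t - max (- real n) (min (real n) (f t)))\<^sup>2 \<partial>wmeasure \<beta>) \<longlonglongrightarrow> (\<integral>t. 0 \<partial>wmeasure \<beta>)"
  proof (rule integral_dominated_convergence[where w = "\<lambda>t. (f t)\<^sup>2"])
    show "AE t in wmeasure \<beta>. (\<lambda>n. (f t - max (- real n) (min (real n) (f t)))\<^sup>2) \<longlonglongrightarrow> 0"
    proof (intro AE_I2 tendsto_eventually)
      fix t
      obtain k :: nat where "\<bar>f t\<bar> < real k" using reals_Archimedean2 by blast
      then show "eventually (\<lambda>n. (f t - max (- real n) (min (real n) (f t)))\<^sup>2 = 0) sequentially"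
        by (intro eventually_sequentiallyI[of k]) (auto simp: max_def min_def)
    qed
    show "AE t in wmeasure \<beta>. norm ((f t - max (- real n) (min (real n) (f t)))\<^sup>2) \<le> (f t)\<^sup>2" for n
      by (intro AE_I2) (auto simp: abs_le_square_iff[symmetric] max_def min_def)
    show "integrable (wmeasure \<beta>) (\<lambda>t. (f t)\<^sup>2)"
      using f by (auto simp: wL2_iff sq_integrable_def)
  qed auto
  then have "(\<lambda>n. sqrt (\<integral>t. (f t - max (- real n) (min (real n) (f t)))\<^sup>2 \<partial>wmeasure \<beta>)) \<longlonglongrightarrow> sqrt 0"
    by (intro tendsto_real_sqrt) simp
  then have "(\<lambda>n. wnorm \<beta> (\<lambda>t. f t - max (- real n) (min (real n) (f t)))) \<longlonglongrightarrow> 0"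
    by (simp add: wnorm_eq)
  then have "eventually (\<lambda>n. wnorm \<beta> (\<lambda>t. f t - max (- real n) (min (real n) (f t))) < \<epsilon>) sequentially"
    using \<open>\<epsilon> > 0\<close> by (rule order_tendstoD)
  then have "eventually (\<lambda>n. wnorm \<beta> (\<lambda>t. f t - max (- real n) (min (real n) (f t))) < \<epsilon> \<and> n > 0) sequentially"
    using eventually_gt_at_top[of 0] by (rule eventually_conj)
  then obtain n where "wnorm \<beta> (\<lambda>t. f t - max (- real n) (min (real n) (f t))) < \<epsilon>" "n > 0"
    unfolding eventually_sequentially by blast
  then show ?thesis using that[of "real n"] by simp
qed

text \<open>Truncation comes first. A measurable function is almost everywhere a limit of continuous
  ones, and cutting these off at the same level keeps the limit while supplying the constant that
  dominates.\<close>

lemma continuous_approximation: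
  assumes \<beta>: "\<beta> > 0" and f: "f \<in> wL2 \<beta>" and "\<epsilon> > 0"
  obtains g B where "continuous_on UNIV g" "\<And>t. \<bar>g t\<bar> \<le> B" "wnorm \<beta> (\<lambda>t. f t - g t) < \<epsilon>"
proof -
  interpret finite_measure "wmeasure \<beta>" using \<beta> by (rule finite_measure_wmeasure)
  have fb [measurable]: "f \<in> borel_measurable borel" using f by (auto simp: wL2_def)
  obtain B where B: "wnorm \<beta> (\<lambda>t. f t - max (- B) (min B (f t))) < \<epsilon> / 2" "B > 0"
    using truncation_approximation[OF \<beta> f, of "\<epsilon> / 2"] \<open>\<epsilon> > 0\<close> by auto
  define F where "F t = max (- B) (min B (f t))" for t
  have [measurable]: "F \<in> borel_measurable borel" unfolding F_def[abs_def] by measurable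
  \<comment> \<open>By definition this yields continuous functions converging to \<open>f\<close>
    off a negligible set.\<close>
  have "f measurable_on UNIV"
    by (rule lebesgue_measurable_imp_measurable_on) (use fb in \<open>auto intro: measurable_completion\<close>)
  then obtain N g where N: "negligible N" and g: "\<And>n. continuous_on UNIV (g n)"
    and lim: "\<And>x. x \<notin> N \<Longrightarrow> (\<lambda>n. g n x) \<longlonglongrightarrow> f x"
    unfolding measurable_on_def by auto
  define G where "G n t = max (- B) (min B (g n t))" for n t
  have Gc: "continuous_on UNIV (G n)" for n
    unfolding G_def by (intro continuous_intros g)
  have GB: "\<bar>G n t\<bar> \<le> B" and FB: "\<bar>F t\<bar> \<le> B" for n t
    using \<open>B > 0\<close> by (auto simp: G_def F_def max_def min_def)
  have [measurable]: "G n \<in> borel_measurable borel" for n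
    using Gc by (rule borel_measurable_continuous_onI)
  have "(\<lambda>n. \<integral>t. (F t - G n t)\<^sup>2 \<partial>wmeasure \<beta>) \<longlonglongrightarrow> (\<integral>t. 0 \<partial>wmeasure \<beta>)"
  proof (rule integral_dominated_convergence[where w = "\<lambda>_. (2 * B)\<^sup>2"])
    have "AE t in lebesgue. t \<notin> N"
      using N by (simp add: negligible_iff_null_sets AE_not_in)
    then have "AE t in lborel. t \<notin> N" by (simp add: AE_completion_iff)
    then have "AE t in wmeasure \<beta>. t \<notin> N"
      unfolding wmeasure_def by (subst AE_density) (auto elim: eventually_mono)
    then show "AE t in wmeasure \<beta>. (\<lambda>n. (F t - G n t)\<^sup>2) \<longlonglongrightarrow> 0"
    proof eventually_elim
      case (elim t)
      have "(\<lambda>n. (F t - G n t)\<^sup>2) \<longlonglongrightarrow> (F t - F t)\<^sup>2"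
        unfolding F_def G_def by (intro tendsto_intros lim elim)
      then show ?case by simp
    qed
    show "AE t in wmeasure \<beta>. norm ((F t - G n t)\<^sup>2) \<le> (2 * B)\<^sup>2" for n
    proof (intro AE_I2)
      fix t
      have "\<bar>F t - G n t\<bar> \<le> 2 * B"
        using GB[of n t] FB[of t] by linarith
      then show "norm ((F t - G n t)\<^sup>2) \<le> (2 * B)\<^sup>2"
        using abs_le_square_iff[of "F t - G n t" "2 * B"] by simp
    qed
  qed auto
  then have "(\<lambda>n. sqrt (\<integral>t. (F t - G n t)\<^sup>2 \<partial>wmeasure \<beta>)) \<longlonglongrightarrow> sqrt 0"
    by (intro tendsto_real_sqrt) simp
  then have "(\<lambda>n. wnorm \<beta> (\<lambda>t. F t - G n t)) \<longlonglongrightarrow> 0"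
    by (simp add: wnorm_eq)
  then have "eventually (\<lambda>n. wnorm \<beta> (\<lambda>t. F t - G n t) < \<epsilon> / 2) sequentially"
    using \<open>\<epsilon> > 0\<close> by (intro order_tendstoD) auto
  then obtain n where n: "wnorm \<beta> (\<lambda>t. F t - G n t) < \<epsilon> / 2"
    unfolding eventually_sequentially by blast
  have "wnorm \<beta> (\<lambda>t. f t - G n t) \<le> wnorm \<beta> (\<lambda>t. f t - F t) + wnorm \<beta> (\<lambda>t. F t - G n t)"
    by (intro wnorm_triangle_diff f bounded_wL2[OF \<beta> _ GB] bounded_wL2[OF \<beta> _ FB]) auto
  also have "\<dots> < \<epsilon>" using B(1) n by (simp add: F_def)
  finally show ?thesis by (rule that[OF Gc GB])
qed

text \<open>The map sending \<open>f\<close> to its projection error is linear and, by Bessel, a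
  contraction for positive \<open>m\<close>. Convergence therefore extends from the dense class of
  bounded continuous functions to the whole space.\<close>

theorem cell_avg_tendsto:
  assumes \<beta>: "\<beta> > 0" and f: "f \<in> wL2 \<beta>"
  shows "(\<lambda>m. wnorm \<beta> (\<lambda>t. f t - cell_avg \<beta> m f t)) \<longlonglongrightarrow> 0"
proof (rule LIMSEQ_I)
  fix r :: real assume "r > 0"
  obtain g B where g: "continuous_on UNIV g" "\<And>t. \<bar>g t\<bar> \<le> B" and fg: "wnorm \<beta> (\<lambda>t. f t - g t) < r / 2"
    using continuous_approximation[OF \<beta> f, of "r / 2"] \<open>r > 0\<close> by auto
  have gL: "g \<in> wL2 \<beta>" by (intro bounded_wL2[OF \<beta> _ g(2)] borel_measurable_continuous_onI g)
  have fgL: "(\<lambda>t. f t - g t) \<in> wL2 \<beta>" using f gL by (simp add: wL2_iff sq_integrable_diff)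
  have pos: "wnorm \<beta> h \<ge> 0" if "h \<in> wL2 \<beta>" for h
    using that by (simp add: wnorm_eq wL2_measurable)
  obtain M where M: "\<And>m. m \<ge> M \<Longrightarrow> wnorm \<beta> (\<lambda>t. g t - cell_avg \<beta> m g t) < r / 2"
    using order_tendstoD(2)[OF cell_avg_continuous_L2[OF \<beta> g], of "r / 2"] \<open>r > 0\<close>
    unfolding eventually_sequentially by auto
  show "\<exists>no. \<forall>m\<ge>no. norm (wnorm \<beta> (\<lambda>t. f t - cell_avg \<beta> m f t) - 0) < r"
  proof (intro exI allI impI)
    fix m assume m: "m \<ge> Suc M"
    let ?d = "\<lambda>t. f t - g t"
    have "(wnorm \<beta> (\<lambda>t. ?d t - cell_avg \<beta> m ?d t))\<^sup>2 \<le> (wnorm \<beta> ?d)\<^sup>2"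
      using cell_avg_Bessel[OF \<beta> _ fgL, of m] m sum_nonneg[of "cells m" "\<lambda>i. (coef \<beta> m i ?d)\<^sup>2"] by simp
    then have 1: "wnorm \<beta> (\<lambda>t. ?d t - cell_avg \<beta> m ?d t) \<le> wnorm \<beta> ?d"
      by (rule power2_le_imp_le) (rule pos[OF fgL])
    have fmL: "(\<lambda>t. f t - cell_avg \<beta> m f t) \<in> wL2 \<beta>"
      and gmL: "(\<lambda>t. g t - cell_avg \<beta> m g t) \<in> wL2 \<beta>"
      using f gL cell_avg_wL2[OF \<beta>] by (simp_all add: wL2_iff sq_integrable_diff)
    have "wnorm \<beta> (\<lambda>t. (f t - cell_avg \<beta> m f t) - 0) \<le>
        wnorm \<beta> (\<lambda>t. (f t - cell_avg \<beta> m f t) - (g t - cell_avg \<beta> m g t)) + wnorm \<beta> (\<lambda>t. (g t - cell_avg \<beta> m g t) - 0)"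
      by (rule wnorm_triangle_diff[OF fmL gmL]) (simp add: wL2_iff sq_integrable_zero)
    also have "(\<lambda>t. (f t - cell_avg \<beta> m f t) - (g t - cell_avg \<beta> m g t)) = (\<lambda>t. ?d t - cell_avg \<beta> m ?d t)"
      by (simp add: cell_avg_diff[OF \<beta> f gL] fun_eq_iff)
    finally have "wnorm \<beta> (\<lambda>t. f t - cell_avg \<beta> m f t) < r"
      using 1 fg M[of m] m by simp
    then show "norm (wnorm \<beta> (\<lambda>t. f t - cell_avg \<beta> m f t) - 0) < r"
      using pos[OF fmL] by simp
  qed
qed

text \<open>The orthonormal systems for different \<open>m\<close> are not nested, so this is not a
  series expansion in one basis; convergence rests on the projection error alone.\<close>

corollary Parseval_cells:
  assumes \<beta>: "\<beta> > 0" and f: "f \<in> wL2 \<beta>"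
  shows "(\<lambda>m. \<Sum>i\<in>cells (Suc m). (coef \<beta> (Suc m) i f)\<^sup>2) \<longlonglongrightarrow> (wnorm \<beta> f)\<^sup>2"
proof -
  have "(\<lambda>m. (wnorm \<beta> f)\<^sup>2 - (wnorm \<beta> (\<lambda>t. f t - cell_avg \<beta> (Suc m) f t))\<^sup>2) \<longlonglongrightarrow> (wnorm \<beta> f)\<^sup>2 - 0\<^sup>2"
    by (intro tendsto_intros LIMSEQ_Suc cell_avg_tendsto[OF \<beta> f])
  then show ?thesis using f by (simp add: cell_avg_Bessel[OF \<beta> _ f])
qed

section \<open>Laplace transforms\<close>

text \<open>Polynomials in \<open>exp (- T)\<close> approximate every continuous function of \<open>exp (- T)\<close> uniformly.\<close>

lemma weak_conv_of_Laplace: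
  fixes T :: "nat \<Rightarrow> 'a \<Rightarrow> real" and S :: "'b \<Rightarrow> real"
  assumes M: "prob_space M" and N: "prob_space N"
    and T [measurable]: "\<And>n. T n \<in> borel_measurable M" and S [measurable]: "S \<in> borel_measurable N"
    and T0: "\<And>n \<omega>. 0 \<le> T n \<omega>" and S0: "\<And>\<omega>. 0 \<le> S \<omega>"
    and lim: "\<And>k::nat. (\<lambda>n. \<integral>\<omega>. exp (- real k * T n \<omega>) \<partial>M) \<longlonglongrightarrow> (\<integral>\<omega>. exp (- real k * S \<omega>) \<partial>N)"
  shows "weak_conv_m (\<lambda>n. distr M borel (T n)) (distr N borel S)"
proof (rule integral_cts_step_conv_imp_weak_conv)
  interpret M: prob_space M by fact
  interpret N: prob_space N by fact
  show "real_distribution (distr M borel (T n))" for n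
    by (rule M.real_distribution_distr) simp
  show "real_distribution (distr N borel S)"
    by (rule N.real_distribution_distr) simp
  fix x y :: real assume xy: "x < y"
  have cts_cont: "continuous_on UNIV (cts_step x y)"
    using cts_step_uniformly_continuous[OF xy] by (rule uniformly_continuous_imp_continuous)
  then have [measurable]: "cts_step x y \<in> borel_measurable borel"
    by (rule borel_measurable_continuous_onI)
  \<comment> \<open>The step function rewritten in the variable \<open>u = exp (- s)\<close>. The
    maximum keeps the logarithm away from 0 and changes no value, since \<open>cts_step x y\<close>
    already vanishes from \<open>y\<close> on; this makes \<open>\<phi>\<close> continuous up to
    \<open>u = 0\<close>.\<close>
  define \<phi> where "\<phi> u = cts_step x y (- ln (max u (exp (- y))))" for u
  have \<phi>_eq: "\<phi> (exp (- s)) = cts_step x y s" for s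
    using xy by (cases "s \<le> y") (auto simp: \<phi>_def max_def cts_step_def)
  have "continuous_on {0..1} \<phi>"
    unfolding \<phi>_def
    by (intro continuous_on_compose2[OF cts_cont] continuous_intros) (auto simp: max_def)
  then have \<phi>_approx: "\<exists>p. real_polynomial_function p \<and> (\<forall>u\<in>{0..1}. \<bar>\<phi> u - p u\<bar> < e)" if "e > 0" for e
    using Stone_Weierstrass_real_polynomial_function[of "{0..1}" \<phi> e] that
    by (metis compact_Icc)
  have expT: "exp (- T n \<omega>) \<in> {0..1}" and expS: "exp (- S \<omega>') \<in> {0..1}" for n \<omega> \<omega>'
    using T0 S0 by auto
  have int_exp: "integrable M (\<lambda>\<omega>. exp (- real k * T n \<omega>))"
    and int_exp': "integrable N (\<lambda>\<omega>. exp (- real k * S \<omega>))" for n k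
    by (rule M.integrable_const_bound[of _ 1], simp add: T0, simp)
      (rule N.integrable_const_bound[of _ 1], simp add: S0, simp)
  have int_cts: "integrable M (\<lambda>\<omega>. cts_step x y (T n \<omega>))"
    and int_cts': "integrable N (\<lambda>\<omega>. cts_step x y (S \<omega>))" for n
    by (rule M.integrable_const_bound[of _ 1], simp add: cts_step_def, simp)
      (rule N.integrable_const_bound[of _ 1], simp add: cts_step_def, simp)
  have lim_cts: "(\<lambda>n. \<integral>\<omega>. cts_step x y (T n \<omega>) \<partial>M) \<longlonglongrightarrow> (\<integral>\<omega>. cts_step x y (S \<omega>) \<partial>N)"
  proof (rule LIMSEQ_I)
    fix r :: real assume "r > 0"
    then obtain p where "real_polynomial_function p" and p: "\<And>u. u \<in> {0..1} \<Longrightarrow> \<bar>\<phi> u - p u\<bar> < r / 3"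
      using \<phi>_approx[of "r / 3"] by auto
    \<comment> \<open>Monomials in \<open>exp (- T)\<close> are exponentials with integer rate,
      which is why the hypothesis asks for integer \<open>k\<close> only.\<close>
    then obtain a d where p_eq: "p = (\<lambda>u. \<Sum>i\<le>d. a i * u ^ i)"
      unfolding real_polynomial_function_iff_sum by auto
    have pT: "p (exp (- T n \<omega>)) = (\<Sum>i\<le>d. a i * exp (- real i * T n \<omega>))"
      and pS: "p (exp (- S \<omega>')) = (\<Sum>i\<le>d. a i * exp (- real i * S \<omega>'))" for n \<omega> \<omega>'
      by (simp_all add: p_eq exp_of_nat_mult[symmetric])
    have int_pT: "integrable M (\<lambda>\<omega>. p (exp (- T n \<omega>)))"
      and int_pS: "integrable N (\<lambda>\<omega>. p (exp (- S \<omega>)))" for n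
      unfolding pT pS by (intro Bochner_Integration.integrable_sum integrable_mult_right int_exp int_exp')+
    have "(\<lambda>n. \<integral>\<omega>. p (exp (- T n \<omega>)) \<partial>M) \<longlonglongrightarrow> (\<integral>\<omega>. p (exp (- S \<omega>)) \<partial>N)"
      unfolding pT pS using lim
      by (simp add: int_exp[simplified] int_exp'[simplified] tendsto_intros)
    then obtain n0 where n0: "\<And>n. n \<ge> n0 \<Longrightarrow>
        \<bar>(\<integral>\<omega>. p (exp (- T n \<omega>)) \<partial>M) - (\<integral>\<omega>. p (exp (- S \<omega>)) \<partial>N)\<bar> < r / 3"
      using \<open>r > 0\<close> LIMSEQ_D[of _ _ "r / 3"] by fastforce
    have 1: "\<bar>(\<integral>\<omega>. cts_step x y (T n \<omega>) \<partial>M) - (\<integral>\<omega>. p (exp (- T n \<omega>)) \<partial>M)\<bar> \<le> r / 3" for n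
    proof -
      have "\<bar>(\<integral>\<omega>. cts_step x y (T n \<omega>) \<partial>M) - (\<integral>\<omega>. p (exp (- T n \<omega>)) \<partial>M)\<bar>
        = \<bar>\<integral>\<omega>. cts_step x y (T n \<omega>) - p (exp (- T n \<omega>)) \<partial>M\<bar>"
        by (simp add: int_cts int_pT)
      also have "\<dots> \<le> (\<integral>\<omega>. \<bar>cts_step x y (T n \<omega>) - p (exp (- T n \<omega>))\<bar> \<partial>M)"
        by (rule integral_abs_bound)
      also have "\<dots> \<le> (\<integral>\<omega>. r / 3 \<partial>M)"
        using p[OF expT] by (intro integral_mono) (auto simp: \<phi>_eq int_cts int_pT less_imp_le)
      also have "\<dots> = r / 3" by (simp add: M.prob_space)
      finally show ?thesis .
    qed
    have 2: "\<bar>(\<integral>\<omega>. cts_step x y (S \<omega>) \<partial>N) - (\<integral>\<omega>. p (exp (- S \<omega>)) \<partial>N)\<bar> \<le> r / 3"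
    proof -
      have "\<bar>(\<integral>\<omega>. cts_step x y (S \<omega>) \<partial>N) - (\<integral>\<omega>. p (exp (- S \<omega>)) \<partial>N)\<bar>
        = \<bar>\<integral>\<omega>. cts_step x y (S \<omega>) - p (exp (- S \<omega>)) \<partial>N\<bar>"
        by (simp add: int_cts' int_pS)
      also have "\<dots> \<le> (\<integral>\<omega>. \<bar>cts_step x y (S \<omega>) - p (exp (- S \<omega>))\<bar> \<partial>N)"
        by (rule integral_abs_bound)
      also have "\<dots> \<le> (\<integral>\<omega>. r / 3 \<partial>N)"
        using p[OF expS] by (intro integral_mono) (auto simp: \<phi>_eq int_cts' int_pS less_imp_le)
      also have "\<dots> = r / 3" by (simp add: N.prob_space)
      finally show ?thesis .
    qed
    show "\<exists>no. \<forall>n\<ge>no. norm ((\<integral>\<omega>. cts_step x y (T n \<omega>) \<partial>M) - (\<integral>\<omega>. cts_step x y (S \<omega>) \<partial>N)) < r"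
    proof (intro exI allI impI)
      fix n assume "n \<ge> n0"
      from n0[OF this] 1[of n] 2
      show "norm ((\<integral>\<omega>. cts_step x y (T n \<omega>) \<partial>M) - (\<integral>\<omega>. cts_step x y (S \<omega>) \<partial>N)) < r"
        unfolding real_norm_def by linarith
    qed
  qed
  then show "(\<lambda>n. integral\<^sup>L (distr M borel (T n)) (cts_step x y)) \<longlonglongrightarrow> integral\<^sup>L (distr N borel S) (cts_step x y)"
    by (simp add: integral_distr)
qed

section \<open>Gaussian randomisation of sums of squares\<close>

abbreviation gauss_PiM :: "'i set \<Rightarrow> ('i \<Rightarrow> real) measure" where
  "gauss_PiM J \<equiv> PiM J (\<lambda>_. std_normal_distribution)"

interpretation std_normal: prob_space std_normal_distribution
  by (rule prob_space_normal_density) simp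

lemma gauss_PiM_iexp:
  assumes J: "finite J"
  shows "(CLINT g|gauss_PiM J. iexp (s * (\<Sum>i\<in>J. g i * v i)))
    = complex_of_real (exp (- (s\<^sup>2 / 2) * (\<Sum>i\<in>J. (v i)\<^sup>2)))"
proof -
  interpret product_sigma_finite "\<lambda>_. std_normal_distribution" by unfold_locales
  have "(CLINT g|gauss_PiM J. iexp (s * (\<Sum>i\<in>J. g i * v i)))
      = (CLINT g|gauss_PiM J. (\<Prod>i\<in>J. iexp ((s * v i) * g i)))"
    using J by (simp add: exp_sum[symmetric] sum_distrib_left mult_ac)
  also have "\<dots> = (\<Prod>i\<in>J. CLINT x|std_normal_distribution. iexp ((s * v i) * x))"
    by (rule product_integral_prod[OF J])
      (auto intro!: std_normal.integrable_const_bound[where B = 1])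
  also have "\<dots> = (\<Prod>i\<in>J. char std_normal_distribution (s * v i))"
    by (simp add: char_def)
  also have "\<dots> = (\<Prod>i\<in>J. complex_of_real (exp (- (s * v i)\<^sup>2 / 2)))"
    by (simp add: char_std_normal_distribution)
  also have "\<dots> = complex_of_real (exp (\<Sum>i\<in>J. - (s * v i)\<^sup>2 / 2))"
    using J by (simp add: exp_sum)
  also have "(\<Sum>i\<in>J. - (s * v i)\<^sup>2 / 2) = - (s\<^sup>2 / 2) * (\<Sum>i\<in>J. (v i)\<^sup>2)"
    by (simp add: sum_distrib_left sum_negf power_mult_distrib)
  finally show ?thesis .
qed

text \<open>Independent Gaussian weights linearise the square in the exponent, so that only the
  characteristic functions of linear combinations are needed.\<close>

lemma Laplace_sum_squares:
  assumes M: "prob_space M" and J: "finite J" and V [measurable]: "\<And>i. i \<in> J \<Longrightarrow> V i \<in> borel_measurable M"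
  shows "complex_of_real (\<integral>\<omega>. exp (- (s\<^sup>2 / 2) * (\<Sum>i\<in>J. (V i \<omega>)\<^sup>2)) \<partial>M)
    = (CLINT g|gauss_PiM J. CLINT \<omega>|M. iexp (s * (\<Sum>i\<in>J. g i * V i \<omega>)))"
proof -
  interpret M: prob_space M by fact
  interpret G: prob_space "gauss_PiM J" by (rule prob_space_PiM) unfold_locales
  interpret P: pair_prob_space "gauss_PiM J" M by unfold_locales
  have "complex_of_real (\<integral>\<omega>. exp (- (s\<^sup>2 / 2) * (\<Sum>i\<in>J. (V i \<omega>)\<^sup>2)) \<partial>M)
      = (CLINT \<omega>|M. complex_of_real (exp (- (s\<^sup>2 / 2) * (\<Sum>i\<in>J. (V i \<omega>)\<^sup>2))))"
    by (rule integral_complex_of_real[symmetric])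
  also have "\<dots> = (CLINT \<omega>|M. CLINT g|gauss_PiM J. iexp (s * (\<Sum>i\<in>J. g i * V i \<omega>)))"
    by (simp only: gauss_PiM_iexp[OF J])
  also have "\<dots> = (CLINT g|gauss_PiM J. CLINT \<omega>|M. iexp (s * (\<Sum>i\<in>J. g i * V i \<omega>)))"
  proof (rule P.Fubini_integral)
    have [measurable]: "(\<lambda>x. fst x i) \<in> borel_measurable (gauss_PiM J \<Otimes>\<^sub>M M)" if "i \<in> J" for i
    proof -
      have "(\<lambda>x. fst x i) \<in> measurable (gauss_PiM J \<Otimes>\<^sub>M M) std_normal_distribution"
        using that by (intro measurable_compose[OF measurable_fst] measurable_component_singleton)
      then show ?thesis by simp
    qed
    show "integrable (gauss_PiM J \<Otimes>\<^sub>M M) (\<lambda>(g, \<omega>). iexp (s * (\<Sum>i\<in>J. g i * V i \<omega>)))"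
      unfolding split_beta'
      by (rule P.integrable_const_bound[where B = 1]) auto
  qed
  finally show ?thesis .
qed

text \<open>For a fixed weight vector \<open>g\<close> only the characteristic function of one
  linear combination has to converge. Characteristic functions are bounded by 1, so dominated
  convergence under the law of \<open>g\<close> yields the Laplace transforms. The limit
  \<open>\<Psi>\<close> is tied to \<open>U\<close>, which may live on another space.\<close>

lemma Laplace_sum_squares_tendsto:
  assumes M: "prob_space M" and J: "finite J"
    and V: "\<And>n i. i \<in> J \<Longrightarrow> V n i \<in> borel_measurable M"
    and lim: "\<And>g. (\<lambda>n. CLINT \<omega>|M. iexp (s * (\<Sum>i\<in>J. g i * V n i \<omega>))) \<longlonglongrightarrow> \<Psi> g"
    and N: "prob_space N" and U: "\<And>i. i \<in> J \<Longrightarrow> U i \<in> borel_measurable N"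
    and U_char: "\<And>g. (CLINT \<omega>|N. iexp (s * (\<Sum>i\<in>J. g i * U i \<omega>))) = \<Psi> g"
  shows "(\<lambda>n. \<integral>\<omega>. exp (- (s\<^sup>2 / 2) * (\<Sum>i\<in>J. (V n i \<omega>)\<^sup>2)) \<partial>M)
    \<longlonglongrightarrow> (\<integral>\<omega>. exp (- (s\<^sup>2 / 2) * (\<Sum>i\<in>J. (U i \<omega>)\<^sup>2)) \<partial>N)"
proof -
  interpret M: prob_space M by fact
  interpret G: prob_space "gauss_PiM J" by (rule prob_space_PiM) unfold_locales
  have comp: "(\<lambda>x. fst x i) \<in> borel_measurable (gauss_PiM J \<Otimes>\<^sub>M K)" if "i \<in> J" for i and K :: "'x measure"
  proof -
    have "(\<lambda>x. fst x i) \<in> measurable (gauss_PiM J \<Otimes>\<^sub>M K) std_normal_distribution"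
      using that by (intro measurable_compose[OF measurable_fst] measurable_component_singleton)
    then show ?thesis by simp
  qed
  have meas: "(\<lambda>g. CLINT \<omega>|K. iexp (s * (\<Sum>i\<in>J. g i * R i \<omega>))) \<in> borel_measurable (gauss_PiM J)"
    if "prob_space K" and [measurable]: "\<And>i. i \<in> J \<Longrightarrow> R i \<in> borel_measurable K"
    for K :: "'x measure" and R :: "_ \<Rightarrow> _ \<Rightarrow> real"
  proof -
    interpret K: prob_space K by fact
    note comp[measurable]
    show ?thesis
      by (rule K.borel_measurable_lebesgue_integral) (unfold split_beta', measurable)
  qed
  have "(\<lambda>n. CLINT g|gauss_PiM J. CLINT \<omega>|M. iexp (s * (\<Sum>i\<in>J. g i * V n i \<omega>)))
      \<longlonglongrightarrow> (CLINT g|gauss_PiM J. \<Psi> g)"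
  proof (rule integral_dominated_convergence[where w = "\<lambda>_. 1"])
    \<comment> \<open>Measurability of \<open>\<Psi>\<close> is inherited from \<open>U\<close>,
      whose characteristic function it is.\<close>
    show "\<Psi> \<in> borel_measurable (gauss_PiM J)"
      using meas[OF N, of U, OF U] unfolding U_char by this
    show "AE g in gauss_PiM J. norm (CLINT \<omega>|M. iexp (s * (\<Sum>i\<in>J. g i * V n i \<omega>))) \<le> 1" for n
    proof (intro AE_I2)
      fix g
      have "norm (CLINT \<omega>|M. iexp (s * (\<Sum>i\<in>J. g i * V n i \<omega>)))
          \<le> (\<integral>\<omega>. norm (iexp (s * (\<Sum>i\<in>J. g i * V n i \<omega>))) \<partial>M)"
        by (rule integral_norm_bound)
      then show "norm (CLINT \<omega>|M. iexp (s * (\<Sum>i\<in>J. g i * V n i \<omega>))) \<le> 1"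
        by (simp add: M.prob_space)
    qed
    show "(\<lambda>g. CLINT \<omega>|M. iexp (s * (\<Sum>i\<in>J. g i * V n i \<omega>))) \<in> borel_measurable (gauss_PiM J)" for n
      by (rule meas[OF M V])
    show "AE g in gauss_PiM J. (\<lambda>n. CLINT \<omega>|M. iexp (s * (\<Sum>i\<in>J. g i * V n i \<omega>))) \<longlonglongrightarrow> \<Psi> g"
      by (intro AE_I2 lim)
  qed simp
  moreover have "complex_of_real (\<integral>\<omega>. exp (- (s\<^sup>2 / 2) * (\<Sum>i\<in>J. (V n i \<omega>)\<^sup>2)) \<partial>M)
    = (CLINT g|gauss_PiM J. CLINT \<omega>|M. iexp (s * (\<Sum>i\<in>J. g i * V n i \<omega>)))" for n
    by (rule Laplace_sum_squares[OF M J V])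
  moreover have "complex_of_real (\<integral>\<omega>. exp (- (s\<^sup>2 / 2) * (\<Sum>i\<in>J. (U i \<omega>)\<^sup>2)) \<partial>N)
    = (CLINT g|gauss_PiM J. \<Psi> g)"
    unfolding U_char[symmetric] by (rule Laplace_sum_squares[OF N J U])
  ultimately have "(\<lambda>n. complex_of_real (\<integral>\<omega>. exp (- (s\<^sup>2 / 2) * (\<Sum>i\<in>J. (V n i \<omega>)\<^sup>2)) \<partial>M))
    \<longlonglongrightarrow> complex_of_real (\<integral>\<omega>. exp (- (s\<^sup>2 / 2) * (\<Sum>i\<in>J. (U i \<omega>)\<^sup>2)) \<partial>N)"
    by (simp only:)
  then show ?thesis by (simp only: tendsto_of_real_iff)
qed

section \<open>Square integrable kernels\<close>

context pair_sigma_finite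
begin

lemma sq_integrable_tensor:
  assumes f: "sq_integrable M1 f" and g: "sq_integrable M2 g"
  shows "sq_integrable (M1 \<Otimes>\<^sub>M M2) (\<lambda>(x, y). f x * g y)"
proof -
  have [measurable]: "f \<in> borel_measurable M1" "g \<in> borel_measurable M2"
    using f g by (auto simp: sq_integrable_def)
  have "integrable (M1 \<Otimes>\<^sub>M M2) (\<lambda>(x, y). (f x)\<^sup>2 * (g y)\<^sup>2)"
  proof (rule Fubini_integrable)
    show "integrable M1 (\<lambda>x. \<integral>y. norm (case (x, y) of (x, y) \<Rightarrow> (f x)\<^sup>2 * (g y)\<^sup>2) \<partial>M2)"
      using f g by (simp add: abs_mult sq_integrable_def)
    show "AE x in M1. integrable M2 (\<lambda>y. case (x, y) of (x, y) \<Rightarrow> (f x)\<^sup>2 * (g y)\<^sup>2)"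
      using f g by (simp add: sq_integrable_def)
  qed measurable
  then show ?thesis
    by (simp add: sq_integrable_def split_beta' power_mult_distrib)
qed

text \<open>Tonelli in the direction in which it is applied: the integral over the first variable,
  the sample, is explicit, whereas the wanted quantity, such as a squared norm, integrates over the
  second variable first.\<close>

lemma nonneg_kernelI:
  fixes H :: "'a \<Rightarrow> 'b \<Rightarrow> real"
  assumes H: "(\<lambda>(x, y). H x y) \<in> borel_measurable (M1 \<Otimes>\<^sub>M M2)" and nonneg: "\<And>x y. 0 \<le> H x y"
    and int: "\<And>y. integrable M1 (\<lambda>x. H x y)" "integrable M2 (\<lambda>y. \<integral>x. H x y \<partial>M1)"
  shows "integrable (M1 \<Otimes>\<^sub>M M2) (\<lambda>(x, y). H x y)"
    and "(\<integral>x. (\<integral>y. H x y \<partial>M2) \<partial>M1) = (\<integral>y. (\<integral>x. H x y \<partial>M1) \<partial>M2)"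
proof -
  interpret S: pair_sigma_finite M2 M1 ..
  have swap: "(\<lambda>p. H (snd p) (fst p)) \<in> borel_measurable (M2 \<Otimes>\<^sub>M M1)"
    using measurable_compose[OF measurable_pair_swap' H] by (simp add: split_beta')
  have "integrable (M2 \<Otimes>\<^sub>M M1) (\<lambda>(y, x). H x y)"
  proof (rule S.Fubini_integrable)
    show "(\<lambda>(y, x). H x y) \<in> borel_measurable (M2 \<Otimes>\<^sub>M M1)"
      unfolding split_beta' by (rule swap)
  qed (use int nonneg in simp_all)
  then show int2: "integrable (M1 \<Otimes>\<^sub>M M2) (\<lambda>(x, y). H x y)"
    using S.integrable_product_swap_iff[of "\<lambda>(y, x). H x y"] by (simp add: split_beta')
  show "(\<integral>x. (\<integral>y. H x y \<partial>M2) \<partial>M1) = (\<integral>y. (\<integral>x. H x y \<partial>M1) \<partial>M2)"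
    by (rule Fubini_integral[OF int2, symmetric])
qed

lemma sq_integrable_kernelI:
  assumes H: "(\<lambda>(x, y). H x y) \<in> borel_measurable (M1 \<Otimes>\<^sub>M M2)"
    and int: "\<And>y. integrable M1 (\<lambda>x. (H x y)\<^sup>2)" "integrable M2 (\<lambda>y. \<integral>x. (H x y)\<^sup>2 \<partial>M1)"
  shows "sq_integrable (M1 \<Otimes>\<^sub>M M2) (\<lambda>(x, y). H x y)"
    and "(\<integral>x. (\<integral>y. (H x y)\<^sup>2 \<partial>M2) \<partial>M1) = (\<integral>y. (\<integral>x. (H x y)\<^sup>2 \<partial>M1) \<partial>M2)"
proof -
  have "(\<lambda>(x, y). (H x y)\<^sup>2) \<in> borel_measurable (M1 \<Otimes>\<^sub>M M2)"
    using borel_measurable_power[OF H, of 2] by (simp add: split_beta')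
  note k = nonneg_kernelI[OF this _ int]
  show "sq_integrable (M1 \<Otimes>\<^sub>M M2) (\<lambda>(x, y). H x y)"
    using k(1) H by (simp add: sq_integrable_def split_beta')
  show "(\<integral>x. (\<integral>y. (H x y)\<^sup>2 \<partial>M2) \<partial>M1) = (\<integral>y. (\<integral>x. (H x y)\<^sup>2 \<partial>M1) \<partial>M2)"
    using k(2) by simp
qed

lemma kernel_square_integrable:
  assumes H: "sq_integrable (M1 \<Otimes>\<^sub>M M2) (\<lambda>(x, y). H x y)"
  shows "integrable M1 (\<lambda>x. \<integral>y. (H x y)\<^sup>2 \<partial>M2)"
  using integrable_fst'[of "\<lambda>(x, y). (H x y)\<^sup>2"] H
  by (simp add: sq_integrable_def split_beta')

text \<open>Cauchy-Schwarz in \<open>y\<close> for each \<open>x\<close>: a square integrable kernel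
  defines a Hilbert-Schmidt operator.\<close>

lemma kernel_operator_sq_integrable:
  assumes H: "sq_integrable (M1 \<Otimes>\<^sub>M M2) (\<lambda>(x, y). H x y)"
    and Hx: "\<And>x. sq_integrable M2 (H x)" and f: "sq_integrable M2 f"
  shows "sq_integrable M1 (\<lambda>x. \<integral>y. H x y * f y \<partial>M2)"
proof -
  have [measurable]: "f \<in> borel_measurable M2" "(\<lambda>(x, y). H x y) \<in> borel_measurable (M1 \<Otimes>\<^sub>M M2)"
    using H f by (auto simp: sq_integrable_def)
  have m: "(\<lambda>x. \<integral>y. H x y * f y \<partial>M2) \<in> borel_measurable M1"
    by measurable
  moreover have "integrable M1 (\<lambda>x. (\<integral>y. H x y * f y \<partial>M2)\<^sup>2)"
  proof (rule Bochner_Integration.integrable_bound)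
    show "integrable M1 (\<lambda>x. (\<integral>y. (H x y)\<^sup>2 \<partial>M2) * (\<integral>y. (f y)\<^sup>2 \<partial>M2))"
      by (intro integrable_mult_left kernel_square_integrable H)
    show "AE x in M1. norm ((\<integral>y. H x y * f y \<partial>M2)\<^sup>2) \<le> norm ((\<integral>y. (H x y)\<^sup>2 \<partial>M2) * (\<integral>y. (f y)\<^sup>2 \<partial>M2))"
      using Cauchy_Schwarz_sq_integrable[OF Hx f] by (auto intro!: AE_I2 simp: abs_mult)
  qed (use m in measurable)
  ultimately show ?thesis by (simp add: sq_integrable_def)
qed

text \<open>Fubini is applied twice, once for each test function. Each time the integrand is
  \<open>H\<close> times a tensor product of square integrable functions, so integrability is a
  Cauchy-Schwarz product in two variables and no triple integral over \<open>x\<close>,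
  \<open>s\<close>, \<open>t\<close> arises.\<close>

lemma kernel_covariance:
  assumes fin: "finite_measure M1"
    and H: "sq_integrable (M1 \<Otimes>\<^sub>M M2) (\<lambda>(x, y). H x y)"
    and Hx: "\<And>x. sq_integrable M2 (H x)" and Hy: "\<And>y. sq_integrable M1 (\<lambda>x. H x y)"
    and f: "sq_integrable M2 f" and g: "sq_integrable M2 g"
    and K: "\<And>s t. (\<integral>x. H x s * H x t \<partial>M1) = K s t"
  shows "(\<integral>x. (\<integral>s. H x s * f s \<partial>M2) * (\<integral>t. H x t * g t \<partial>M2) \<partial>M1) = (\<integral>t. (\<integral>s. K s t * f s \<partial>M2) * g t \<partial>M2)"
proof -
  have [measurable]: "f \<in> borel_measurable M2" "g \<in> borel_measurable M2"
    "(\<lambda>(x, y). H x y) \<in> borel_measurable (M1 \<Otimes>\<^sub>M M2)"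
    using H f g by (auto simp: sq_integrable_def)
  have f': "sq_integrable M1 (\<lambda>x. \<integral>s. H x s * f s \<partial>M2)"
    by (rule kernel_operator_sq_integrable[OF H Hx f])
  have inner: "(\<integral>s. K s t * f s \<partial>M2) = (\<integral>x. H x t * (\<integral>s. H x s * f s \<partial>M2) \<partial>M1)" for t
  proof -
    have "integrable (M1 \<Otimes>\<^sub>M M2) (\<lambda>(x, s). H x s * (H x t * f s))"
      using sq_integrable_mult[OF H sq_integrable_tensor[OF Hy[of t] f]] by (simp add: split_beta')
    then have "(\<integral>s. (\<integral>x. H x s * (H x t * f s) \<partial>M1) \<partial>M2) = (\<integral>x. (\<integral>s. H x s * (H x t * f s) \<partial>M2) \<partial>M1)"
      by (rule Fubini_integral)
    moreover have "(\<integral>x. H x s * (H x t * f s) \<partial>M1) = K s t * f s" for s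
      by (simp add: K[symmetric] mult.assoc[symmetric])
    moreover have "(\<integral>s. H x s * (H x t * f s) \<partial>M2) = H x t * (\<integral>s. H x s * f s \<partial>M2)" for x
      by (simp only: mult.left_commute[of "H x _" "H x t"] integral_mult_right_zero)
    ultimately show ?thesis by simp
  qed
  have "integrable (M1 \<Otimes>\<^sub>M M2) (\<lambda>(x, t). H x t * ((\<integral>s. H x s * f s \<partial>M2) * g t))"
    using sq_integrable_mult[OF H sq_integrable_tensor[OF f' g]] by (simp add: split_beta')
  then have "(\<integral>t. (\<integral>x. H x t * ((\<integral>s. H x s * f s \<partial>M2) * g t) \<partial>M1) \<partial>M2)
      = (\<integral>x. (\<integral>t. H x t * ((\<integral>s. H x s * f s \<partial>M2) * g t) \<partial>M2) \<partial>M1)"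
    by (rule Fubini_integral)
  moreover have "(\<integral>x. H x t * ((\<integral>s. H x s * f s \<partial>M2) * g t) \<partial>M1) = (\<integral>s. K s t * f s \<partial>M2) * g t" for t
    by (simp add: inner mult.assoc[symmetric])
  moreover have "(\<integral>t. H x t * ((\<integral>s. H x s * f s \<partial>M2) * g t) \<partial>M2)
      = (\<integral>s. H x s * f s \<partial>M2) * (\<integral>t. H x t * g t \<partial>M2)" for x
    by (simp only: mult.left_commute[of "H x _"] integral_mult_right_zero)
  ultimately show ?thesis by simp
qed

text \<open>Finiteness of \<open>M1\<close> makes the constant 1 square integrable, so that
  \<open>1\<close> times \<open>f\<close> can serve as the tensor partner of \<open>H\<close> in
  Fubini's theorem.\<close>

lemma kernel_operator_mean_zero:
  assumes fin: "finite_measure M1"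
    and H: "sq_integrable (M1 \<Otimes>\<^sub>M M2) (\<lambda>(x, y). H x y)"
    and f: "sq_integrable M2 f" and 0: "\<And>y. (\<integral>x. H x y \<partial>M1) = 0"
  shows "(\<integral>x. (\<integral>y. H x y * f y \<partial>M2) \<partial>M1) = 0"
proof -
  interpret M1: finite_measure M1 by fact
  have "sq_integrable M1 (\<lambda>_. 1)" by (simp add: sq_integrable_def)
  from sq_integrable_mult[OF H sq_integrable_tensor[OF this f]]
  have "integrable (M1 \<Otimes>\<^sub>M M2) (\<lambda>(x, y). H x y * f y)" by (simp add: split_beta')
  then have "(\<integral>x. (\<integral>y. H x y * f y \<partial>M2) \<partial>M1) = (\<integral>y. (\<integral>x. H x y * f y \<partial>M1) \<partial>M2)"
    by (rule Fubini_integral[symmetric])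
  then show ?thesis by (simp add: 0)
qed

end

section \<open>The kernel of the linearised statistic\<close>

lemma std_normal_poly:
  "has_bochner_integral std_normal_distribution
    (\<lambda>x. a + b * x + c * x\<^sup>2 + d * x ^ 3 + e * x ^ 4) (a + c + 3 * e)"
proof -
  have i: "integrable std_normal_distribution (\<lambda>x. x ^ k)" for k
    by (rule integrable_std_normal_distribution_moment)
  have m: "has_bochner_integral std_normal_distribution (\<lambda>x. x) 0"
    "has_bochner_integral std_normal_distribution (\<lambda>x. x ^ 3) 0"
    using integral_std_normal_distribution_moment_odd[of 1] integral_std_normal_distribution_moment_odd[of 3] i[of 1] i[of 3]
    by (simp_all add: has_bochner_integral_iff)
  have m': "has_bochner_integral std_normal_distribution (\<lambda>x. x\<^sup>2) 1"
    "has_bochner_integral std_normal_distribution (\<lambda>x. x ^ 4) 3"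
    using std_normal_distribution_even_moments[of 1] std_normal_distribution_even_moments[of 2]
    by (simp_all add: has_bochner_integral_iff fact_numeral)
  have "has_bochner_integral std_normal_distribution (\<lambda>x. a) a"
    by (simp add: has_bochner_integral_iff std_normal.prob_space[simplified])
  then have "has_bochner_integral std_normal_distribution
    (\<lambda>x. a + b * x + c * x\<^sup>2 + d * x ^ 3 + e * x ^ 4) (a + b * 0 + c * 1 + d * 0 + e * 3)"
    by (intro has_bochner_integral_add has_bochner_integral_mult_right m m')
  then show ?thesis by (simp add: mult.commute[of e])
qed

text \<open>Exponential tilting: multiplying the normal density by \<open>exp (u * x)\<close> gives
  \<open>exp (u^2 / 2)\<close> times the density shifted by \<open>u\<close>. Moments with
  exponential factors thus become polynomial ones.\<close>

lemma std_normal_exp_shift: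
  assumes q: "has_bochner_integral std_normal_distribution (\<lambda>x. q (x + u)) I"
    and [measurable]: "q \<in> borel_measurable borel"
  shows "has_bochner_integral std_normal_distribution (\<lambda>x. exp (u * x) * q x) (exp (u\<^sup>2 / 2) * I)"
proof -
  let ?F = "\<lambda>x. std_normal_density x * (exp (u * x) * q x)"
  have eq: "?F (u + x) = exp (u\<^sup>2 / 2) * (std_normal_density x * q (x + u))" for x
  proof -
    have "exp (- (u + x)\<^sup>2 / 2) * exp (u * (u + x)) = exp (u\<^sup>2 / 2) * exp (- x\<^sup>2 / 2)"
      by (simp add: exp_add[symmetric] power2_eq_square field_simps)
    then show ?thesis
      by (simp add: std_normal_density_def add.commute)
  qed
  have q': "integrable lborel (\<lambda>x. std_normal_density x * q (x + u))"
    "(\<integral>x. std_normal_density x * q (x + u) \<partial>lborel) = I"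
    using q by (simp_all add: has_bochner_integral_iff integrable_density integral_density)
  have "integrable lborel (\<lambda>x. ?F (u + 1 * x))"
    using q' by (simp add: eq)
  then have int: "integrable lborel ?F"
    by (subst (asm) lborel_integrable_real_affine_iff) auto
  have "(\<integral>x. ?F x \<partial>lborel) = (\<integral>x. ?F (u + x) \<partial>lborel)"
    using lborel_integral_real_affine[of 1 ?F u] by simp
  also have "\<dots> = exp (u\<^sup>2 / 2) * I" using q' by (simp add: eq)
  finally show ?thesis
    using int by (simp add: has_bochner_integral_iff integrable_density integral_density)
qed

text \<open>The Taylor polynomial of degree 2 in \<open>t\<close> of
  \<open>exp (t x - t^2 / 2)\<close>, the generating function of the Hermite polynomials 1,
  \<open>x\<close>, \<open>x^2 - 1\<close>.\<close>

definition taylor2 :: "real \<Rightarrow> real \<Rightarrow> real" where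
  "taylor2 x t = 1 + t * x + t\<^sup>2 * (x\<^sup>2 - 1) / 2"

text \<open>What remains of \<open>exp (t * x)\<close> after its projection onto polynomials of
  degree at most 2 in \<open>x\<close> is removed; it is the influence function of the empirical
  moment generating function of the residuals.\<close>

definition hker :: "real \<Rightarrow> real \<Rightarrow> real" where
  "hker x t = exp (t * x) - exp (t\<^sup>2 / 2) * taylor2 x t"

lemma hker_measurable [measurable]: "case_prod hker \<in> borel_measurable (borel \<Otimes>\<^sub>M borel)"
  unfolding hker_def[abs_def] taylor2_def split_beta' by measurable

lemma hker_measurable2 [measurable]: "hker x \<in> borel_measurable borel"
  unfolding hker_def[abs_def] taylor2_def by measurable

lemma exp_shift_taylor2:
  "has_bochner_integral std_normal_distribution (\<lambda>x. exp (u * x) * taylor2 x s)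
    (exp (u\<^sup>2 / 2) * (1 + s * u + s\<^sup>2 * u\<^sup>2 / 2))"
proof (rule std_normal_exp_shift)
  have "has_bochner_integral std_normal_distribution
    (\<lambda>x. (1 + s * u + s\<^sup>2 * (u\<^sup>2 - 1) / 2) + (s + s\<^sup>2 * u) * x + (s\<^sup>2 / 2) * x\<^sup>2 + 0 * x ^ 3 + 0 * x ^ 4)
    ((1 + s * u + s\<^sup>2 * (u\<^sup>2 - 1) / 2) + (s\<^sup>2 / 2) + 3 * 0)"
    by (rule std_normal_poly)
  moreover have "(1 + s * u + s\<^sup>2 * (u\<^sup>2 - 1) / 2) + (s + s\<^sup>2 * u) * x + (s\<^sup>2 / 2) * x\<^sup>2 + 0 * x ^ 3 + 0 * x ^ 4
      = taylor2 (x + u) s" for x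
    unfolding taylor2_def
    by (simp add: power2_eq_square add_divide_distrib diff_divide_distrib algebra_simps)
  moreover have "(1 + s * u + s\<^sup>2 * (u\<^sup>2 - 1) / 2) + (s\<^sup>2 / 2) + 3 * 0 = 1 + s * u + s\<^sup>2 * u\<^sup>2 / 2"
    by (simp add: power2_eq_square add_divide_distrib diff_divide_distrib algebra_simps)
  ultimately show "has_bochner_integral std_normal_distribution (\<lambda>x. taylor2 (x + u) s) (1 + s * u + s\<^sup>2 * u\<^sup>2 / 2)"
    by (simp only:)
qed (simp add: taylor2_def)

lemma exp_shift_1:
  "has_bochner_integral std_normal_distribution (\<lambda>x. exp (u * x)) (exp (u\<^sup>2 / 2))"
  using exp_shift_taylor2[of u 0] by (simp add: taylor2_def)

lemma taylor2_product:
  "has_bochner_integral std_normal_distribution (\<lambda>x. taylor2 x s * taylor2 x t) (1 + s * t + s\<^sup>2 * t\<^sup>2 / 2)"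
proof -
  have "has_bochner_integral std_normal_distribution
    (\<lambda>x. (1 - s\<^sup>2 / 2) * (1 - t\<^sup>2 / 2) + (s * (1 - t\<^sup>2 / 2) + t * (1 - s\<^sup>2 / 2)) * x
      + (s * t + s\<^sup>2 / 2 * (1 - t\<^sup>2 / 2) + t\<^sup>2 / 2 * (1 - s\<^sup>2 / 2)) * x\<^sup>2 + (s * t\<^sup>2 / 2 + t * s\<^sup>2 / 2) * x ^ 3
      + (s\<^sup>2 * t\<^sup>2 / 4) * x ^ 4)
    ((1 - s\<^sup>2 / 2) * (1 - t\<^sup>2 / 2) + (s * t + s\<^sup>2 / 2 * (1 - t\<^sup>2 / 2) + t\<^sup>2 / 2 * (1 - s\<^sup>2 / 2)) + 3 * (s\<^sup>2 * t\<^sup>2 / 4))"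
    by (rule std_normal_poly)
  moreover have "(1 - s\<^sup>2 / 2) * (1 - t\<^sup>2 / 2) + (s * (1 - t\<^sup>2 / 2) + t * (1 - s\<^sup>2 / 2)) * x
      + (s * t + s\<^sup>2 / 2 * (1 - t\<^sup>2 / 2) + t\<^sup>2 / 2 * (1 - s\<^sup>2 / 2)) * x\<^sup>2 + (s * t\<^sup>2 / 2 + t * s\<^sup>2 / 2) * x ^ 3
      + (s\<^sup>2 * t\<^sup>2 / 4) * x ^ 4 = taylor2 x s * taylor2 x t" for x
    unfolding taylor2_def
    by (simp add: power2_eq_square power3_eq_cube power4_eq_xxxx add_divide_distrib diff_divide_distrib algebra_simps)
  moreover have "(1 - s\<^sup>2 / 2) * (1 - t\<^sup>2 / 2) + (s * t + s\<^sup>2 / 2 * (1 - t\<^sup>2 / 2) + t\<^sup>2 / 2 * (1 - s\<^sup>2 / 2))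
      + 3 * (s\<^sup>2 * t\<^sup>2 / 4) = 1 + s * t + s\<^sup>2 * t\<^sup>2 / 2"
    by (simp add: power2_eq_square add_divide_distrib diff_divide_distrib algebra_simps)
  ultimately show ?thesis
    by (simp only:)
qed

text \<open>As expected of a projection, both cross terms and the product of the two projections
  have the same mean, so exactly one copy of it survives with a minus sign.\<close>

lemma hker_covariance:
  "has_bochner_integral std_normal_distribution (\<lambda>x. hker x s * hker x t) (K_cov s t)"
proof -
  have "has_bochner_integral std_normal_distribution
    (\<lambda>x. exp ((s + t) * x) - exp (s\<^sup>2 / 2) * (exp (t * x) * taylor2 x s)
      - exp (t\<^sup>2 / 2) * (exp (s * x) * taylor2 x t) + exp (s\<^sup>2 / 2) * exp (t\<^sup>2 / 2) * (taylor2 x s * taylor2 x t))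
    (exp ((s + t)\<^sup>2 / 2) - exp (s\<^sup>2 / 2) * (exp (t\<^sup>2 / 2) * (1 + s * t + s\<^sup>2 * t\<^sup>2 / 2))
      - exp (t\<^sup>2 / 2) * (exp (s\<^sup>2 / 2) * (1 + t * s + t\<^sup>2 * s\<^sup>2 / 2))
      + exp (s\<^sup>2 / 2) * exp (t\<^sup>2 / 2) * (1 + s * t + s\<^sup>2 * t\<^sup>2 / 2))"
    by (intro has_bochner_integral_add has_bochner_integral_diff has_bochner_integral_mult_right
        exp_shift_1 exp_shift_taylor2 taylor2_product)
  moreover have "exp ((s + t) * x) - exp (s\<^sup>2 / 2) * (exp (t * x) * taylor2 x s)
      - exp (t\<^sup>2 / 2) * (exp (s * x) * taylor2 x t) + exp (s\<^sup>2 / 2) * exp (t\<^sup>2 / 2) * (taylor2 x s * taylor2 x t)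
    = hker x s * hker x t" for x
    by (simp add: hker_def exp_add algebra_simps)
  moreover have "exp ((s + t)\<^sup>2 / 2) - exp (s\<^sup>2 / 2) * (exp (t\<^sup>2 / 2) * (1 + s * t + s\<^sup>2 * t\<^sup>2 / 2))
      - exp (t\<^sup>2 / 2) * (exp (s\<^sup>2 / 2) * (1 + t * s + t\<^sup>2 * s\<^sup>2 / 2))
      + exp (s\<^sup>2 / 2) * exp (t\<^sup>2 / 2) * (1 + s * t + s\<^sup>2 * t\<^sup>2 / 2) = K_cov s t"
  proof -
    have "(s + t)\<^sup>2 / 2 = s\<^sup>2 / 2 + (t\<^sup>2 / 2 + t * s)" "(t\<^sup>2 + s\<^sup>2) / 2 = s\<^sup>2 / 2 + t\<^sup>2 / 2"
      by (simp_all add: power2_eq_square add_divide_distrib algebra_simps)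
    then show ?thesis
      unfolding K_cov_def by (simp only: exp_add) (simp add: algebra_simps)
  qed
  ultimately show ?thesis
    by (simp only:)
qed

lemma hker_mean: "(\<integral>x. hker x t \<partial>std_normal_distribution) = 0"
proof -
  have "has_bochner_integral std_normal_distribution
    (\<lambda>x. exp (t * x) - exp (t\<^sup>2 / 2) * (exp (0 * x) * taylor2 x t))
    (exp (t\<^sup>2 / 2) - exp (t\<^sup>2 / 2) * (exp (0\<^sup>2 / 2) * (1 + t * 0 + t\<^sup>2 * 0\<^sup>2 / 2)))"
    by (intro has_bochner_integral_diff has_bochner_integral_mult_right exp_shift_1 exp_shift_taylor2)
  then show ?thesis by (simp add: hker_def has_bochner_integral_iff)
qed

lemma hker_sq_integrable: "sq_integrable std_normal_distribution (\<lambda>x. hker x t)"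
proof -
  have "(\<lambda>x. hker x t) \<in> borel_measurable borel"
    unfolding hker_def taylor2_def by measurable
  then show ?thesis
    using hker_covariance[of t t] by (simp add: sq_integrable_def has_bochner_integral_iff power2_eq_square)
qed

lemma abs_power_le_exp: "\<bar>t\<bar> ^ k \<le> fact k * exp \<bar>t::real\<bar>"
proof -
  have "\<bar>t\<bar> ^ k / fact k \<le> exp \<bar>t\<bar>"
    using sum_le_suminf[OF summable_exp_generic[of "\<bar>t\<bar>"], of "{k}"]
    by (simp add: exp_def divide_inverse mult.commute)
  then show ?thesis by (simp add: field_simps)
qed

text \<open>Powers and linear exponents are absorbed into
  \<open>exp ((1 + \<bar>c\<bar>) * \<bar>t\<bar>)\<close>; only the quadratic rate \<open>a\<close>
  decides membership.\<close>

lemma power_exp_wL2: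
  assumes "2 * a < \<beta>"
  shows "(\<lambda>t. t ^ k * exp (c * t + a * t\<^sup>2)) \<in> wL2 \<beta>"
proof -
  have "(\<lambda>t. fact k * exp ((1 + \<bar>c\<bar>) * \<bar>t\<bar> + a * t\<^sup>2)) \<in> wL2 \<beta>"
    using exp_quadratic_in_wL2[OF assms] unfolding wL2_iff by (rule sq_integrable_cmult)
  then show ?thesis unfolding wL2_iff
  proof (rule sq_integrable_bound)
    fix t :: real
    have "c * t \<le> \<bar>c\<bar> * \<bar>t\<bar>" by (simp add: abs_mult[symmetric])
    then have "\<bar>t\<bar> ^ k * exp (c * t + a * t\<^sup>2) \<le> (fact k * exp \<bar>t\<bar>) * exp (\<bar>c\<bar> * \<bar>t\<bar> + a * t\<^sup>2)"
      by (intro mult_mono abs_power_le_exp) auto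
    also have "\<dots> = fact k * exp ((1 + \<bar>c\<bar>) * \<bar>t\<bar> + a * t\<^sup>2)"
      by (simp add: exp_add algebra_simps)
    finally show "\<bar>t ^ k * exp (c * t + a * t\<^sup>2)\<bar> \<le> \<bar>fact k * exp ((1 + \<bar>c\<bar>) * \<bar>t\<bar> + a * t\<^sup>2)\<bar>"
      by (simp add: abs_mult power_abs)
  qed simp
qed

lemma hker_wL2:
  assumes "\<beta> > 2"
  shows "hker x \<in> wL2 \<beta>"
proof -
  have "(\<lambda>t. t ^ 0 * exp (x * t + 0 * t\<^sup>2) + (-1) * (t ^ 0 * exp (0 * t + 1/2 * t\<^sup>2))
    + (- x) * (t ^ 1 * exp (0 * t + 1/2 * t\<^sup>2)) + (- (x\<^sup>2 - 1) / 2) * (t ^ 2 * exp (0 * t + 1/2 * t\<^sup>2))) \<in> wL2 \<beta>"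
    unfolding wL2_iff
    by (intro sq_integrable_add sq_integrable_cmult; unfold wL2_iff[symmetric], rule power_exp_wL2)
      (use assms in auto)
  moreover have "(\<lambda>t. t ^ 0 * exp (x * t + 0 * t\<^sup>2) + (-1) * (t ^ 0 * exp (0 * t + 1/2 * t\<^sup>2))
    + (- x) * (t ^ 1 * exp (0 * t + 1/2 * t\<^sup>2)) + (- (x\<^sup>2 - 1) / 2) * (t ^ 2 * exp (0 * t + 1/2 * t\<^sup>2))) = hker x"
    by (simp add: hker_def taylor2_def fun_eq_iff field_simps)
  ultimately show ?thesis by simp
qed

text \<open>On the diagonal the kernel is at most \<open>exp (2 * t^2)\<close>, which the weight
  outweighs because \<open>\<beta> > 2\<close>. It is nonnegative as a second moment. Its integral
  is the trace of the covariance operator.\<close>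

lemma K_cov_diag_integrable:
  assumes "\<beta> > 2"
  shows "integrable (wmeasure \<beta>) (\<lambda>t. K_cov t t)"
proof (rule Bochner_Integration.integrable_bound)
  show "integrable (wmeasure \<beta>) (\<lambda>t. exp (0 * \<bar>t\<bar> + 2 * t\<^sup>2))"
    using assms by (rule integrable_wmeasure_exp)
  show "AE t in wmeasure \<beta>. norm (K_cov t t) \<le> norm (exp (0 * \<bar>t\<bar> + 2 * t\<^sup>2))"
  proof (intro AE_I2)
    fix t :: real
    have "K_cov t t = (\<integral>x. hker x t * hker x t \<partial>std_normal_distribution)"
      using hker_covariance[of t t] by (simp add: has_bochner_integral_iff)
    then have "K_cov t t \<ge> 0" by simp
    moreover have "K_cov t t \<le> exp (t\<^sup>2) * exp (t * t)"
    proof -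
      have "0 \<le> t * t" "0 \<le> t\<^sup>2 * t\<^sup>2" by simp_all
      then have "exp (t * t) - 1 - t * t - t\<^sup>2 * t\<^sup>2 / 2 \<le> exp (t * t)" by linarith
      then have "exp ((t\<^sup>2 + t\<^sup>2) / 2) * (exp (t * t) - 1 - t * t - t\<^sup>2 * t\<^sup>2 / 2) \<le> exp ((t\<^sup>2 + t\<^sup>2) / 2) * exp (t * t)"
        by (rule mult_left_mono) simp
      then show ?thesis by (simp add: K_cov_def)
    qed
    ultimately show "norm (K_cov t t) \<le> norm (exp (0 * \<bar>t\<bar> + 2 * t\<^sup>2))"
      by (simp add: exp_add[symmetric] power2_eq_square)
  qed
qed (simp add: K_cov_def)

section \<open>The kernel as a function of two variables\<close>

lemma pair_sigma_finite_std_normal_wmeasure: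
  assumes "\<beta> > 0"
  shows "pair_sigma_finite std_normal_distribution (wmeasure \<beta>)"
proof -
  interpret finite_measure "wmeasure \<beta>" using assms by (rule finite_measure_wmeasure)
  show ?thesis by unfold_locales
qed

lemma hker_sq_integrable_pair:
  assumes "\<beta> > 2"
  shows "sq_integrable (std_normal_distribution \<Otimes>\<^sub>M wmeasure \<beta>) (\<lambda>(x, t). hker x t)"
proof -
  interpret pair_sigma_finite std_normal_distribution "wmeasure \<beta>"
    using assms by (intro pair_sigma_finite_std_normal_wmeasure) simp
  show ?thesis
  proof (rule sq_integrable_kernelI)
    show "(\<lambda>(x, t). hker x t) \<in> borel_measurable (std_normal_distribution \<Otimes>\<^sub>M wmeasure \<beta>)"
      using hker_measurable by (simp cong: measurable_cong_sets sets_pair_measure_cong)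
  qed (use K_cov_diag_integrable[OF assms] hker_covariance in \<open>simp_all add: power2_eq_square has_bochner_integral_iff\<close>)
qed

text \<open>Literally the right-hand side required of a Gaussian element with kernel
  \<open>K_cov\<close>, with the same order of integration, so that the two match by
  unfolding.\<close>

definition covform :: "real \<Rightarrow> (real \<Rightarrow> real) \<Rightarrow> (real \<Rightarrow> real) \<Rightarrow> real" where
  "covform \<beta> f g = (LINT t|lborel. LINT s|lborel. K_cov s t * f s * g t * exp (- \<beta> * s\<^sup>2) * exp (- \<beta> * t\<^sup>2))"

lemma covform_eq:
  assumes f: "f \<in> wL2 \<beta>" and g: "g \<in> wL2 \<beta>"
  shows "covform \<beta> f g = (\<integral>t. (\<integral>s. K_cov s t * f s \<partial>wmeasure \<beta>) * g t \<partial>wmeasure \<beta>)"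
proof -
  have [measurable]: "f \<in> borel_measurable borel" "g \<in> borel_measurable borel"
    using f g by (auto intro: wL2_measurable)
  have [measurable]: "(\<lambda>s. K_cov s t) \<in> borel_measurable borel" "(\<lambda>(s, t). K_cov s t) \<in> borel_measurable (borel \<Otimes>\<^sub>M borel)" for t
    unfolding K_cov_def split_beta' by measurable
  have "(\<integral>t. (\<integral>s. K_cov s t * f s \<partial>wmeasure \<beta>) * g t \<partial>wmeasure \<beta>) = (LINT t|lborel. (LINT s|lborel. K_cov s t * f s * exp (- \<beta> * s\<^sup>2)) * g t * exp (- \<beta> * t\<^sup>2))"
    by (subst integral_wmeasure, measurable) (subst integral_wmeasure, auto)
  also have "\<dots> = covform \<beta> f g"
  proof -
    have "(LINT s|lborel. K_cov s t * f s * g t * exp (- \<beta> * s\<^sup>2) * exp (- \<beta> * t\<^sup>2))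
      = (LINT s|lborel. K_cov s t * f s * exp (- \<beta> * s\<^sup>2)) * g t * exp (- \<beta> * t\<^sup>2)" for t
    proof -
      have "(LINT s|lborel. K_cov s t * f s * g t * exp (- \<beta> * s\<^sup>2) * exp (- \<beta> * t\<^sup>2))
        = (LINT s|lborel. (K_cov s t * f s * exp (- \<beta> * s\<^sup>2)) * (g t * exp (- \<beta> * t\<^sup>2)))"
        by (rule Bochner_Integration.integral_cong) (simp_all only: mult_ac)
      also have "\<dots> = (LINT s|lborel. K_cov s t * f s * exp (- \<beta> * s\<^sup>2)) * (g t * exp (- \<beta> * t\<^sup>2))"
        by (rule integral_mult_left_zero)
      finally show ?thesis by (simp only: mult.assoc)
    qed
    then show ?thesis unfolding covform_def by simp
  qed
  finally show ?thesis by (rule sym)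
qed

text \<open>Each inner product of \<open>hker x\<close> with a test function is a centred square
  integrable function of one normal variable, hence a summand for the one-dimensional central limit
  theorem.\<close>

lemma hker_coef:
  assumes \<beta>: "\<beta> > 2" and f: "f \<in> wL2 \<beta>"
  shows "sq_integrable std_normal_distribution (\<lambda>x. winner \<beta> (hker x) f)" (is ?sq)
    and "(\<integral>x. winner \<beta> (hker x) f \<partial>std_normal_distribution) = 0" (is ?mean)
    and "g \<in> wL2 \<beta> \<Longrightarrow> (\<integral>x. winner \<beta> (hker x) f * winner \<beta> (hker x) g \<partial>std_normal_distribution) = covform \<beta> f g"
proof -
  interpret pair_sigma_finite std_normal_distribution "wmeasure \<beta>"
    using \<beta> by (intro pair_sigma_finite_std_normal_wmeasure) simp
  have fin: "finite_measure std_normal_distribution" by unfold_locales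
  note H = hker_sq_integrable_pair[OF \<beta>]
  have Hx: "sq_integrable (wmeasure \<beta>) (hker x)" for x
    using hker_wL2[OF \<beta>] by (simp add: wL2_iff)
  have f': "sq_integrable (wmeasure \<beta>) f" using f by (simp add: wL2_iff)
  have w: "winner \<beta> (hker x) f = (\<integral>t. hker x t * f t \<partial>wmeasure \<beta>)" if "f \<in> wL2 \<beta>" for x f
    by (rule winner_eq) (use that in \<open>auto intro: wL2_measurable\<close>)
  show ?sq unfolding w[OF f] by (rule kernel_operator_sq_integrable[OF H Hx f'])
  show ?mean unfolding w[OF f] by (rule kernel_operator_mean_zero[OF fin H f' hker_mean])
  assume g: "g \<in> wL2 \<beta>"
  have g': "sq_integrable (wmeasure \<beta>) g" using g by (simp add: wL2_iff)
  have "(\<integral>x. winner \<beta> (hker x) f * winner \<beta> (hker x) g \<partial>std_normal_distribution)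
      = (\<integral>t. (\<integral>s. K_cov s t * f s \<partial>wmeasure \<beta>) * g t \<partial>wmeasure \<beta>)"
    unfolding w[OF f] w[OF g]
    by (rule kernel_covariance[OF fin H Hx hker_sq_integrable f' g'])
      (use hker_covariance in \<open>simp add: has_bochner_integral_iff\<close>)
  also have "\<dots> = covform \<beta> f g" by (rule covform_eq[OF f g, symmetric])
  finally show "(\<integral>x. winner \<beta> (hker x) f * winner \<beta> (hker x) g \<partial>std_normal_distribution) = covform \<beta> f g" .
qed

section \<open>Normal samples\<close>

text \<open>Samples are indexed from 1, whereas the central limit theorem takes sequences indexed
  from 0.\<close>

lemma (in prob_space) indep_sets_Suc:
  assumes "indep_sets F {1..}"
  shows "indep_sets (\<lambda>i. F (Suc i)) UNIV"
proof (rule indep_setsI)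
  show "F (Suc i) \<subseteq> events" for i using assms by (auto simp: indep_sets_def)
next
  fix A J assume J: "J \<noteq> {}" "J \<subseteq> (UNIV :: nat set)" "finite J" and A: "\<forall>j\<in>J. A j \<in> F (Suc j)"
  have "prob (\<Inter>j\<in>Suc ` J. A (j - 1)) = (\<Prod>j\<in>Suc ` J. prob (A (j - 1)))"
    using J A by (intro indep_setsD[OF assms]) auto
  then show "prob (\<Inter>j\<in>J. A j) = (\<Prod>j\<in>J. prob (A j))"
    by (simp add: prod.reindex)
qed

lemma (in prob_space) indep_vars_Suc:
  assumes "indep_vars M' X {1..}"
  shows "indep_vars (\<lambda>i. M' (Suc i)) (\<lambda>i. X (Suc i)) UNIV"
  using assms indep_sets_Suc unfolding indep_vars_def2 by auto

text \<open>Only standard normal samples are treated: scaled residuals do not see location and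
  scale, so the general case reduces to this one at the end.\<close>

locale normal_sample = prob_space M for M :: "'a measure" +
  fixes \<xi> :: "nat \<Rightarrow> 'a \<Rightarrow> real"
  assumes indep: "indep_vars (\<lambda>_. borel) \<xi> {1..}"
    and distr_sample: "\<And>j. j \<ge> 1 \<Longrightarrow> distr M borel (\<xi> j) = std_normal_distribution"
begin

lemma sample_measurable [measurable]: "j \<ge> 1 \<Longrightarrow> \<xi> j \<in> borel_measurable M"
  using indep by (auto simp: indep_vars_def2)

lemma integral_sample:
  fixes \<phi> :: "real \<Rightarrow> real"
  assumes "j \<ge> 1" "\<phi> \<in> borel_measurable borel"
  shows "(\<integral>\<omega>. \<phi> (\<xi> j \<omega>) \<partial>M) = (\<integral>x. \<phi> x \<partial>std_normal_distribution)"
    and "integrable M (\<lambda>\<omega>. \<phi> (\<xi> j \<omega>)) \<longleftrightarrow> integrable std_normal_distribution \<phi>"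
  using assms by (simp_all add: distr_sample[OF assms(1), symmetric] integral_distr integrable_distr_eq)

definition nsum :: "(real \<Rightarrow> real) \<Rightarrow> nat \<Rightarrow> 'a \<Rightarrow> real" where
  "nsum \<phi> n \<omega> = (\<Sum>j=1..n. \<phi> (\<xi> j \<omega>)) / sqrt (real n)"

lemma nsum_measurable:
  assumes [measurable]: "\<phi> \<in> borel_measurable borel"
  shows "nsum \<phi> n \<in> borel_measurable M"
  unfolding nsum_def[abs_def] by (intro borel_measurable_divide borel_measurable_sum) auto

text \<open>Independence and centring remove the off-diagonal terms. That the value does not depend
  on \<open>n\<close> is what makes the later approximation by finitely many cells uniform in the
  sample size.\<close>

lemma nsum_second_moment:
  assumes \<phi>: "sq_integrable std_normal_distribution \<phi>" and mean: "(\<integral>x. \<phi> x \<partial>std_normal_distribution) = 0"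
    and n: "n > 0"
  shows "integrable M (\<lambda>\<omega>. (nsum \<phi> n \<omega>)\<^sup>2)"
    and "(\<integral>\<omega>. (nsum \<phi> n \<omega>)\<^sup>2 \<partial>M) = (\<integral>x. (\<phi> x)\<^sup>2 \<partial>std_normal_distribution)"
proof -
  let ?v = "\<integral>x. (\<phi> x)\<^sup>2 \<partial>std_normal_distribution"
  have [measurable]: "\<phi> \<in> borel_measurable borel" using \<phi> by (simp add: sq_integrable_def)
  have sq: "sq_integrable M (\<lambda>\<omega>. \<phi> (\<xi> j \<omega>))" if "j \<ge> 1" for j
    using \<phi> that integral_sample(2)[of j "\<lambda>x. (\<phi> x)\<^sup>2"] by (simp add: sq_integrable_def)
  have prods: "(\<integral>\<omega>. \<phi> (\<xi> i \<omega>) * \<phi> (\<xi> j \<omega>) \<partial>M) = (if i = j then ?v else 0)" if "i \<ge> 1" "j \<ge> 1" for i j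
  proof (cases "i = j")
    case True
    then show ?thesis using that integral_sample(1)[of j "\<lambda>x. (\<phi> x)\<^sup>2"] by (simp add: power2_eq_square)
  next
    case False
    have "indep_vars (\<lambda>_. borel) (\<lambda>i \<omega>. \<phi> (\<xi> i \<omega>)) {i, j}"
      by (rule indep_vars_compose2[where M' = "\<lambda>_. borel"])
        (use that in \<open>auto intro: indep_vars_subset[OF indep]\<close>)
    moreover have "integrable M (\<lambda>\<omega>. \<phi> (\<xi> k \<omega>))" if "k \<ge> 1" for k
      using sq[OF that] by (rule_tac square_integrable_imp_integrable[of "\<lambda>\<omega>. \<phi> (\<xi> k \<omega>)"]) (auto simp: sq_integrable_def)
    ultimately have "(\<integral>\<omega>. (\<Prod>k\<in>{i, j}. \<phi> (\<xi> k \<omega>)) \<partial>M) = (\<Prod>k\<in>{i, j}. \<integral>\<omega>. \<phi> (\<xi> k \<omega>) \<partial>M)"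
      using that by (intro indep_vars_lebesgue_integral) auto
    then show ?thesis
      using False that integral_sample(1)[of i \<phi>] mean by simp
  qed
  have eq: "(nsum \<phi> n \<omega>)\<^sup>2 = (\<Sum>i=1..n. \<Sum>j=1..n. \<phi> (\<xi> i \<omega>) * \<phi> (\<xi> j \<omega>)) / real n" for \<omega>
    using n by (simp add: nsum_def power_divide) (simp add: power2_eq_square sum_product)
  have int: "integrable M (\<lambda>\<omega>. \<phi> (\<xi> i \<omega>) * \<phi> (\<xi> j \<omega>))" if "i \<in> {1..n}" "j \<in> {1..n}" for i j
    using that by (intro sq_integrable_mult sq) auto
  show "integrable M (\<lambda>\<omega>. (nsum \<phi> n \<omega>)\<^sup>2)"
    unfolding eq by (intro Bochner_Integration.integrable_sum integrable_divide int)
  have "(\<integral>\<omega>. (nsum \<phi> n \<omega>)\<^sup>2 \<partial>M) = (\<Sum>i=1..n. \<Sum>j=1..n. \<integral>\<omega>. \<phi> (\<xi> i \<omega>) * \<phi> (\<xi> j \<omega>) \<partial>M) / real n"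
  proof -
    have "(\<integral>\<omega>. (\<Sum>j=1..n. \<phi> (\<xi> i \<omega>) * \<phi> (\<xi> j \<omega>)) \<partial>M) = (\<Sum>j=1..n. \<integral>\<omega>. \<phi> (\<xi> i \<omega>) * \<phi> (\<xi> j \<omega>) \<partial>M)"
      if "i \<in> {1..n}" for i
      using that by (intro Bochner_Integration.integral_sum int)
    moreover have "(\<integral>\<omega>. (\<Sum>i=1..n. \<Sum>j=1..n. \<phi> (\<xi> i \<omega>) * \<phi> (\<xi> j \<omega>)) \<partial>M)
       = (\<Sum>i=1..n. \<integral>\<omega>. (\<Sum>j=1..n. \<phi> (\<xi> i \<omega>) * \<phi> (\<xi> j \<omega>)) \<partial>M)"
      by (intro Bochner_Integration.integral_sum Bochner_Integration.integrable_sum int)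
    ultimately show ?thesis unfolding eq by (simp only: integral_divide_zero cong: sum.cong)
  qed
  also have "\<dots> = (\<Sum>i=1..n. \<Sum>j=1..n. if i = j then ?v else 0) / real n"
    using prods by simp
  also have "\<dots> = ?v" using n by simp
  finally show "(\<integral>\<omega>. (nsum \<phi> n \<omega>)\<^sup>2 \<partial>M) = ?v" .
qed

text \<open>The degenerate case \<open>v = 0\<close> is separated because the central limit theorem
  needs positive variance. It does occur: Gaussian weights that all vanish give the zero test
  function. There the sums vanish almost surely.\<close>

lemma nsum_char:
  assumes \<phi>: "sq_integrable std_normal_distribution \<phi>" and mean: "(\<integral>x. \<phi> x \<partial>std_normal_distribution) = 0"
  defines "v \<equiv> \<integral>x. (\<phi> x)\<^sup>2 \<partial>std_normal_distribution"
  shows "(\<lambda>n. CLINT \<omega>|M. iexp (s * nsum \<phi> n \<omega>)) \<longlonglongrightarrow> complex_of_real (exp (- (s\<^sup>2 / 2) * v))"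
proof (cases "v = 0")
  case True
  have [measurable]: "\<phi> \<in> borel_measurable borel" using \<phi> by (simp add: sq_integrable_def)
  have "(CLINT \<omega>|M. iexp (s * nsum \<phi> n \<omega>)) = 1" for n
  proof (cases "n = 0")
    case False
    then have n: "n > 0" by simp
    have [measurable]: "nsum \<phi> n \<in> borel_measurable M" by (rule nsum_measurable) simp
    have "(\<integral>\<omega>. (nsum \<phi> n \<omega>)\<^sup>2 \<partial>M) = 0"
      using nsum_second_moment(2)[OF \<phi> mean n] True by (simp add: v_def)
    then have "AE \<omega> in M. (nsum \<phi> n \<omega>)\<^sup>2 = 0"
      using nsum_second_moment(1)[OF \<phi> mean n]
      by (subst (asm) integral_nonneg_eq_0_iff_AE) auto
    then have "(CLINT \<omega>|M. iexp (s * nsum \<phi> n \<omega>)) = (CLINT \<omega>|M. 1)"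
      by (intro integral_cong_AE) (auto elim: eventually_mono)
    then show ?thesis by (simp add: prob_space)
  qed (simp add: nsum_def prob_space)
  then show ?thesis using True by simp
next
  case False
  moreover have "v \<ge> 0" unfolding v_def by simp
  ultimately have v: "v > 0" by simp
  have [measurable]: "\<phi> \<in> borel_measurable borel" using \<phi> by (simp add: sq_integrable_def)
  define Y where "Y i \<omega> = \<phi> (\<xi> (Suc i) \<omega>)" for i \<omega>
  have "weak_conv_m (\<lambda>n. distr M borel (\<lambda>\<omega>. (\<Sum>i<n. Y i \<omega>) / sqrt (n * (sqrt v)\<^sup>2))) std_normal_distribution"
  proof (rule central_limit_theorem_zero_mean)
    have "indep_vars (\<lambda>_. borel) (\<lambda>i. \<xi> (Suc i)) UNIV"
      using indep by (rule indep_vars_Suc)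
    then show "indep_vars (\<lambda>i. borel) Y UNIV"
      unfolding Y_def by (rule indep_vars_compose2) simp
    show "expectation (Y n) = 0" for n
      unfolding Y_def using integral_sample(1)[of "Suc n" \<phi>] mean by simp
    then show "variance (Y n) = (sqrt v)\<^sup>2" for n
      using integral_sample(1)[of "Suc n" "\<lambda>x. (\<phi> x)\<^sup>2"] v by (simp add: Y_def v_def)
    show "integrable M (\<lambda>x. (Y n x)\<^sup>2)" for n
      using integral_sample(2)[of "Suc n" "\<lambda>x. (\<phi> x)\<^sup>2"] \<phi> by (simp add: Y_def sq_integrable_def)
    show "distr M borel (Y n) = distr std_normal_distribution borel \<phi>" for n
      unfolding Y_def distr_sample[of "Suc n", symmetric, simplified]
      by (subst distr_distr) (auto simp: comp_def)
  qed (use v in simp)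
  \<comment> \<open>The central limit theorem divides by \<open>sqrt v\<close>; evaluation at
    \<open>s * sqrt v\<close> undoes this.\<close>
  then have "(\<lambda>n. char (distr M borel (\<lambda>\<omega>. (\<Sum>i<n. Y i \<omega>) / sqrt (n * (sqrt v)\<^sup>2))) (s * sqrt v))
      \<longlonglongrightarrow> char std_normal_distribution (s * sqrt v)"
    by (intro levy_continuity1) (auto intro!: real_dist_normal_dist real_distribution_distr simp: Y_def)
  moreover have "char (distr M borel (\<lambda>\<omega>. (\<Sum>i<n. Y i \<omega>) / sqrt (n * (sqrt v)\<^sup>2))) (s * sqrt v)
      = (CLINT \<omega>|M. iexp (s * nsum \<phi> n \<omega>))" for n
  proof -
    have "s * sqrt v * ((\<Sum>i<n. Y i \<omega>) / sqrt (n * (sqrt v)\<^sup>2)) = s * nsum \<phi> n \<omega>" for \<omega>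
      using v by (simp add: nsum_def Y_def real_sqrt_mult sum.shift_bounds_Suc_ivl
        sum.atLeast1_atMost_eq lessThan_atLeast0)
    then show ?thesis
      unfolding char_def by (subst integral_distr) (auto simp: Y_def)
  qed
  moreover have "char std_normal_distribution (s * sqrt v) = complex_of_real (exp (- (s\<^sup>2 / 2) * v))"
    using v by (simp add: char_std_normal_distribution power_mult_distrib)
  ultimately show ?thesis by simp
qed

end

section \<open>The linearised process in the weighted space\<close>

lemma winner_sum_right:
  assumes f: "f \<in> wL2 \<beta>" and e: "\<And>i. i \<in> J \<Longrightarrow> e i \<in> wL2 \<beta>"
  shows "winner \<beta> f (\<lambda>t. \<Sum>i\<in>J. c i * e i t) = (\<Sum>i\<in>J. c i * winner \<beta> f (e i))"
proof -
  have "winner \<beta> f (\<lambda>t. \<Sum>i\<in>J. c i * e i t) = (\<integral>t. f t * (\<Sum>i\<in>J. c i * e i t) \<partial>wmeasure \<beta>)"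
    by (rule winner_eq) (use f e in \<open>auto intro!: borel_measurable_sum borel_measurable_times intro: wL2_measurable\<close>)
  also have "\<dots> = (\<integral>t. (\<Sum>i\<in>J. c i * (f t * e i t)) \<partial>wmeasure \<beta>)"
    by (simp add: sum_distrib_left mult.left_commute)
  also have "\<dots> = (\<Sum>i\<in>J. c i * (\<integral>t. f t * e i t \<partial>wmeasure \<beta>))"
    using f e by (subst Bochner_Integration.integral_sum)
      (auto intro!: integrable_mult_right sq_integrable_mult simp: wL2_iff)
  also have "\<dots> = (\<Sum>i\<in>J. c i * winner \<beta> f (e i))"
    by (intro sum.cong refl, subst winner_eq) (use f e in \<open>auto intro: wL2_measurable\<close>)
  finally show ?thesis .
qed

lemma winner_commute: "winner \<beta> f g = winner \<beta> g f"
  by (simp add: winner_def mult.commute)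

lemma wL2_sum: "(\<And>i. i \<in> J \<Longrightarrow> e i \<in> wL2 \<beta>) \<Longrightarrow> (\<lambda>t. \<Sum>i\<in>J. c i * e i t) \<in> wL2 \<beta>"
  unfolding wL2_iff by (intro sq_integrable_sum sq_integrable_cmult)

context normal_sample
begin

definition zlin :: "nat \<Rightarrow> 'a \<Rightarrow> real \<Rightarrow> real" where
  "zlin n \<omega> t = nsum (\<lambda>x. hker x t) n \<omega>"

lemma zlin_eq: "zlin n \<omega> = (\<lambda>t. \<Sum>j=1..n. (1 / sqrt (real n)) * hker (\<xi> j \<omega>) t)"
  by (simp add: zlin_def nsum_def sum_divide_distrib fun_eq_iff)

lemma zlin_wL2: "\<beta> > 2 \<Longrightarrow> zlin n \<omega> \<in> wL2 \<beta>"
  unfolding zlin_eq by (intro wL2_sum hker_wL2)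

lemma winner_zlin:
  assumes "\<beta> > 2" "f \<in> wL2 \<beta>"
  shows "winner \<beta> (zlin n \<omega>) f = nsum (\<lambda>x. winner \<beta> (hker x) f) n \<omega>"
proof -
  have "winner \<beta> f (zlin n \<omega>) = (\<Sum>j=1..n. (1 / sqrt (real n)) * winner \<beta> f (hker (\<xi> j \<omega>)))"
    unfolding zlin_eq using assms by (intro winner_sum_right hker_wL2)
  then show ?thesis
    unfolding nsum_def winner_commute[of \<beta> _ f] by (simp add: sum_divide_distrib)
qed

lemma zlin_measurable [measurable]:
  "(\<lambda>p. zlin n (fst p) (snd p)) \<in> borel_measurable (M \<Otimes>\<^sub>M borel)"
proof -
  have [measurable]: "(\<lambda>p. hker (\<xi> j (fst p)) (snd p)) \<in> borel_measurable (M \<Otimes>\<^sub>M borel)" if "j \<ge> 1" for j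
    using that measurable_compose[OF _ hker_measurable, of "\<lambda>p. (\<xi> j (fst p), snd p)" "M \<Otimes>\<^sub>M borel"]
    by simp
  show ?thesis
    unfolding zlin_def nsum_def by (intro borel_measurable_divide borel_measurable_sum) auto
qed

lemma pair_sigma_finite_wmeasure: "\<beta> > 0 \<Longrightarrow> pair_sigma_finite M (wmeasure \<beta>)"
  by (intro pair_sigma_finite.intro sigma_finite_measure_axioms
    finite_measure.sigma_finite_measure finite_measure_wmeasure)

text \<open>For each \<open>t\<close> the second moment is that of a single summand; integrating
  over \<open>t\<close> and exchanging the order of integration gives the trace of the covariance
  operator for every nonempty sample.\<close>

lemma zlin_norm:
  assumes \<beta>: "\<beta> > 2" and n: "n > 0"
  shows "integrable M (\<lambda>\<omega>. (wnorm \<beta> (zlin n \<omega>))\<^sup>2)"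
    and "(\<integral>\<omega>. (wnorm \<beta> (zlin n \<omega>))\<^sup>2 \<partial>M) = (\<integral>t. K_cov t t \<partial>wmeasure \<beta>)"
proof -
  interpret P: pair_sigma_finite M "wmeasure \<beta>" using \<beta> by (intro pair_sigma_finite_wmeasure) simp
  have meas: "(\<lambda>(\<omega>, t). zlin n \<omega> t) \<in> borel_measurable (M \<Otimes>\<^sub>M wmeasure \<beta>)"
    using zlin_measurable[of n] by (simp add: split_beta' cong: measurable_cong_sets sets_pair_measure_cong)
  have K: "integrable M (\<lambda>\<omega>. (zlin n \<omega> t)\<^sup>2)" "(\<integral>\<omega>. (zlin n \<omega> t)\<^sup>2 \<partial>M) = K_cov t t" for t
    using nsum_second_moment[OF hker_sq_integrable hker_mean n] hker_covariance[of t t]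
    by (simp_all add: zlin_def has_bochner_integral_iff power2_eq_square[of "hker _ _"])
  have *: "integrable (wmeasure \<beta>) (\<lambda>t. \<integral>\<omega>. (zlin n \<omega> t)\<^sup>2 \<partial>M)"
    using K_cov_diag_integrable[OF \<beta>] by (simp add: K)
  have eq: "(wnorm \<beta> (zlin n \<omega>))\<^sup>2 = (\<integral>t. (zlin n \<omega> t)\<^sup>2 \<partial>wmeasure \<beta>)" for \<omega>
    by (rule wnorm_square) (use zlin_wL2[OF \<beta>] in \<open>auto intro: wL2_measurable\<close>)
  show "integrable M (\<lambda>\<omega>. (wnorm \<beta> (zlin n \<omega>))\<^sup>2)"
    unfolding eq by (rule P.kernel_square_integrable[OF P.sq_integrable_kernelI(1)[OF meas K(1) *]])
  show "(\<integral>\<omega>. (wnorm \<beta> (zlin n \<omega>))\<^sup>2 \<partial>M) = (\<integral>t. K_cov t t \<partial>wmeasure \<beta>)"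
    unfolding eq P.sq_integrable_kernelI(2)[OF meas K(1) *] by (simp add: K)
qed

lemma zlin_coef:
  assumes \<beta>: "\<beta> > 2" and f: "f \<in> wL2 \<beta>"
  shows "(\<lambda>\<omega>. winner \<beta> (zlin n \<omega>) f) \<in> borel_measurable M"
    and "n > 0 \<Longrightarrow> integrable M (\<lambda>\<omega>. (winner \<beta> (zlin n \<omega>) f)\<^sup>2)"
    and "n > 0 \<Longrightarrow> (\<integral>\<omega>. (winner \<beta> (zlin n \<omega>) f)\<^sup>2 \<partial>M) = covform \<beta> f f"
    and "(\<lambda>n. CLINT \<omega>|M. iexp (s * winner \<beta> (zlin n \<omega>) f)) \<longlonglongrightarrow> complex_of_real (exp (- (s\<^sup>2 / 2) * covform \<beta> f f))"
  unfolding winner_zlin[OF \<beta> f]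
  using hker_coef[OF \<beta> f] nsum_char[OF hker_coef(1,2)[OF \<beta> f], of s] f
  by (auto simp: sq_integrable_def nsum_second_moment intro!: nsum_measurable simp: power2_eq_square[of "winner _ _ _"])

end

section \<open>Convergence of the linearised statistic\<close>

text \<open>The approximation error \<open>d m\<close> is uniform in \<open>n\<close>, so
  \<open>m\<close> is fixed first and then \<open>n\<close> grows. The restriction to
  \<open>n > 0\<close> reflects the second moment formulas, which need a nonempty sample.\<close>

lemma tendsto_diagonal:
  fixes a :: "nat \<Rightarrow> real"
  assumes d: "\<And>m n. n > 0 \<Longrightarrow> \<bar>a n - A m n\<bar> \<le> d m" and d0: "d \<longlonglongrightarrow> 0"
    and A: "\<And>m. A m \<longlonglongrightarrow> b m" and b: "b \<longlonglongrightarrow> B"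
  shows "a \<longlonglongrightarrow> B"
proof (rule LIMSEQ_I)
  fix r :: real assume r: "r > 0"
  have "eventually (\<lambda>m. d m < r / 3 \<and> \<bar>b m - B\<bar> < r / 3) sequentially"
    using r order_tendstoD(2)[OF d0, of "r / 3"] tendstoD[OF b, of "r / 3"]
    by (auto simp: dist_real_def intro: eventually_conj)
  then obtain m where m: "d m < r / 3" "\<bar>b m - B\<bar> < r / 3"
    unfolding eventually_sequentially by blast
  obtain n0 where n0: "\<And>n. n \<ge> n0 \<Longrightarrow> \<bar>A m n - b m\<bar> < r / 3"
    using LIMSEQ_D[OF A[of m], of "r / 3"] r by auto
  show "\<exists>no. \<forall>n\<ge>no. norm (a n - B) < r"
  proof (intro exI allI impI)
    fix n assume n: "n \<ge> Suc n0"
    show "norm (a n - B) < r"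
      using d[of n m] n0[of n] m n unfolding real_norm_def by linarith
  qed
qed

lemma exp_neg_diff_le:
  fixes x y c :: real
  assumes "0 \<le> x" "x \<le> y" "0 \<le> c"
  shows "\<bar>exp (- c * y) - exp (- c * x)\<bar> \<le> c * (y - x)"
proof -
  have 1: "exp (- c * y) \<le> exp (- c * x)" using assms by (simp add: mult_left_mono)
  have "exp (- c * x) - exp (- c * y) = exp (- c * x) * (1 - exp (- c * (y - x)))"
    by (simp add: right_diff_distrib exp_add[symmetric] algebra_simps)
  also have "\<dots> \<le> 1 * (1 - exp (- c * (y - x)))"
    using assms by (intro mult_right_mono) auto
  also have "\<dots> \<le> c * (y - x)" using exp_ge_add_one_self[of "- c * (y - x)"] by simp
  finally show ?thesis using 1 by simp
qed

text \<open>The expected energy that the linearised process loses under projection onto the cells;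
  it is the same for all sample sizes \<open>n > 0\<close>. The successor keeps the cell parameter
  positive.\<close>

definition defect :: "real \<Rightarrow> nat \<Rightarrow> real" where
  "defect \<beta> m = (\<integral>t. K_cov t t \<partial>wmeasure \<beta>)
    - (\<Sum>i\<in>cells (Suc m). covform \<beta> (cell_fun \<beta> (Suc m) i) (cell_fun \<beta> (Suc m) i))"

text \<open>Since second moments do not depend on the sample size, the loss can be computed from one
  copy of \<open>hker\<close>. There Parseval holds for every \<open>x\<close>, and the integrable
  squared norm dominates.\<close>

lemma defect_tendsto_0:
  assumes \<beta>: "\<beta> > 2"
  shows "defect \<beta> \<longlonglongrightarrow> 0"
proof -
  have \<beta>0: "\<beta> > 0" using \<beta> by simp
  interpret pair_sigma_finite std_normal_distribution "wmeasure \<beta>"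
    using \<beta>0 by (rule pair_sigma_finite_std_normal_wmeasure)
  have eq: "(wnorm \<beta> (hker x))\<^sup>2 = (\<integral>t. (hker x t)\<^sup>2 \<partial>wmeasure \<beta>)" for x
    by (rule wnorm_square) simp
  have int: "integrable std_normal_distribution (\<lambda>x. (wnorm \<beta> (hker x))\<^sup>2)"
    unfolding eq by (rule kernel_square_integrable[OF hker_sq_integrable_pair[OF \<beta>]])
  have "integrable (std_normal_distribution \<Otimes>\<^sub>M wmeasure \<beta>) (\<lambda>(x, t). (hker x t)\<^sup>2)"
    using hker_sq_integrable_pair[OF \<beta>] by (simp add: sq_integrable_def split_beta')
  then have "(\<integral>x. (wnorm \<beta> (hker x))\<^sup>2 \<partial>std_normal_distribution) = (\<integral>t. (\<integral>x. (hker x t)\<^sup>2 \<partial>std_normal_distribution) \<partial>wmeasure \<beta>)"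
    unfolding eq by (rule Fubini_integral[symmetric])
  also have "\<dots> = (\<integral>t. K_cov t t \<partial>wmeasure \<beta>)"
    using hker_covariance by (simp add: power2_eq_square has_bochner_integral_iff)
  finally have K: "(\<integral>x. (wnorm \<beta> (hker x))\<^sup>2 \<partial>std_normal_distribution) = (\<integral>t. K_cov t t \<partial>wmeasure \<beta>)" .
  have c: "integrable std_normal_distribution (\<lambda>x. (coef \<beta> m i (hker x))\<^sup>2)"
    "(\<integral>x. (coef \<beta> m i (hker x))\<^sup>2 \<partial>std_normal_distribution) = covform \<beta> (cell_fun \<beta> m i) (cell_fun \<beta> m i)" for m i
    using hker_coef(1,3)[OF \<beta> cell_fun_wL2[OF \<beta>0, of m i]] cell_fun_wL2[OF \<beta>0, of m i]
    by (simp_all add: coef_def sq_integrable_def power2_eq_square)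
  let ?S = "\<lambda>m x. \<Sum>i\<in>cells (Suc m). (coef \<beta> (Suc m) i (hker x))\<^sup>2"
  have intS: "integrable std_normal_distribution (?S m)" for m
    by (intro Bochner_Integration.integrable_sum c)
  have def_eq: "defect \<beta> m = (\<integral>x. (wnorm \<beta> (hker x))\<^sup>2 - ?S m x \<partial>std_normal_distribution)" for m
    by (subst Bochner_Integration.integral_diff[OF int intS], subst Bochner_Integration.integral_sum[OF c(1)])
      (simp add: defect_def K c(2))
  have "(\<lambda>m. \<integral>x. (wnorm \<beta> (hker x))\<^sup>2 - ?S m x \<partial>std_normal_distribution) \<longlonglongrightarrow> (\<integral>x. 0 \<partial>std_normal_distribution)"
  proof (rule integral_dominated_convergence[OF _ _ int])
    show "AE x in std_normal_distribution. (\<lambda>m. (wnorm \<beta> (hker x))\<^sup>2 - ?S m x) \<longlonglongrightarrow> 0"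
    proof (intro AE_I2)
      fix x
      have "(\<lambda>m. (wnorm \<beta> (hker x))\<^sup>2 - ?S m x) \<longlonglongrightarrow> (wnorm \<beta> (hker x))\<^sup>2 - (wnorm \<beta> (hker x))\<^sup>2"
        by (intro tendsto_intros Parseval_cells[OF \<beta>0 hker_wL2[OF \<beta>]])
      then show "(\<lambda>m. (wnorm \<beta> (hker x))\<^sup>2 - ?S m x) \<longlonglongrightarrow> 0" by simp
    qed
    show "AE x in std_normal_distribution. norm ((wnorm \<beta> (hker x))\<^sup>2 - ?S m x) \<le> (wnorm \<beta> (hker x))\<^sup>2" for m
    proof (intro AE_I2)
      fix x
      show "norm ((wnorm \<beta> (hker x))\<^sup>2 - ?S m x) \<le> (wnorm \<beta> (hker x))\<^sup>2"
        using Bessel_inequality[OF \<beta>0 _ hker_wL2[OF \<beta>], of "Suc m" x]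
          sum_nonneg[of "cells (Suc m)" "\<lambda>i. (coef \<beta> (Suc m) i (hker x))\<^sup>2"] by simp
    qed
    show "(\<lambda>x. (wnorm \<beta> (hker x))\<^sup>2 - ?S m x) \<in> borel_measurable std_normal_distribution" for m
      using int intS by (intro borel_measurable_diff borel_measurable_integrable)
  qed simp
  then show ?thesis by (simp add: def_eq[abs_def])
qed

section \<open>Characteristic functions and norm of a Gaussian element\<close>

lemma (in prob_space) centred_normal_char:
  assumes Z: "centred_normal M Z"
  shows "(CLINT \<omega>|M. iexp (s * Z \<omega>)) = complex_of_real (exp (- (s\<^sup>2 / 2) * (\<integral>\<omega>. (Z \<omega>)\<^sup>2 \<partial>M)))"
proof -
  have [measurable]: "Z \<in> borel_measurable M" using Z by (simp add: centred_normal_def)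
  from Z consider "AE \<omega> in M. Z \<omega> = 0"
    | \<sigma> where "\<sigma> > 0" "distributed M lborel Z (\<lambda>x. ennreal (normal_density 0 \<sigma> x))"
    by (auto simp: centred_normal_def)
  then show ?thesis
  proof cases
    case 1
    have "(CLINT \<omega>|M. iexp (s * Z \<omega>)) = (CLINT \<omega>|M. 1)"
      by (rule integral_cong_AE) (use 1 in \<open>auto elim: eventually_mono\<close>)
    moreover have "(\<integral>\<omega>. (Z \<omega>)\<^sup>2 \<partial>M) = (\<integral>\<omega>. 0 \<partial>M)"
      by (rule integral_cong_AE) (use 1 in \<open>auto elim: eventually_mono\<close>)
    ultimately show ?thesis by (simp add: prob_space)
  next
    case 2
    have "distributed M lborel (\<lambda>\<omega>. (Z \<omega> - 0) / \<sigma>) std_normal_density"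
      using normal_standard_normal_convert[OF 2(1), of Z 0] 2(2) by simp
    then have "distr M lborel (\<lambda>\<omega>. Z \<omega> / \<sigma>) = std_normal_distribution"
      by (simp add: distributed_def)
    then have D: "distr M borel (\<lambda>\<omega>. Z \<omega> / \<sigma>) = std_normal_distribution"
      using distr_cong[of M M borel lborel "\<lambda>\<omega>. Z \<omega> / \<sigma>" "\<lambda>\<omega>. Z \<omega> / \<sigma>"] by simp
    have var: "(\<integral>\<omega>. (Z \<omega>)\<^sup>2 \<partial>M) = \<sigma>\<^sup>2"
      using normal_distributed_variance[OF 2] normal_distributed_expectation[OF 2] by simp
    have "(CLINT \<omega>|M. iexp (s * Z \<omega>)) = char (distr M borel (\<lambda>\<omega>. Z \<omega> / \<sigma>)) (s * \<sigma>)"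
      unfolding char_def using 2(1) by (subst integral_distr) auto
    also have "\<dots> = complex_of_real (exp (- (s\<^sup>2 / 2) * \<sigma>\<^sup>2))"
      unfolding D by (simp add: char_std_normal_distribution power_mult_distrib)
    finally show ?thesis by (simp only: var)
  qed
qed

lemma space_borel_wL2 [simp]: "space (borel_wL2 \<beta>) = wL2 \<beta>"
  by (auto simp: borel_wL2_def space_measure_of_conv)

lemma gaussian_element_char:
  assumes N: "prob_space N" and W: "centred_gaussian_element \<beta> K_cov N W" and f: "f \<in> wL2 \<beta>"
  shows "(CLINT \<omega>|N. iexp (s * winner \<beta> (W \<omega>) f)) = complex_of_real (exp (- (s\<^sup>2 / 2) * covform \<beta> f f))"
proof -
  interpret N: prob_space N by fact
  have "centred_normal N (\<lambda>\<omega>. winner \<beta> (W \<omega>) f)"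
    using W f by (simp add: centred_gaussian_element_def)
  moreover have "(\<integral>\<omega>. (winner \<beta> (W \<omega>) f)\<^sup>2 \<partial>N) = covform \<beta> f f"
    using W f by (simp add: centred_gaussian_element_def covform_def power2_eq_square)
  ultimately show ?thesis using N.centred_normal_char by simp
qed

lemma gaussian_element_wL2:
  "centred_gaussian_element \<beta> K N W \<Longrightarrow> \<omega> \<in> space N \<Longrightarrow> W \<omega> \<in> wL2 \<beta>"
  by (auto simp: centred_gaussian_element_def dest: measurable_space)

lemma gaussian_element_coef_measurable:
  assumes "\<beta> > 0" "centred_gaussian_element \<beta> K N W"
  shows "(\<lambda>\<omega>. coef \<beta> m i (W \<omega>)) \<in> borel_measurable N"
  using assms cell_fun_wL2[of \<beta> m i]
  by (auto simp: centred_gaussian_element_def centred_normal_def coef_def)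

text \<open>By Parseval the norm is a limit of sums of squared coefficients, which are measurable as
  centred normal variables.\<close>

lemma gaussian_element_norm_measurable:
  assumes \<beta>: "\<beta> > 0" and W: "centred_gaussian_element \<beta> K N W"
  shows "(\<lambda>\<omega>. (wnorm \<beta> (W \<omega>))\<^sup>2) \<in> borel_measurable N"
  by (rule borel_measurable_LIMSEQ_real[OF Parseval_cells[OF \<beta> gaussian_element_wL2[OF W]]])
    (use gaussian_element_coef_measurable[OF assms] in measurable)

context normal_sample
begin

lemma zlin_norm_measurable:
  assumes "\<beta> > 2"
  shows "(\<lambda>\<omega>. (wnorm \<beta> (zlin n \<omega>))\<^sup>2) \<in> borel_measurable M"
  by (rule borel_measurable_LIMSEQ_real[OF Parseval_cells[OF _ zlin_wL2]])
    (use assms in \<open>auto simp: coef_def intro!: borel_measurable_sum borel_measurable_power zlin_coef(1) cell_fun_wL2\<close>)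

text \<open>Three limits are combined: projection onto cells with an error uniform in
  \<open>n\<close>, convergence in \<open>n\<close> for fixed cells, and refinement of the cells on
  the side of \<open>W\<close>. The rate is written \<open>s\<^sup>2 / 2\<close> to fit the Gaussian
  randomisation.\<close>

theorem zlin_Laplace_tendsto:
  assumes \<beta>: "\<beta> > 2" and N: "prob_space N" and W: "centred_gaussian_element \<beta> K_cov N W"
  shows "(\<lambda>n. \<integral>\<omega>. exp (- (s\<^sup>2 / 2) * (wnorm \<beta> (zlin n \<omega>))\<^sup>2) \<partial>M)
    \<longlonglongrightarrow> (\<integral>\<omega>. exp (- (s\<^sup>2 / 2) * (wnorm \<beta> (W \<omega>))\<^sup>2) \<partial>N)"
proof (rule tendsto_diagonal)
  interpret N: prob_space N by fact
  have \<beta>0: "\<beta> > 0" using \<beta> by simp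
  let ?S = "\<lambda>m f. \<Sum>i\<in>cells (Suc m). (coef \<beta> (Suc m) i f)\<^sup>2"
  note cW [measurable] = gaussian_element_coef_measurable[OF \<beta>0 W]
  have cz [measurable]: "(\<lambda>\<omega>. coef \<beta> m i (zlin n \<omega>)) \<in> borel_measurable M" for m i n
    unfolding coef_def by (rule zlin_coef(1)[OF \<beta> cell_fun_wL2[OF \<beta>0]])
  note [measurable] = zlin_norm_measurable[OF \<beta>] gaussian_element_norm_measurable[OF \<beta>0 W]
  show "(\<lambda>m. s\<^sup>2 / 2 * defect \<beta> m) \<longlonglongrightarrow> 0"
    using tendsto_mult_right_zero[OF defect_tendsto_0[OF \<beta>]] .
  show "\<bar>(\<integral>\<omega>. exp (- (s\<^sup>2 / 2) * (wnorm \<beta> (zlin n \<omega>))\<^sup>2) \<partial>M) - (\<integral>\<omega>. exp (- (s\<^sup>2 / 2) * ?S m (zlin n \<omega>)) \<partial>M)\<bar>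
    \<le> s\<^sup>2 / 2 * defect \<beta> m" if n: "n > 0" for m n
  proof -
    have i1: "integrable M (\<lambda>\<omega>. exp (- (s\<^sup>2 / 2) * (wnorm \<beta> (zlin n \<omega>))\<^sup>2))"
      "integrable M (\<lambda>\<omega>. exp (- (s\<^sup>2 / 2) * ?S m (zlin n \<omega>)))"
      by (rule integrable_const_bound[of _ 1], auto intro!: mult_nonneg_nonneg sum_nonneg)+
    have c: "integrable M (\<lambda>\<omega>. (coef \<beta> (Suc m) i (zlin n \<omega>))\<^sup>2)"
      "(\<integral>\<omega>. (coef \<beta> (Suc m) i (zlin n \<omega>))\<^sup>2 \<partial>M) = covform \<beta> (cell_fun \<beta> (Suc m) i) (cell_fun \<beta> (Suc m) i)" for i
      using zlin_coef(2,3)[OF \<beta> cell_fun_wL2[OF \<beta>0] n] by (simp_all add: coef_def)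
    have intS: "integrable M (\<lambda>\<omega>. ?S m (zlin n \<omega>))"
      by (intro Bochner_Integration.integrable_sum c)
    have "\<bar>(\<integral>\<omega>. exp (- (s\<^sup>2 / 2) * (wnorm \<beta> (zlin n \<omega>))\<^sup>2) \<partial>M) - (\<integral>\<omega>. exp (- (s\<^sup>2 / 2) * ?S m (zlin n \<omega>)) \<partial>M)\<bar>
      = \<bar>\<integral>\<omega>. exp (- (s\<^sup>2 / 2) * (wnorm \<beta> (zlin n \<omega>))\<^sup>2) - exp (- (s\<^sup>2 / 2) * ?S m (zlin n \<omega>)) \<partial>M\<bar>"
      by (simp only: Bochner_Integration.integral_diff[OF i1])
    also have "\<dots> \<le> (\<integral>\<omega>. \<bar>exp (- (s\<^sup>2 / 2) * (wnorm \<beta> (zlin n \<omega>))\<^sup>2) - exp (- (s\<^sup>2 / 2) * ?S m (zlin n \<omega>))\<bar> \<partial>M)"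
      by (rule integral_abs_bound)
    \<comment> \<open>Bessel puts the projected energy below the full one, so the integrand bounds
      the difference pointwise and its mean is exactly a multiple of \<open>defect\<close>.\<close>
    also have "\<dots> \<le> (\<integral>\<omega>. s\<^sup>2 / 2 * ((wnorm \<beta> (zlin n \<omega>))\<^sup>2 - ?S m (zlin n \<omega>)) \<partial>M)"
    proof (rule integral_mono)
      show "\<bar>exp (- (s\<^sup>2 / 2) * (wnorm \<beta> (zlin n \<omega>))\<^sup>2) - exp (- (s\<^sup>2 / 2) * ?S m (zlin n \<omega>))\<bar>
        \<le> s\<^sup>2 / 2 * ((wnorm \<beta> (zlin n \<omega>))\<^sup>2 - ?S m (zlin n \<omega>))" for \<omega>
        by (intro exp_neg_diff_le sum_nonneg Bessel_inequality \<beta>0 zlin_wL2 \<beta>) auto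
    qed (intro integrable_abs Bochner_Integration.integrable_diff i1 integrable_mult_right intS zlin_norm(1)[OF \<beta> n])+
    also have "\<dots> = s\<^sup>2 / 2 * ((\<integral>\<omega>. (wnorm \<beta> (zlin n \<omega>))\<^sup>2 \<partial>M) - (\<integral>\<omega>. ?S m (zlin n \<omega>) \<partial>M))"
      by (simp only: integral_mult_right_zero Bochner_Integration.integral_diff[OF zlin_norm(1)[OF \<beta> n] intS])
    also have "\<dots> = s\<^sup>2 / 2 * defect \<beta> m"
      by (subst Bochner_Integration.integral_sum[OF c(1)])
        (simp only: zlin_norm(2)[OF \<beta> n] c(2) defect_def)
    finally show ?thesis .
  qed
  show "(\<lambda>n. \<integral>\<omega>. exp (- (s\<^sup>2 / 2) * ?S m (zlin n \<omega>)) \<partial>M) \<longlonglongrightarrow> (\<integral>\<omega>. exp (- (s\<^sup>2 / 2) * ?S m (W \<omega>)) \<partial>N)" for m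
  proof (rule Laplace_sum_squares_tendsto[OF prob_space_axioms finite_cells cz _ N cW])
    let ?e = "cell_fun \<beta> (Suc m)" and ?J = "cells (Suc m)"
    let ?f = "\<lambda>g t. \<Sum>i\<in>?J. g i * ?e i t"
    have fL: "?f g \<in> wL2 \<beta>" for g by (intro wL2_sum cell_fun_wL2 \<beta>0)
    \<comment> \<open>A weighted sum of coefficients is a single inner product with the step
      function \<open>?f g\<close>. Its limiting characteristic function for the process and that of
      \<open>W\<close> are both given by \<open>covform\<close>.\<close>
    have lin: "(\<Sum>i\<in>?J. g i * coef \<beta> (Suc m) i u) = winner \<beta> u (?f g)" if "u \<in> wL2 \<beta>" for u g
      unfolding coef_def by (rule winner_sum_right[symmetric]) (use that \<beta>0 cell_fun_wL2 in auto)
    show "(\<lambda>n. CLINT \<omega>|M. iexp (s * (\<Sum>i\<in>?J. g i * coef \<beta> (Suc m) i (zlin n \<omega>))))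
        \<longlonglongrightarrow> complex_of_real (exp (- (s\<^sup>2 / 2) * covform \<beta> (?f g) (?f g)))" for g
      using zlin_coef(4)[OF \<beta> fL, of s g] by (simp only: lin zlin_wL2[OF \<beta>])
    show "(CLINT \<omega>|N. iexp (s * (\<Sum>i\<in>?J. g i * coef \<beta> (Suc m) i (W \<omega>))))
        = complex_of_real (exp (- (s\<^sup>2 / 2) * covform \<beta> (?f g) (?f g)))" for g
      unfolding gaussian_element_char[OF N W fL, symmetric]
      by (rule Bochner_Integration.integral_cong) (auto simp only: lin gaussian_element_wL2[OF W])
  qed
  \<comment> \<open>On the side of \<open>W\<close> pointwise Parseval suffices, the exponentials
    being bounded by 1.\<close>
  show "(\<lambda>m. \<integral>\<omega>. exp (- (s\<^sup>2 / 2) * ?S m (W \<omega>)) \<partial>N) \<longlonglongrightarrow> (\<integral>\<omega>. exp (- (s\<^sup>2 / 2) * (wnorm \<beta> (W \<omega>))\<^sup>2) \<partial>N)"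
  proof (rule integral_dominated_convergence[where w = "\<lambda>_. 1"])
    show "AE \<omega> in N. (\<lambda>m. exp (- (s\<^sup>2 / 2) * ?S m (W \<omega>))) \<longlonglongrightarrow> exp (- (s\<^sup>2 / 2) * (wnorm \<beta> (W \<omega>))\<^sup>2)"
      by (intro AE_I2 tendsto_intros Parseval_cells[OF \<beta>0 gaussian_element_wL2[OF W]])
    show "AE \<omega> in N. norm (exp (- (s\<^sup>2 / 2) * ?S m (W \<omega>))) \<le> 1" for m
      by (intro AE_I2) (auto intro!: mult_nonneg_nonneg sum_nonneg)
  qed auto
qed

end

section \<open>Linearisation\<close>

lemma exp_remainder: "\<bar>exp y - 1 - y\<bar> \<le> y\<^sup>2 * exp \<bar>y::real\<bar>"
proof -
  obtain t where t: "\<bar>t\<bar> \<le> \<bar>y\<bar>" "exp y = (\<Sum>m<2. y ^ m / fact m) + exp t / fact 2 * y ^ 2"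
    using Maclaurin_exp_le[of y 2] by blast
  then have "\<bar>exp y - 1 - y\<bar> = y\<^sup>2 * (exp t / 2)"
    by (simp add: numeral_2_eq_2 abs_mult)
  also have "\<dots> \<le> y\<^sup>2 * exp \<bar>y\<bar>"
  proof (rule mult_left_mono)
    have "exp t \<le> exp \<bar>y\<bar>" using t(1) by simp
    then show "exp t / 2 \<le> exp \<bar>y\<bar>" using exp_gt_zero[of t] by linarith
  qed simp
  finally show ?thesis .
qed

text \<open>In terms of \<open>s = sqrt (1 + d)\<close> one has
  \<open>d = (s - 1) * (s + 1)\<close>, so both errors become rational functions of \<open>s\<close>
  with an explicit factor \<open>s - 1\<close> or \<open>(s - 1)^2\<close>.\<close>

lemma inverse_sqrt_expansion:
  fixes d :: real
  assumes d: "\<bar>d\<bar> \<le> 1 / 4"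
  shows "\<bar>1 / sqrt (1 + d) - 1\<bar> \<le> \<bar>d\<bar>" and "\<bar>1 / sqrt (1 + d) - 1 + d / 2\<bar> \<le> d\<^sup>2"
proof -
  define s where "s = sqrt (1 + d)"
  have s2: "s\<^sup>2 = 1 + d" using d by (simp add: s_def)
  \<comment> \<open>The bound on \<open>d\<close> confines the root to \<open>[4/5, 6/5]\<close>,
    which provides the slack in the numerical estimates below.\<close>
  have "(4 / 5)\<^sup>2 \<le> 1 + d" "1 + d \<le> (6 / 5)\<^sup>2" using d by (auto simp: power2_eq_square abs_le_iff)
  then have s: "4 / 5 \<le> s" "s \<le> 6 / 5" unfolding s_def
    using real_le_rsqrt[of "4 / 5" "1 + d"] real_le_lsqrt[of "6 / 5" "1 + d"] by auto
  then have s0: "s \<noteq> 0" by linarith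
  have d_eq: "d = (s - 1) * (s + 1)" using s2 by (simp add: power2_eq_square algebra_simps)
  have ds: "1 / s - 1 = - (s - 1) / s" using s0 by (simp add: diff_divide_distrib)
  have "\<bar>1 / s - 1\<bar> = \<bar>s - 1\<bar> / s" unfolding ds using s by simp
  also have "\<dots> \<le> \<bar>s - 1\<bar> * (s + 1)"
  proof -
    have "1 / s \<le> 5 / 4" using s by (simp add: field_simps)
    then have "1 / s \<le> s + 1" using s by linarith
    then have "\<bar>s - 1\<bar> * (1 / s) \<le> \<bar>s - 1\<bar> * (s + 1)" by (rule mult_left_mono) simp
    then show ?thesis by simp
  qed
  also have "\<dots> = \<bar>d\<bar>" using s by (simp add: d_eq abs_mult)
  finally show "\<bar>1 / sqrt (1 + d) - 1\<bar> \<le> \<bar>d\<bar>" by (simp add: s_def)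
  have e: "1 / s - 1 + d / 2 = (s - 1)\<^sup>2 * ((s + 2) / (2 * s))"
    unfolding d_eq using s0 by (simp add: field_simps power2_eq_square)
  have "\<bar>1 / s - 1 + d / 2\<bar> = (s - 1)\<^sup>2 * ((s + 2) / (2 * s))" unfolding e using s by (simp add: abs_mult)
  also have "\<dots> \<le> (s - 1)\<^sup>2 * (s + 1)\<^sup>2"
  proof (rule mult_left_mono)
    have "(s + 2) / (2 * s) \<le> 2" using s by (simp add: field_simps)
    also have "2 \<le> (9 / 5 :: real)\<^sup>2" by (simp add: power2_eq_square)
    also have "\<dots> \<le> (s + 1)\<^sup>2" using s by (intro power_mono) auto
    finally show "(s + 2) / (2 * s) \<le> (s + 1)\<^sup>2" .
  qed simp
  also have "\<dots> = d\<^sup>2" by (simp add: d_eq power_mult_distrib)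
  finally show "\<bar>1 / sqrt (1 + d) - 1 + d / 2\<bar> \<le> d\<^sup>2" by (simp add: s_def)
qed

section \<open>Expansion of the scaled residuals\<close>

lemma sample_var_eq:
  assumes "n > 0"
  shows "sample_var x n = (\<Sum>j=1..n. (x j)\<^sup>2) / real n - (sample_mean x n)\<^sup>2"
proof -
  define m where "m = sample_mean x n"
  have m: "(\<Sum>j=1..n. x j) = real n * m" using assms by (simp add: m_def sample_mean_def)
  have "(\<Sum>j=1..n. (x j - m)\<^sup>2) = (\<Sum>j=1..n. (x j)\<^sup>2 - (2 * m) * x j + m\<^sup>2)"
    by (intro sum.cong refl) (simp add: power2_diff)
  also have "\<dots> = (\<Sum>j=1..n. (x j)\<^sup>2) - (2 * m) * (\<Sum>j=1..n. x j) + real n * m\<^sup>2"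
    by (simp add: sum.distrib sum_subtractf sum_distrib_left)
  also have "\<dots> = (\<Sum>j=1..n. (x j)\<^sup>2) - real n * m\<^sup>2"
    unfolding m by (simp add: power2_eq_square)
  finally show ?thesis using assms
    by (simp add: sample_var_def m_def[symmetric] diff_divide_distrib)
qed

text \<open>Residuals are affine in the observations. With \<open>r = 1 / sqrt n\<close> the slope
  deviates from 1 by about \<open>- r V / 2\<close> and the intercept is about \<open>- r U\<close>.
  The statement is deterministic once \<open>U\<close> and \<open>V\<close> are bounded by
  \<open>L\<close>. All four bounds share the constant \<open>5 L^2\<close>, so one number can stand
  for them later.\<close>

lemma scaled_residual_expansion:
  fixes x :: "nat \<Rightarrow> real"
  assumes n: "n > 0" and L: "L \<ge> 1" and r: "r = 1 / sqrt (real n)" "r * (8 * L) \<le> 1"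
    and U: "U = (\<Sum>j=1..n. x j) / sqrt (real n)" "\<bar>U\<bar> \<le> L"
    and V: "V = (\<Sum>j=1..n. (x j)\<^sup>2 - 1) / sqrt (real n)" "\<bar>V\<bar> \<le> L"
  obtains \<alpha> b where "\<And>j. scaled_residual x n j = x j + (\<alpha> * x j + b)"
    "\<bar>\<alpha>\<bar> \<le> 5 * L\<^sup>2 * r" "\<bar>b\<bar> \<le> 5 * L\<^sup>2 * r"
    "\<bar>\<alpha> / r + V / 2\<bar> \<le> 5 * L\<^sup>2 * r" "\<bar>b / r + U\<bar> \<le> 5 * L\<^sup>2 * r"
proof -
  have rpos: "r > 0" and r2: "r\<^sup>2 = 1 / real n" using n by (auto simp: r power_divide)
  have LL: "L \<le> L\<^sup>2" using L by (simp add: power2_eq_square)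
  have mean: "sample_mean x n = r * U"
    using n by (simp add: sample_mean_def U(1) r(1) divide_divide_eq_left)
  \<comment> \<open>The deviation of the sample variance from 1. The assumption
    \<open>r * (8 * L) \<le> 1\<close> is made so that
    \<open>\<bar>d\<bar> \<le> 2 * (r * L) \<le> 1 / 4\<close>.\<close>
  define d where "d = r * V - r\<^sup>2 * U\<^sup>2"
  have "(\<Sum>j=1..n. (x j)\<^sup>2) / real n = 1 + r * V"
    using n by (simp add: V(1) r(1) sum_subtractf field_simps)
  then have var: "sample_var x n = 1 + d"
    using sample_var_eq[OF n, of x] by (simp add: mean d_def power_mult_distrib)
  have rL: "r * L \<le> 1 / 8" using r(2) by simp
  have rV: "\<bar>r * V\<bar> \<le> r * L" and rU: "\<bar>r * U\<bar> \<le> r * L"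
    using U(2) V(2) rpos by (auto simp: abs_mult)
  have "\<bar>r\<^sup>2 * U\<^sup>2\<bar> = \<bar>r * U\<bar>\<^sup>2" by (simp add: power_mult_distrib)
  also have "\<dots> \<le> (r * L)\<^sup>2" using rU by (intro power_mono) auto
  also have "\<dots> \<le> (r * L) * (1 / 8)" unfolding power2_eq_square using rL L rpos by (intro mult_left_mono) auto
  finally have d_le: "\<bar>d\<bar> \<le> 2 * (r * L)" unfolding d_def using rV L rpos by linarith
  then have d4: "\<bar>d\<bar> \<le> 1 / 4" using rL by linarith
  define a where "a = 1 / sqrt (1 + d)"
  have a1: "\<bar>a - 1\<bar> \<le> \<bar>d\<bar>" and a2: "\<bar>a - 1 + d / 2\<bar> \<le> d\<^sup>2"
    unfolding a_def by (rule inverse_sqrt_expansion[OF d4])+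
  have res: "scaled_residual x n j = x j + ((a - 1) * x j + (- (a * (r * U))))" for j
    by (simp add: scaled_residual_def var mean a_def diff_divide_distrib algebra_simps)
  have rL2: "r * L \<le> r * L\<^sup>2" using LL rpos by simp
  have b1: "\<bar>a - 1\<bar> \<le> 5 * L\<^sup>2 * r" using a1 d_le rL2 by (simp add: mult.commute)
  have "\<bar>- (a * (r * U))\<bar> = \<bar>a\<bar> * \<bar>r * U\<bar>" by (simp add: abs_mult)
  also have "\<dots> \<le> 2 * (r * L)" using a1 d4 rU by (intro mult_mono) auto
  finally have b2: "\<bar>- (a * (r * U))\<bar> \<le> 5 * L\<^sup>2 * r" using rL2 by (simp add: mult.commute)
  \<comment> \<open>The term \<open>d / 2\<close> differs from \<open>r * V / 2\<close> by
    \<open>r^2 U^2 / 2\<close>. The Taylor error contributes 4 and this term at most 1 to the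
    constant 5.\<close>
  have "(a - 1) / r + V / 2 = (a - 1 + d / 2) / r + r * U\<^sup>2 / 2"
    using rpos by (simp add: d_def field_simps power2_eq_square)
  also have "\<bar>\<dots>\<bar> \<le> \<bar>(a - 1 + d / 2) / r\<bar> + \<bar>r * U\<^sup>2 / 2\<bar>" by (rule abs_triangle_ineq)
  also have "\<bar>(a - 1 + d / 2) / r\<bar> \<le> 4 * L\<^sup>2 * r"
  proof -
    have "\<bar>a - 1 + d / 2\<bar> \<le> \<bar>d\<bar>\<^sup>2" using a2 by simp
    also have "\<dots> \<le> (2 * (r * L))\<^sup>2" using d_le by (intro power_mono) auto
    also have "\<dots> = (4 * L\<^sup>2 * r) * r" by (simp add: power2_eq_square)
    finally have "\<bar>a - 1 + d / 2\<bar> / r \<le> (4 * L\<^sup>2 * r) * r / r" using rpos by (intro divide_right_mono) auto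
    then show ?thesis using rpos by simp
  qed
  also have "\<bar>r * U\<^sup>2 / 2\<bar> \<le> L\<^sup>2 * r"
  proof -
    have "U\<^sup>2 \<le> L\<^sup>2" using U(2) L by (simp add: abs_le_square_iff[symmetric])
    then have "r * U\<^sup>2 \<le> r * L\<^sup>2" using rpos by simp
    moreover have "0 \<le> r * U\<^sup>2" using rpos by simp
    ultimately show ?thesis by (simp add: mult.commute)
  qed
  finally have b3: "\<bar>(a - 1) / r + V / 2\<bar> \<le> 5 * L\<^sup>2 * r" by (simp add: mult.commute)
  have "- (a * (r * U)) / r + U = (1 - a) * U" using rpos by (simp add: algebra_simps)
  also have "\<bar>\<dots>\<bar> = \<bar>a - 1\<bar> * \<bar>U\<bar>" by (simp add: abs_mult abs_minus_commute)
  also have "\<dots> \<le> (2 * (r * L)) * L" using a1 d_le U(2) L rpos by (intro mult_mono) auto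
  also have "\<dots> \<le> 5 * L\<^sup>2 * r" using rpos by (simp add: power2_eq_square)
  finally have b4: "\<bar>- (a * (r * U)) / r + U\<bar> \<le> 5 * L\<^sup>2 * r" .
  show ?thesis by (rule that[OF res b1 b2 b3 b4])
qed

text \<open>A majorant with an explicit normal mean. The fourth power of
  \<open>y = \<bar>t\<bar> * (1 + \<bar>x\<bar>)\<close> costs a factor
  \<open>exp (\<epsilon> * y)\<close> and squaring \<open>exp (\<epsilon> * y)\<close> doubles its
  rate, which makes the \<open>3 * \<epsilon>\<close>; both signs together replace
  \<open>\<bar>x\<bar>\<close> in the exponent. The 24 is \<open>4!\<close>.\<close>

definition qdom :: "real \<Rightarrow> real \<Rightarrow> real \<Rightarrow> real" where
  "qdom \<epsilon> x t = 24 / \<epsilon> ^ 4 * exp (3 * \<epsilon> * \<bar>t\<bar>) * (exp ((2 * t + 3 * \<epsilon> * \<bar>t\<bar>) * x) + exp ((2 * t - 3 * \<epsilon> * \<bar>t\<bar>) * x))"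

lemma qdom_bound:
  assumes \<epsilon>: "\<epsilon> > 0"
  shows "(exp (t * x) * (\<bar>t\<bar> * (1 + \<bar>x\<bar>))\<^sup>2 * exp (\<epsilon> * (\<bar>t\<bar> * (1 + \<bar>x\<bar>))))\<^sup>2 \<le> qdom \<epsilon> x t"
proof -
  define y where "y = \<bar>t\<bar> * (1 + \<bar>x\<bar>)"
  have y: "y \<ge> 0" by (simp add: y_def)
  have "(\<epsilon> * y) ^ 4 \<le> 24 * exp (\<epsilon> * y)"
    using abs_power_le_exp[of "\<epsilon> * y" 4] y \<epsilon> by (simp add: fact_numeral)
  then have y4: "y ^ 4 \<le> 24 / \<epsilon> ^ 4 * exp (\<epsilon> * y)"
    using \<epsilon> by (simp add: power_mult_distrib field_simps)
  have "(exp (t * x) * y\<^sup>2 * exp (\<epsilon> * y))\<^sup>2 = y ^ 4 * exp (2 * (t * x) + 2 * (\<epsilon> * y))"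
  proof -
    have "exp (2 * (t * x) + 2 * (\<epsilon> * y)) = (exp (t * x))\<^sup>2 * (exp (\<epsilon> * y))\<^sup>2"
      by (simp add: exp_add exp_double)
    moreover have "(y\<^sup>2)\<^sup>2 = y ^ 4" by simp
    ultimately show ?thesis by (simp only: power_mult_distrib mult_ac)
  qed
  also have "\<dots> \<le> (24 / \<epsilon> ^ 4 * exp (\<epsilon> * y)) * exp (2 * (t * x) + 2 * (\<epsilon> * y))"
    using y4 by (rule mult_right_mono) simp
  also have "\<dots> = 24 / \<epsilon> ^ 4 * exp (3 * \<epsilon> * \<bar>t\<bar>) * exp (2 * (t * x) + 3 * \<epsilon> * \<bar>t\<bar> * \<bar>x\<bar>)"
    by (simp add: y_def exp_add[symmetric] algebra_simps)
  also have "\<dots> \<le> qdom \<epsilon> x t"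
    unfolding qdom_def
  proof (rule mult_left_mono)
    show "exp (2 * (t * x) + 3 * \<epsilon> * \<bar>t\<bar> * \<bar>x\<bar>)
      \<le> exp ((2 * t + 3 * \<epsilon> * \<bar>t\<bar>) * x) + exp ((2 * t - 3 * \<epsilon> * \<bar>t\<bar>) * x)"
      by (cases "x \<ge> 0") (simp_all add: algebra_simps)
  qed (use \<epsilon> in simp)
  finally show ?thesis by (simp add: y_def)
qed

lemma power2_sum5_le:
  fixes p q r s u :: real
  shows "(p + q + r + s + u)\<^sup>2 \<le> 5 * (p\<^sup>2 + q\<^sup>2 + r\<^sup>2 + s\<^sup>2 + u\<^sup>2)"
  using sum_squares_bound[of p q] sum_squares_bound[of p r] sum_squares_bound[of p s] sum_squares_bound[of p u]
    sum_squares_bound[of q r] sum_squares_bound[of q s] sum_squares_bound[of q u]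
    sum_squares_bound[of r s] sum_squares_bound[of r u] sum_squares_bound[of s u]
  by (simp add: power2_eq_square algebra_simps)

definition zres :: "(nat \<Rightarrow> real) \<Rightarrow> nat \<Rightarrow> real \<Rightarrow> real" where
  "zres x n t = sqrt (real n) * (emp_mgf x n t - std_normal_mgf t)"

text \<open>The summands correspond to the quadratic remainder, the fluctuations of the two
  empirical first-order coefficients, and the two expected coefficients. Dependence on the bound for
  \<open>U\<close> and \<open>V\<close> is left to a separate factor, so that the mean of this
  function is the same for all \<open>n > 0\<close>.\<close>

definition errdom :: "real \<Rightarrow> (nat \<Rightarrow> real) \<Rightarrow> nat \<Rightarrow> real \<Rightarrow> real" where
  "errdom \<epsilon> x n t = (\<Sum>j=1..n. qdom \<epsilon> (x j) t) / real n
    + ((\<Sum>j=1..n. t * x j * exp (t * x j) - t\<^sup>2 * exp (t\<^sup>2 / 2)) / sqrt (real n))\<^sup>2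
    + ((\<Sum>j=1..n. t * exp (t * x j) - t * exp (t\<^sup>2 / 2)) / sqrt (real n))\<^sup>2
    + (t\<^sup>2 * exp (t\<^sup>2 / 2))\<^sup>2 + (t * exp (t\<^sup>2 / 2))\<^sup>2"

text \<open>Expand \<open>exp (t * Y)\<close> to first order about \<open>exp (t * x)\<close>.
  Replacing the empirical coefficients by their expectations, and \<open>\<alpha> / r\<close>,
  \<open>b / r\<close> by \<open>- V / 2\<close>, \<open>- U\<close>, leaves exactly the normalised
  sum of \<open>hker\<close>. The bound is deterministic in the sample.\<close>

lemma zres_diff_bound:
  fixes x :: "nat \<Rightarrow> real"
  assumes n: "n > 0" and r: "r = 1 / sqrt (real n)" and \<epsilon>: "\<epsilon> > 0"
    and K: "K \<ge> 1" "K * r \<le> \<epsilon>"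
    and res: "\<And>j. scaled_residual x n j = x j + (\<alpha> * x j + b)"
    and U: "U = (\<Sum>j=1..n. x j) / sqrt (real n)" and V: "V = (\<Sum>j=1..n. (x j)\<^sup>2 - 1) / sqrt (real n)"
    and bounds: "\<bar>\<alpha>\<bar> \<le> K * r" "\<bar>b\<bar> \<le> K * r" "\<bar>\<alpha> / r + V / 2\<bar> \<le> K * r" "\<bar>b / r + U\<bar> \<le> K * r"
  shows "(zres x n t - (\<Sum>j=1..n. hker (x j) t) / sqrt (real n))\<^sup>2 \<le> 5 * K ^ 4 / real n * errdom \<epsilon> x n t"
proof -
  have rpos: "r > 0" and r2: "r\<^sup>2 = 1 / real n" and rn: "real n * r = 1 / r" using n by (auto simp: r power_divide real_div_sqrt)
  let ?e = "exp (t\<^sup>2 / 2)"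
  define \<rho> where "\<rho> j = exp (t * x j) * (exp (t * (\<alpha> * x j + b)) - 1 - t * (\<alpha> * x j + b))" for j
  define A where "A = (\<Sum>j=1..n. t * x j * exp (t * x j) - t\<^sup>2 * ?e) / sqrt (real n)"
  define B where "B = (\<Sum>j=1..n. t * exp (t * x j) - t * ?e) / sqrt (real n)"
  define q where "q j = exp (t * x j) * (\<bar>t\<bar> * (1 + \<bar>x j\<bar>))\<^sup>2 * exp (\<epsilon> * (\<bar>t\<bar> * (1 + \<bar>x j\<bar>)))" for j
  define Q where "Q = (\<Sum>j=1..n. q j) / real n"
  have sums: "A = r * (\<Sum>j=1..n. t * x j * exp (t * x j)) - t\<^sup>2 * ?e / r"
      "B = r * (\<Sum>j=1..n. t * exp (t * x j)) - t * ?e / r"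
      "U = r * (\<Sum>j=1..n. x j)" "V = r * (\<Sum>j=1..n. (x j)\<^sup>2) - 1 / r"
  proof -
    have sum_shift: "(\<Sum>j=1..n. f j - c) / sqrt (real n) = r * (\<Sum>j=1..n. f j) - c / r" for f :: "nat \<Rightarrow> real" and c
    proof -
      have "(\<Sum>j=1..n. f j - c) / sqrt (real n) = r * (\<Sum>j=1..n. f j) - c * (real n * r)"
        by (simp add: sum_subtractf r algebra_simps diff_divide_distrib)
      then show ?thesis by (simp add: rn)
    qed
    show "A = r * (\<Sum>j=1..n. t * x j * exp (t * x j)) - t\<^sup>2 * ?e / r"
      "B = r * (\<Sum>j=1..n. t * exp (t * x j)) - t * ?e / r" "V = r * (\<Sum>j=1..n. (x j)\<^sup>2) - 1 / r"
      by (simp_all only: A_def B_def V sum_shift)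
    show "U = r * (\<Sum>j=1..n. x j)" by (simp add: U r)
  qed
  have z: "zres x n t = r * (\<Sum>j=1..n. exp (t * scaled_residual x n j)) - ?e / r"
  proof -
    have "sqrt (real n) = real n * r" unfolding rn by (simp add: r)
    then have "zres x n t = (real n * r) * ((\<Sum>j=1..n. exp (t * scaled_residual x n j)) / real n - ?e)"
      by (simp add: zres_def emp_mgf_def std_normal_mgf_def)
    also have "\<dots> = r * (\<Sum>j=1..n. exp (t * scaled_residual x n j)) - (real n * r) * ?e"
      using n by (simp add: right_diff_distrib)
    finally show ?thesis by (simp add: rn)
  qed
  have "(\<Sum>j=1..n. exp (t * scaled_residual x n j))
    = (\<Sum>j=1..n. exp (t * x j) + \<alpha> * (t * x j * exp (t * x j)) + b * (t * exp (t * x j)) + \<rho> j)"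
    by (intro sum.cong refl) (simp add: res \<rho>_def distrib_left exp_add algebra_simps)
  also have "\<dots> = (\<Sum>j=1..n. exp (t * x j)) + \<alpha> * (\<Sum>j=1..n. t * x j * exp (t * x j))
      + b * (\<Sum>j=1..n. t * exp (t * x j)) + (\<Sum>j=1..n. \<rho> j)"
    by (simp only: sum.distrib sum_distrib_left)
  finally have z': "zres x n t = r * (\<Sum>j=1..n. exp (t * x j)) + \<alpha> * (r * (\<Sum>j=1..n. t * x j * exp (t * x j)))
      + b * (r * (\<Sum>j=1..n. t * exp (t * x j))) + r * (\<Sum>j=1..n. \<rho> j) - ?e / r"
    unfolding z by (simp add: algebra_simps)
  define c where "c = ?e * t\<^sup>2 / 2"
  have "(\<Sum>j=1..n. hker (x j) t) = (\<Sum>j=1..n. exp (t * x j) - (?e * t) * x j - c * (x j)\<^sup>2 - (?e - c))"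
    by (intro sum.cong refl) (simp add: hker_def taylor2_def c_def algebra_simps diff_divide_distrib)
  also have "\<dots> = (\<Sum>j=1..n. exp (t * x j)) - (?e * t) * (\<Sum>j=1..n. x j) - c * (\<Sum>j=1..n. (x j)\<^sup>2) - real n * (?e - c)"
    by (simp add: sum_subtractf sum_distrib_left)
  finally have "(\<Sum>j=1..n. hker (x j) t) / sqrt (real n) = r * (\<Sum>j=1..n. exp (t * x j))
      - (?e * t) * (r * (\<Sum>j=1..n. x j)) - c * (r * (\<Sum>j=1..n. (x j)\<^sup>2)) - (real n * r) * (?e - c)"
    by (simp add: r diff_divide_distrib)
  also have "\<dots> = r * (\<Sum>j=1..n. exp (t * x j)) - ?e / r - ?e * t * U - c * V"
    unfolding rn sums by (simp add: algebra_simps diff_divide_distrib)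
  finally have h: "(\<Sum>j=1..n. hker (x j) t) / sqrt (real n) = r * (\<Sum>j=1..n. exp (t * x j)) - ?e / r
      - ?e * t * U - ?e * t\<^sup>2 / 2 * V"
    by (simp add: c_def)
  \<comment> \<open>The five errors: the quadratic remainder, \<open>\<alpha>\<close> and
    \<open>b\<close> times the fluctuations \<open>A\<close> and \<open>B\<close>, and the errors of
    the linear approximations of \<open>\<alpha>\<close> and \<open>b\<close> times the expected
    coefficients.\<close>
  have diff: "zres x n t - (\<Sum>j=1..n. hker (x j) t) / sqrt (real n)
    = r * (\<Sum>j=1..n. \<rho> j) + \<alpha> * A + b * B + (\<alpha> / r + V / 2) * (t\<^sup>2 * ?e) + (b / r + U) * (t * ?e)"
    unfolding z' h sums(1,2) using rpos by (simp add: algebra_simps add_divide_distrib)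
  have \<rho>: "\<bar>\<rho> j\<bar> \<le> (K * r)\<^sup>2 * q j" for j
  proof -
    define y where "y = \<bar>t\<bar> * (1 + \<bar>x j\<bar>)"
    have y: "y \<ge> 0" by (simp add: y_def)
    have "\<bar>\<alpha> * x j + b\<bar> \<le> \<bar>\<alpha>\<bar> * \<bar>x j\<bar> + \<bar>b\<bar>" by (metis abs_mult abs_triangle_ineq)
    also have "\<dots> \<le> (K * r) * \<bar>x j\<bar> + K * r" using bounds by (intro add_mono mult_right_mono) auto
    finally have "\<bar>\<alpha> * x j + b\<bar> \<le> (K * r) * (1 + \<bar>x j\<bar>)" by (simp add: algebra_simps)
    then have ty: "\<bar>t * (\<alpha> * x j + b)\<bar> \<le> (K * r) * y"
    proof -
      have "\<bar>t\<bar> * \<bar>\<alpha> * x j + b\<bar> \<le> \<bar>t\<bar> * ((K * r) * (1 + \<bar>x j\<bar>))"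
        using \<open>\<bar>\<alpha> * x j + b\<bar> \<le> (K * r) * (1 + \<bar>x j\<bar>)\<close> by (rule mult_left_mono) simp
      then show ?thesis by (simp only: abs_mult y_def mult_ac)
    qed
    also have "(K * r) * y \<le> \<epsilon> * y" using K(2) y by (rule mult_right_mono)
    finally have ty': "\<bar>t * (\<alpha> * x j + b)\<bar> \<le> \<epsilon> * y" .
    have "\<bar>exp (t * (\<alpha> * x j + b)) - 1 - t * (\<alpha> * x j + b)\<bar> \<le> \<bar>t * (\<alpha> * x j + b)\<bar>\<^sup>2 * exp \<bar>t * (\<alpha> * x j + b)\<bar>"
      using exp_remainder[of "t * (\<alpha> * x j + b)"] by simp
    also have "\<dots> \<le> ((K * r) * y)\<^sup>2 * exp (\<epsilon> * y)"
      using ty ty' by (intro mult_mono power_mono) auto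
    finally have "\<bar>\<rho> j\<bar> \<le> exp (t * x j) * (((K * r) * y)\<^sup>2 * exp (\<epsilon> * y))"
      unfolding \<rho>_def abs_mult by (simp only: abs_exp_cancel) (rule mult_left_mono, simp_all)
    also have "\<dots> = (K * r)\<^sup>2 * q j" by (simp add: q_def y_def power_mult_distrib mult_ac)
    finally show ?thesis .
  qed
  have K2: "K \<le> K\<^sup>2" "0 \<le> K" using K by (auto simp: power2_eq_square)
  have "\<bar>r * (\<Sum>j=1..n. \<rho> j)\<bar> \<le> r * (\<Sum>j=1..n. \<bar>\<rho> j\<bar>)"
    using rpos by (simp add: abs_mult)
  also have "\<dots> \<le> r * (\<Sum>j=1..n. (K * r)\<^sup>2 * q j)"
    using rpos \<rho> by (intro mult_left_mono sum_mono) auto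
  also have "\<dots> = K\<^sup>2 * r * Q"
    unfolding Q_def sum_distrib_left[symmetric] power_mult_distrib r2 by simp
  finally have 1: "\<bar>r * (\<Sum>j=1..n. \<rho> j)\<bar> \<le> K\<^sup>2 * r * Q" .
  \<comment> \<open>Since \<open>K \<ge> 1\<close>, the first-order errors can be given the same
    factor \<open>K\<^sup>2 * r\<close> as the quadratic one.\<close>
  have bnd: "\<bar>c * D\<bar> \<le> K\<^sup>2 * r * \<bar>D\<bar>" if "\<bar>c\<bar> \<le> K * r" for c D :: real
  proof -
    have "K * r \<le> K\<^sup>2 * r" using K2 rpos by (intro mult_right_mono) auto
    then show ?thesis unfolding abs_mult using that by (intro mult_right_mono) auto
  qed
  have "\<bar>zres x n t - (\<Sum>j=1..n. hker (x j) t) / sqrt (real n)\<bar>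
    \<le> K\<^sup>2 * r * Q + K\<^sup>2 * r * \<bar>A\<bar> + K\<^sup>2 * r * \<bar>B\<bar> + K\<^sup>2 * r * \<bar>t\<^sup>2 * ?e\<bar> + K\<^sup>2 * r * \<bar>t * ?e\<bar>"
  proof -
    have tri: "\<bar>p + q + u + v + w\<bar> \<le> \<bar>p\<bar> + \<bar>q\<bar> + \<bar>u\<bar> + \<bar>v\<bar> + \<bar>w\<bar>" for p q u v w :: real
      by linarith
    show ?thesis
      unfolding diff by (rule order.trans[OF tri]) (intro add_mono 1 bnd bounds)
  qed
  also have "\<dots> = (K\<^sup>2 * r) * (Q + \<bar>A\<bar> + \<bar>B\<bar> + \<bar>t\<^sup>2 * ?e\<bar> + \<bar>t * ?e\<bar>)"
    by (simp only: distrib_left)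
  finally have "\<bar>zres x n t - (\<Sum>j=1..n. hker (x j) t) / sqrt (real n)\<bar>\<^sup>2
    \<le> ((K\<^sup>2 * r) * (Q + \<bar>A\<bar> + \<bar>B\<bar> + \<bar>t\<^sup>2 * ?e\<bar> + \<bar>t * ?e\<bar>))\<^sup>2"
    by (rule power_mono) simp
  also have "\<dots> = K ^ 4 / real n * (Q + \<bar>A\<bar> + \<bar>B\<bar> + \<bar>t\<^sup>2 * ?e\<bar> + \<bar>t * ?e\<bar>)\<^sup>2"
    by (simp add: power_mult_distrib r2)
  also have "\<dots> \<le> K ^ 4 / real n * (5 * (Q\<^sup>2 + \<bar>A\<bar>\<^sup>2 + \<bar>B\<bar>\<^sup>2 + \<bar>t\<^sup>2 * ?e\<bar>\<^sup>2 + \<bar>t * ?e\<bar>\<^sup>2))"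
    by (intro mult_left_mono power2_sum5_le) (use K in auto)
  also have "\<dots> \<le> K ^ 4 / real n * (5 * errdom \<epsilon> x n t)"
  proof -
    \<comment> \<open>Cauchy-Schwarz replaces the square of the average by the average of squares,
      whose mean needs only a single observation.\<close>
    have "(\<Sum>j=1..n. q j)\<^sup>2 \<le> real n * (\<Sum>j=1..n. (q j)\<^sup>2)"
      using sum_squared_le_sum_of_squares[of q "{1..n}"] by (simp add: mult.commute)
    also have "\<dots> \<le> real n * (\<Sum>j=1..n. qdom \<epsilon> (x j) t)"
      unfolding q_def by (intro mult_left_mono sum_mono qdom_bound[OF \<epsilon>]) auto
    finally have "Q\<^sup>2 \<le> (\<Sum>j=1..n. qdom \<epsilon> (x j) t) / real n"
      using n by (simp add: Q_def power_divide field_simps power2_eq_square)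
    moreover have "errdom \<epsilon> x n t = (\<Sum>j=1..n. qdom \<epsilon> (x j) t) / real n + A\<^sup>2 + B\<^sup>2 + (t\<^sup>2 * ?e)\<^sup>2 + (t * ?e)\<^sup>2"
      by (simp only: errdom_def A_def B_def)
    ultimately have "Q\<^sup>2 + \<bar>A\<bar>\<^sup>2 + \<bar>B\<bar>\<^sup>2 + \<bar>t\<^sup>2 * ?e\<bar>\<^sup>2 + \<bar>t * ?e\<bar>\<^sup>2 \<le> errdom \<epsilon> x n t"
      by (simp only: power2_abs)
    then show ?thesis
      by (intro mult_left_mono) (use K in auto)
  qed
  finally show ?thesis by (simp add: mult_ac)
qed

text \<open>Allows the norms themselves to be compared instead of their squares, so that a small
  norm of the difference is enough. The slope is bounded through
  \<open>2 \<bar>x\<bar> \<le> 1 + x^2 \<le> exp (x^2)\<close>.\<close>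

lemma exp_neg_square_Lipschitz:
  fixes u v :: real
  shows "\<bar>exp (- u\<^sup>2) - exp (- v\<^sup>2)\<bar> \<le> \<bar>u - v\<bar>"
proof -
  have "norm (exp (- u\<^sup>2) - exp (- v\<^sup>2)) \<le> 1 * norm (u - v)"
  proof (rule field_differentiable_bound[of UNIV "\<lambda>x. exp (- x\<^sup>2)" "\<lambda>x. - 2 * x * exp (- x\<^sup>2)"])
    fix x :: real
    show "((\<lambda>x. exp (- x\<^sup>2)) has_field_derivative - 2 * x * exp (- x\<^sup>2)) (at x within UNIV)"
      by (auto intro!: derivative_eq_intros)
    have "2 * \<bar>x\<bar> \<le> 1 + x\<^sup>2" using sum_squares_bound[of 1 "\<bar>x\<bar>"] by simp
    also have "\<dots> \<le> exp (x\<^sup>2)" by (rule exp_ge_add_one_self)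
    finally have "2 * \<bar>x\<bar> * exp (- x\<^sup>2) \<le> exp (x\<^sup>2) * exp (- x\<^sup>2)" by (rule mult_right_mono) simp
    then show "norm (- 2 * x * exp (- x\<^sup>2)) \<le> 1" by (simp add: abs_mult exp_minus)
  qed auto
  then show ?thesis by simp
qed

section \<open>Moments of the error bound\<close>

lemma exp_shift_x:
  "has_bochner_integral std_normal_distribution (\<lambda>x. exp (u * x) * x) (exp (u\<^sup>2 / 2) * u)"
proof (rule std_normal_exp_shift)
  show "has_bochner_integral std_normal_distribution (\<lambda>x. x + u) u"
    using std_normal_poly[of u 1 0 0 0] by (simp add: add.commute)
qed simp

lemma exp_shift_x2:
  "has_bochner_integral std_normal_distribution (\<lambda>x. exp (u * x) * x\<^sup>2) (exp (u\<^sup>2 / 2) * (u\<^sup>2 + 1))"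
proof (rule std_normal_exp_shift)
  have "(x + u)\<^sup>2 = u\<^sup>2 + 2 * u * x + 1 * x\<^sup>2 + 0 * x ^ 3 + 0 * x ^ 4" for x
    by (simp add: power2_sum algebra_simps)
  then show "has_bochner_integral std_normal_distribution (\<lambda>x. (x + u)\<^sup>2) (u\<^sup>2 + 1)"
    using std_normal_poly[of "u\<^sup>2" "2 * u" 1 0 0] by simp
qed simp

definition qmean :: "real \<Rightarrow> real \<Rightarrow> real" where
  "qmean \<epsilon> t = 24 / \<epsilon> ^ 4 * exp (3 * \<epsilon> * \<bar>t\<bar>)
    * (exp ((2 * t + 3 * \<epsilon> * \<bar>t\<bar>)\<^sup>2 / 2) + exp ((2 * t - 3 * \<epsilon> * \<bar>t\<bar>)\<^sup>2 / 2))"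

lemma qdom_mean:
  "has_bochner_integral std_normal_distribution (\<lambda>x. qdom \<epsilon> x t) (qmean \<epsilon> t)"
  unfolding qdom_def qmean_def by (intro has_bochner_integral_mult_right has_bochner_integral_add exp_shift_1)

lemma centred_exp_moments:
  shows "has_bochner_integral std_normal_distribution (\<lambda>x. t * exp (t * x) - t * exp (t\<^sup>2 / 2)) 0"
    and "has_bochner_integral std_normal_distribution (\<lambda>x. (t * exp (t * x) - t * exp (t\<^sup>2 / 2))\<^sup>2)
      (t\<^sup>2 * exp (2 * t\<^sup>2) - (t * exp (t\<^sup>2 / 2))\<^sup>2)"
proof -
  have one: "has_bochner_integral std_normal_distribution (\<lambda>x. c) c" for c :: real
    using std_normal_poly[of c 0 0 0 0] by simp
  have "has_bochner_integral std_normal_distribution (\<lambda>x. t * exp (t * x) - t * exp (t\<^sup>2 / 2))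
      (t * exp (t\<^sup>2 / 2) - t * exp (t\<^sup>2 / 2))"
    by (intro has_bochner_integral_diff has_bochner_integral_mult_right exp_shift_1 one)
  then show "has_bochner_integral std_normal_distribution (\<lambda>x. t * exp (t * x) - t * exp (t\<^sup>2 / 2)) 0"
    by simp
  let ?m = "t * exp (t\<^sup>2 / 2)"
  have "has_bochner_integral std_normal_distribution
      (\<lambda>x. t\<^sup>2 * exp ((2 * t) * x) - 2 * ?m * t * exp (t * x) + ?m\<^sup>2)
      (t\<^sup>2 * exp ((2 * t)\<^sup>2 / 2) - 2 * ?m * t * exp (t\<^sup>2 / 2) + ?m\<^sup>2)"
    by (intro has_bochner_integral_diff has_bochner_integral_add has_bochner_integral_mult_right exp_shift_1 one)
  moreover have "t\<^sup>2 * exp ((2 * t) * x) - 2 * ?m * t * exp (t * x) + ?m\<^sup>2 = (t * exp (t * x) - ?m)\<^sup>2" for x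
    by (simp add: power2_diff power_mult_distrib exp_double[symmetric] mult_ac)
  moreover have "t\<^sup>2 * exp ((2 * t)\<^sup>2 / 2) - 2 * ?m * t * exp (t\<^sup>2 / 2) + ?m\<^sup>2 = t\<^sup>2 * exp (2 * t\<^sup>2) - ?m\<^sup>2"
    by (simp add: power_mult_distrib power2_eq_square mult_ac)
  ultimately show "has_bochner_integral std_normal_distribution (\<lambda>x. (t * exp (t * x) - ?m)\<^sup>2)
      (t\<^sup>2 * exp (2 * t\<^sup>2) - ?m\<^sup>2)"
    by (simp only:)
qed

lemma centred_x_exp_moments:
  shows "has_bochner_integral std_normal_distribution (\<lambda>x. t * x * exp (t * x) - t\<^sup>2 * exp (t\<^sup>2 / 2)) 0"
    and "has_bochner_integral std_normal_distribution (\<lambda>x. (t * x * exp (t * x) - t\<^sup>2 * exp (t\<^sup>2 / 2))\<^sup>2)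
      (t\<^sup>2 * exp (2 * t\<^sup>2) * (4 * t\<^sup>2 + 1) - (t\<^sup>2 * exp (t\<^sup>2 / 2))\<^sup>2)"
proof -
  have one: "has_bochner_integral std_normal_distribution (\<lambda>x. c) c" for c :: real
    using std_normal_poly[of c 0 0 0 0] by simp
  let ?m = "t\<^sup>2 * exp (t\<^sup>2 / 2)"
  have "has_bochner_integral std_normal_distribution (\<lambda>x. t * (exp (t * x) * x) - ?m)
      (t * (exp (t\<^sup>2 / 2) * t) - ?m)"
    by (intro has_bochner_integral_diff has_bochner_integral_mult_right exp_shift_x one)
  moreover have "t * (exp (t\<^sup>2 / 2) * t) - ?m = 0" by (simp add: power2_eq_square)
  moreover have "t * (exp (t * x) * x) = t * x * exp (t * x)" for x by simp
  ultimately show "has_bochner_integral std_normal_distribution (\<lambda>x. t * x * exp (t * x) - ?m) 0"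
    by (simp only:)
  have "has_bochner_integral std_normal_distribution
      (\<lambda>x. t\<^sup>2 * (exp ((2 * t) * x) * x\<^sup>2) - 2 * ?m * t * (exp (t * x) * x) + ?m\<^sup>2)
      (t\<^sup>2 * (exp ((2 * t)\<^sup>2 / 2) * ((2 * t)\<^sup>2 + 1)) - 2 * ?m * t * (exp (t\<^sup>2 / 2) * t) + ?m\<^sup>2)"
    by (intro has_bochner_integral_diff has_bochner_integral_add has_bochner_integral_mult_right exp_shift_x exp_shift_x2 one)
  moreover have "t\<^sup>2 * (exp ((2 * t) * x) * x\<^sup>2) - 2 * ?m * t * (exp (t * x) * x) + ?m\<^sup>2 = (t * x * exp (t * x) - ?m)\<^sup>2" for x
    by (simp add: power2_diff power_mult_distrib exp_double[symmetric] mult_ac)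
  moreover have "t\<^sup>2 * (exp ((2 * t)\<^sup>2 / 2) * ((2 * t)\<^sup>2 + 1)) - 2 * ?m * t * (exp (t\<^sup>2 / 2) * t) + ?m\<^sup>2
      = t\<^sup>2 * exp (2 * t\<^sup>2) * (4 * t\<^sup>2 + 1) - ?m\<^sup>2"
    by (simp add: power_mult_distrib power2_eq_square mult_ac)
  ultimately show "has_bochner_integral std_normal_distribution (\<lambda>x. (t * x * exp (t * x) - ?m)\<^sup>2)
      (t\<^sup>2 * exp (2 * t\<^sup>2) * (4 * t\<^sup>2 + 1) - ?m\<^sup>2)"
    by (simp only:)
qed

text \<open>The mean of \<open>errdom\<close> for \<open>n > 0\<close>. The deterministic squares in
  \<open>errdom\<close> cancel the squared means that are subtracted in the two variances.\<close>

definition errmean :: "real \<Rightarrow> real \<Rightarrow> real" where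
  "errmean \<epsilon> t = qmean \<epsilon> t
    + t\<^sup>2 * exp (2 * t\<^sup>2) * (4 * t\<^sup>2 + 1) + t\<^sup>2 * exp (2 * t\<^sup>2)"

text \<open>The mean of \<open>qdom\<close> grows like
  \<open>exp ((2 + 3 \<epsilon>)^2 t^2 / 2)\<close> up to a linear exponent, a rate tending to 2 as
  \<open>\<epsilon>\<close> tends to 0: here the room left by \<open>\<beta> > 2\<close> is spent.
  The other summands have rate 2.\<close>

lemma errmean_integrable:
  assumes \<epsilon>: "\<epsilon> > 0" "(2 + 3 * \<epsilon>)\<^sup>2 / 2 < \<beta>" and \<beta>: "\<beta> > 2"
  shows "integrable (wmeasure \<beta>) (errmean \<epsilon>)"
proof -
  let ?a = "(2 + 3 * \<epsilon>)\<^sup>2 / 2"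
  have 1: "integrable (wmeasure \<beta>) (qmean \<epsilon>)"
  proof (rule Bochner_Integration.integrable_bound)
    show "integrable (wmeasure \<beta>) (\<lambda>t. 48 / \<epsilon> ^ 4 * exp (3 * \<epsilon> * \<bar>t\<bar> + ?a * t\<^sup>2))"
      by (intro integrable_mult_right integrable_wmeasure_exp \<epsilon>)
    show "AE t in wmeasure \<beta>. norm (qmean \<epsilon> t)
      \<le> norm (48 / \<epsilon> ^ 4 * exp (3 * \<epsilon> * \<bar>t\<bar> + ?a * t\<^sup>2))"
    proof (intro AE_I2)
      fix t :: real
      have sq: "c\<^sup>2 / 2 \<le> ?a * t\<^sup>2" if "\<bar>c\<bar> \<le> (2 + 3 * \<epsilon>) * \<bar>t\<bar>" for c
      proof -
        have "c\<^sup>2 \<le> ((2 + 3 * \<epsilon>) * \<bar>t\<bar>)\<^sup>2" using that \<epsilon> by (simp add: abs_le_square_iff[symmetric])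
        then show ?thesis by (simp add: power_mult_distrib)
      qed
      have tri: "\<bar>2 * t + 3 * \<epsilon> * \<bar>t\<bar>\<bar> \<le> (2 + 3 * \<epsilon>) * \<bar>t\<bar>" "\<bar>2 * t - 3 * \<epsilon> * \<bar>t\<bar>\<bar> \<le> (2 + 3 * \<epsilon>) * \<bar>t\<bar>"
        using abs_triangle_ineq[of "2 * t" "3 * \<epsilon> * \<bar>t\<bar>"] abs_triangle_ineq4[of "2 * t" "3 * \<epsilon> * \<bar>t\<bar>"] \<epsilon>
        by (simp_all add: abs_mult distrib_right)
      have "qmean \<epsilon> t
        \<le> 24 / \<epsilon> ^ 4 * exp (3 * \<epsilon> * \<bar>t\<bar>) * (exp (?a * t\<^sup>2) + exp (?a * t\<^sup>2))"
        unfolding qmean_def using sq[OF tri(1)] sq[OF tri(2)] \<epsilon> by (intro mult_left_mono add_mono) auto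
      also have "\<dots> = 48 / \<epsilon> ^ 4 * exp (3 * \<epsilon> * \<bar>t\<bar> + ?a * t\<^sup>2)"
        by (simp add: exp_add)
      finally have le: "qmean \<epsilon> t
        \<le> 48 / \<epsilon> ^ 4 * exp (3 * \<epsilon> * \<bar>t\<bar> + ?a * t\<^sup>2)" .
      have "0 \<le> qmean \<epsilon> t"
        unfolding qmean_def using \<epsilon> by (intro mult_nonneg_nonneg add_nonneg_nonneg) auto
      with le show "norm (qmean \<epsilon> t)
          \<le> norm (48 / \<epsilon> ^ 4 * exp (3 * \<epsilon> * \<bar>t\<bar> + ?a * t\<^sup>2))"
        unfolding real_norm_def by linarith
    qed
  qed (simp add: qmean_def[abs_def])
  have "integrable (wmeasure \<beta>) (\<lambda>t. (t ^ k * exp (0 * t + 1 * t\<^sup>2))\<^sup>2)" for k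
    by (rule sq_integrable_square) (use power_exp_wL2[of 1 \<beta> k 0] \<beta> in \<open>simp add: wL2_iff\<close>)
  from this[of 1] this[of 2]
  have "integrable (wmeasure \<beta>) (\<lambda>t. 4 * (t ^ 2 * exp (0 * t + 1 * t\<^sup>2))\<^sup>2 + 2 * (t ^ 1 * exp (0 * t + 1 * t\<^sup>2))\<^sup>2)"
    by (intro Bochner_Integration.integrable_add integrable_mult_right)
  moreover have "4 * (t ^ 2 * exp (0 * t + 1 * t\<^sup>2))\<^sup>2 + 2 * (t ^ 1 * exp (0 * t + 1 * t\<^sup>2))\<^sup>2
      = t\<^sup>2 * exp (2 * t\<^sup>2) * (4 * t\<^sup>2 + 1) + t\<^sup>2 * exp (2 * t\<^sup>2)" for t :: real
    by (simp add: power_mult_distrib exp_double power2_eq_square[of "t\<^sup>2"] distrib_left mult_ac)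
  ultimately have 2: "integrable (wmeasure \<beta>) (\<lambda>t. t\<^sup>2 * exp (2 * t\<^sup>2) * (4 * t\<^sup>2 + 1) + t\<^sup>2 * exp (2 * t\<^sup>2))"
    by (simp only:)
  show ?thesis
    using Bochner_Integration.integrable_add[OF 1 2] by (simp add: errmean_def[abs_def] add.assoc)
qed

lemma errdom_nonneg: "\<epsilon> > 0 \<Longrightarrow> 0 \<le> errdom \<epsilon> x n t"
  unfolding errdom_def qdom_def
  by (intro add_nonneg_nonneg divide_nonneg_nonneg sum_nonneg mult_nonneg_nonneg zero_le_power2) auto

context normal_sample
begin

lemma sample_measurable_fst [measurable]: "j \<ge> 1 \<Longrightarrow> (\<lambda>p. \<xi> j (fst p)) \<in> borel_measurable (M \<Otimes>\<^sub>M N)"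
  by (rule measurable_compose[OF measurable_fst]) simp

lemma errdom_measurable:
  "(\<lambda>(\<omega>, t). errdom \<epsilon> (\<lambda>j. \<xi> j \<omega>) n t) \<in> borel_measurable (M \<Otimes>\<^sub>M wmeasure \<beta>)"
proof -
  have [measurable]: "snd \<in> borel_measurable (M \<Otimes>\<^sub>M wmeasure \<beta>)"
    using measurable_snd[of M "wmeasure \<beta>"] by (simp cong: measurable_cong_sets)
  show ?thesis
    unfolding errdom_def qdom_def split_beta'
    by (intro borel_measurable_add borel_measurable_power borel_measurable_divide borel_measurable_sum) measurable
qed

lemma nsum_has_second_moment:
  assumes m: "\<phi> \<in> borel_measurable borel" "has_bochner_integral std_normal_distribution \<phi> 0"
    "has_bochner_integral std_normal_distribution (\<lambda>x. (\<phi> x)\<^sup>2) v" and n: "n > 0"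
  shows "has_bochner_integral M (\<lambda>\<omega>. (nsum \<phi> n \<omega>)\<^sup>2) v"
proof -
  have "sq_integrable std_normal_distribution \<phi>"
    using m(1) integrable.intros[OF m(3)] by (simp add: sq_integrable_def)
  then show ?thesis
    unfolding has_bochner_integral_iff
    using nsum_second_moment[OF _ has_bochner_integral_integral_eq[OF m(2)] n] has_bochner_integral_integral_eq[OF m(3)]
    by metis
qed

lemma errdom_mean:
  assumes n: "n > 0"
  shows "has_bochner_integral M (\<lambda>\<omega>. errdom \<epsilon> (\<lambda>j. \<xi> j \<omega>) n t) (errmean \<epsilon> t)"
proof -
  let ?A = "\<lambda>x. t * x * exp (t * x) - t\<^sup>2 * exp (t\<^sup>2 / 2)" and ?B = "\<lambda>x. t * exp (t * x) - t * exp (t\<^sup>2 / 2)"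
  have qm: "(\<lambda>x. qdom \<epsilon> x t) \<in> borel_measurable borel" unfolding qdom_def by measurable
  have "has_bochner_integral M (\<lambda>\<omega>. qdom \<epsilon> (\<xi> j \<omega>) t) (qmean \<epsilon> t)" if "j \<in> {1..n}" for j
    using that integral_sample[OF _ qm, of j] qdom_mean[of \<epsilon> t] by (simp add: has_bochner_integral_iff)
  then have "has_bochner_integral M (\<lambda>\<omega>. \<Sum>j=1..n. qdom \<epsilon> (\<xi> j \<omega>) t) (\<Sum>j=1..n. qmean \<epsilon> t)"
    by (rule has_bochner_integral_sum)
  then have "has_bochner_integral M (\<lambda>\<omega>. (\<Sum>j=1..n. qdom \<epsilon> (\<xi> j \<omega>) t) / real n) ((\<Sum>j=1..n. qmean \<epsilon> t) / real n)"
    by (rule has_bochner_integral_divide_zero)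
  moreover have "(\<Sum>j=1..n. qmean \<epsilon> t) / real n = qmean \<epsilon> t" using n by (simp only: sum_constant card_atLeastAtMost) simp
  ultimately have 1: "has_bochner_integral M (\<lambda>\<omega>. (\<Sum>j=1..n. qdom \<epsilon> (\<xi> j \<omega>) t) / real n) (qmean \<epsilon> t)"
    by (simp only:)
  have 2: "has_bochner_integral M (\<lambda>\<omega>. (nsum ?A n \<omega>)\<^sup>2) (t\<^sup>2 * exp (2 * t\<^sup>2) * (4 * t\<^sup>2 + 1) - (t\<^sup>2 * exp (t\<^sup>2 / 2))\<^sup>2)"
    by (intro nsum_has_second_moment centred_x_exp_moments n) simp
  have 3: "has_bochner_integral M (\<lambda>\<omega>. (nsum ?B n \<omega>)\<^sup>2) (t\<^sup>2 * exp (2 * t\<^sup>2) - (t * exp (t\<^sup>2 / 2))\<^sup>2)"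
    by (intro nsum_has_second_moment centred_exp_moments n) simp
  have one: "has_bochner_integral M (\<lambda>\<omega>. c) c" for c :: real
    by (simp add: has_bochner_integral_iff prob_space)
  have "has_bochner_integral M (\<lambda>\<omega>. errdom \<epsilon> (\<lambda>j. \<xi> j \<omega>) n t)
    (qmean \<epsilon> t + (t\<^sup>2 * exp (2 * t\<^sup>2) * (4 * t\<^sup>2 + 1) - (t\<^sup>2 * exp (t\<^sup>2 / 2))\<^sup>2) + (t\<^sup>2 * exp (2 * t\<^sup>2) - (t * exp (t\<^sup>2 / 2))\<^sup>2)
      + (t\<^sup>2 * exp (t\<^sup>2 / 2))\<^sup>2 + (t * exp (t\<^sup>2 / 2))\<^sup>2)"
    unfolding errdom_def by (intro has_bochner_integral_add 1 2[unfolded nsum_def] 3[unfolded nsum_def] one)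
  then show ?thesis by (simp add: errmean_def add.assoc)
qed

lemma errdom_integrable:
  assumes \<epsilon>: "\<epsilon> > 0" "(2 + 3 * \<epsilon>)\<^sup>2 / 2 < \<beta>" and \<beta>: "\<beta> > 2" and n: "n > 0"
  shows "AE \<omega> in M. integrable (wmeasure \<beta>) (errdom \<epsilon> (\<lambda>j. \<xi> j \<omega>) n)"
    and "integrable M (\<lambda>\<omega>. \<integral>t. errdom \<epsilon> (\<lambda>j. \<xi> j \<omega>) n t \<partial>wmeasure \<beta>)"
    and "(\<integral>\<omega>. (\<integral>t. errdom \<epsilon> (\<lambda>j. \<xi> j \<omega>) n t \<partial>wmeasure \<beta>) \<partial>M) = (\<integral>t. errmean \<epsilon> t \<partial>wmeasure \<beta>)"
proof -
  interpret P: pair_sigma_finite M "wmeasure \<beta>" using \<beta> by (intro pair_sigma_finite_wmeasure) simp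
  have m: "integrable M (\<lambda>\<omega>. errdom \<epsilon> (\<lambda>j. \<xi> j \<omega>) n t)"
    "(\<integral>\<omega>. errdom \<epsilon> (\<lambda>j. \<xi> j \<omega>) n t \<partial>M) = errmean \<epsilon> t" for t
    using errdom_mean[OF n, of \<epsilon> t] by (simp_all add: has_bochner_integral_iff)
  have *: "integrable (wmeasure \<beta>) (\<lambda>t. \<integral>\<omega>. errdom \<epsilon> (\<lambda>j. \<xi> j \<omega>) n t \<partial>M)"
    using errmean_integrable[OF \<epsilon> \<beta>] by (simp add: m(2))
  note k = P.nonneg_kernelI[OF errdom_measurable errdom_nonneg[OF \<epsilon>(1)] m(1) *]
  show "AE \<omega> in M. integrable (wmeasure \<beta>) (errdom \<epsilon> (\<lambda>j. \<xi> j \<omega>) n)"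
    using P.AE_integrable_fst'[OF k(1)] by simp
  show "integrable M (\<lambda>\<omega>. \<integral>t. errdom \<epsilon> (\<lambda>j. \<xi> j \<omega>) n t \<partial>wmeasure \<beta>)"
    using P.integrable_fst'[OF k(1)] by simp
  show "(\<integral>\<omega>. (\<integral>t. errdom \<epsilon> (\<lambda>j. \<xi> j \<omega>) n t \<partial>wmeasure \<beta>) \<partial>M) = (\<integral>t. errmean \<epsilon> t \<partial>wmeasure \<beta>)"
    unfolding k(2) by (simp add: m(2))
qed

end

section \<open>Comparison of the statistic with its linearisation\<close>

lemma zres_wL2:
  assumes "\<beta> > 2" "n > 0"
  shows "zres x n \<in> wL2 \<beta>"
proof -
  have "(\<lambda>t. \<Sum>j=1..n. (1 / sqrt (real n)) * (t ^ 0 * exp (scaled_residual x n j * t + 0 * t\<^sup>2)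
    + (-1) * (t ^ 0 * exp (0 * t + 1 / 2 * t\<^sup>2)))) \<in> wL2 \<beta>"
    unfolding wL2_iff
    by (intro sq_integrable_sum sq_integrable_add sq_integrable_cmult; unfold wL2_iff[symmetric], rule power_exp_wL2)
      (use assms in auto)
  moreover have "(\<Sum>j=1..n. (1 / sqrt (real n)) * (t ^ 0 * exp (scaled_residual x n j * t + 0 * t\<^sup>2)
    + (-1) * (t ^ 0 * exp (0 * t + 1 / 2 * t\<^sup>2)))) = zres x n t" for t
  proof -
    have "(\<Sum>j=1..n. (1 / sqrt (real n)) * (t ^ 0 * exp (scaled_residual x n j * t + 0 * t\<^sup>2)
      + (-1) * (t ^ 0 * exp (0 * t + 1 / 2 * t\<^sup>2))))
      = ((\<Sum>j=1..n. exp (t * scaled_residual x n j)) - real n * exp (t\<^sup>2 / 2)) / sqrt (real n)"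
      by (simp add: sum_distrib_left[symmetric] sum_divide_distrib[symmetric] sum_subtractf mult.commute)
    also have "\<dots> = (real n * (emp_mgf x n t - std_normal_mgf t)) / sqrt (real n)"
      using assms(2) by (simp add: emp_mgf_def std_normal_mgf_def right_diff_distrib)
    also have "\<dots> = zres x n t"
      by (simp add: zres_def real_div_sqrt flip: times_divide_eq_left)
    finally show ?thesis .
  qed
  ultimately show ?thesis by simp
qed

lemma T_stat_eq:
  assumes "\<beta> > 2" "n > 0"
  shows "T_stat \<beta> x n = (wnorm \<beta> (zres x n))\<^sup>2"
proof -
  have m: "zres x n \<in> borel_measurable borel" using zres_wL2[OF assms] by (rule wL2_measurable)
  have "(wnorm \<beta> (zres x n))\<^sup>2 = (\<integral>t. (zres x n t)\<^sup>2 * exp (- \<beta> * t\<^sup>2) \<partial>lborel)"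
    using m by (simp add: wnorm_square integral_wmeasure)
  also have "\<dots> = (\<integral>t. real n * ((emp_mgf x n t - std_normal_mgf t)\<^sup>2 * exp (- \<beta> * t\<^sup>2)) \<partial>lborel)"
    by (simp add: zres_def power_mult_distrib mult.assoc)
  finally show ?thesis by (simp add: T_stat_def)
qed

context normal_sample
begin

lemma T_stat_measurable: "(\<lambda>\<omega>. T_stat \<beta> (\<lambda>j. \<xi> j \<omega>) n) \<in> borel_measurable M"
proof -
  have [measurable]: "(\<lambda>p. scaled_residual (\<lambda>j. \<xi> j (fst p)) n j) \<in> borel_measurable (M \<Otimes>\<^sub>M lborel)" if "j \<ge> 1" for j
    unfolding scaled_residual_def sample_var_def sample_mean_def using that
    by (intro borel_measurable_divide borel_measurable_diff borel_measurable_sqrt borel_measurable_sum borel_measurable_power) auto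
  have [measurable]: "(\<lambda>p. emp_mgf (\<lambda>j. \<xi> j (fst p)) n (snd p)) \<in> borel_measurable (M \<Otimes>\<^sub>M lborel)"
    unfolding emp_mgf_def by (intro borel_measurable_divide borel_measurable_sum) auto
  show ?thesis
    unfolding T_stat_def std_normal_mgf_def
    by (intro borel_measurable_times borel_measurable_const lborel.borel_measurable_lebesgue_integral)
      (unfold split_beta', measurable)
qed

text \<open>Good and bad samples are merged into one inequality without indicators. If
  \<open>\<bar>U\<bar>\<close> or \<open>\<bar>V\<bar>\<close> exceeds \<open>L\<close>, the first
  term is already at least 1, as in Markov's inequality; otherwise the expansion applies.
  Expectations can then be taken directly.\<close>

lemma pathwise_bound:
  assumes \<epsilon>: "\<epsilon> > 0" and \<beta>: "\<beta> > 2" and n: "n > 0" and c: "c \<ge> 0"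
    and int: "integrable (wmeasure \<beta>) (errdom \<epsilon> (\<lambda>j. \<xi> j \<omega>) n)"
    and L: "L \<ge> 1" and small: "8 * L \<le> sqrt (real n)" "5 * L\<^sup>2 / sqrt (real n) \<le> \<epsilon>"
  defines "\<Phi> \<equiv> \<integral>t. errdom \<epsilon> (\<lambda>j. \<xi> j \<omega>) n t \<partial>wmeasure \<beta>"
  shows "\<bar>exp (- (c * T_stat \<beta> (\<lambda>j. \<xi> j \<omega>) n)) - exp (- (c * (wnorm \<beta> (zlin n \<omega>))\<^sup>2))\<bar>
    \<le> ((nsum (\<lambda>x. x) n \<omega>)\<^sup>2 + (nsum (\<lambda>x. x\<^sup>2 - 1) n \<omega>)\<^sup>2) / L\<^sup>2 + sqrt (c * 5 * (5 * L\<^sup>2) ^ 4) / sqrt (real n) * (1 + \<Phi>)"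
    (is "\<bar>?E1 - ?E2\<bar> \<le> ?P + ?C * (1 + \<Phi>)")
proof -
  let ?x = "\<lambda>j. \<xi> j \<omega>"
  define U V r where "U = nsum (\<lambda>x. x) n \<omega>" and "V = nsum (\<lambda>x. x\<^sup>2 - 1) n \<omega>" and "r = 1 / sqrt (real n)"
  have \<Phi>: "\<Phi> \<ge> 0" unfolding \<Phi>_def by (intro integral_nonneg_AE AE_I2 errdom_nonneg \<epsilon>)
  have C: "?C \<ge> 0" using c by simp
  have P: "?P \<ge> 0" by simp
  have T: "T_stat \<beta> ?x n = (wnorm \<beta> (zres ?x n))\<^sup>2" using \<beta> n by (rule T_stat_eq)
  show ?thesis
  proof (cases "\<bar>U\<bar> \<le> L \<and> \<bar>V\<bar> \<le> L")
    case False
    have E: "0 \<le> ?E1" "?E1 \<le> 1" "0 \<le> ?E2" "?E2 \<le> 1" using c by (auto simp: T)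
    have "L\<^sup>2 \<le> U\<^sup>2 + V\<^sup>2"
    proof (cases "\<bar>U\<bar> \<le> L")
      case True
      with False have "L \<le> \<bar>V\<bar>" by simp
      then have "L\<^sup>2 \<le> V\<^sup>2" using L by (simp add: abs_le_square_iff[symmetric])
      then show ?thesis by (simp add: add_increasing)
    next
      case False
      then have "L\<^sup>2 \<le> U\<^sup>2" using L by (simp add: abs_le_square_iff[symmetric])
      then show ?thesis by (simp add: add_increasing2)
    qed
    \<comment> \<open>Both exponentials lie in \<open>[0, 1]\<close>, so this alone bounds their
      difference.\<close>
    then have "1 \<le> ?P" using L by (simp add: U_def V_def)
    moreover have "0 \<le> ?C * (1 + \<Phi>)" using C \<Phi> by (intro mult_nonneg_nonneg) auto
    ultimately show ?thesis using E by linarith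
  next
    case True
    have "r * (8 * L) \<le> 1" using small(1) n by (simp add: r_def)
    then obtain \<alpha> b where ab: "\<And>j. scaled_residual ?x n j = ?x j + (\<alpha> * ?x j + b)"
      "\<bar>\<alpha>\<bar> \<le> 5 * L\<^sup>2 * r" "\<bar>b\<bar> \<le> 5 * L\<^sup>2 * r"
      "\<bar>\<alpha> / r + V / 2\<bar> \<le> 5 * L\<^sup>2 * r" "\<bar>b / r + U\<bar> \<le> 5 * L\<^sup>2 * r"
      using scaled_residual_expansion[OF n L r_def, of U ?x V] True by (auto simp: U_def V_def nsum_def)
    have L2: "1 \<le> L\<^sup>2" using L by (rule one_le_power)
    \<comment> \<open>The expansion is used with \<open>K = 5 * L\<^sup>2\<close>; the second
      smallness assumption is its condition \<open>K * r \<le> \<epsilon>\<close>.\<close>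
    have bound: "(zres ?x n t - zlin n \<omega> t)\<^sup>2 \<le> 5 * (5 * L\<^sup>2) ^ 4 / real n * errdom \<epsilon> ?x n t" for t
      unfolding zlin_def nsum_def
      by (rule zres_diff_bound[OF n r_def \<epsilon> _ _ ab(1) _ _ ab(2-5)])
        (use L2 small(2) in \<open>auto simp: r_def U_def V_def nsum_def\<close>)
    have zL: "zres ?x n \<in> wL2 \<beta>" "zlin n \<omega> \<in> wL2 \<beta>" using zres_wL2[OF \<beta> n] zlin_wL2[OF \<beta>] by auto
    then have dL: "sq_integrable (wmeasure \<beta>) (\<lambda>t. zres ?x n t - zlin n \<omega> t)"
      by (simp add: wL2_iff sq_integrable_diff)
    have "\<bar>?E1 - ?E2\<bar> = \<bar>exp (- (sqrt c * wnorm \<beta> (zres ?x n))\<^sup>2) - exp (- (sqrt c * wnorm \<beta> (zlin n \<omega>))\<^sup>2)\<bar>"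
      using c by (simp add: T power_mult_distrib)
    also have "\<dots> \<le> \<bar>sqrt c * wnorm \<beta> (zres ?x n) - sqrt c * wnorm \<beta> (zlin n \<omega>)\<bar>"
      by (rule exp_neg_square_Lipschitz)
    also have "\<dots> = sqrt c * \<bar>wnorm \<beta> (zres ?x n) - wnorm \<beta> (zlin n \<omega>)\<bar>"
      using c by (simp add: right_diff_distrib[symmetric] abs_mult)
    also have "\<dots> \<le> sqrt c * sqrt (\<integral>t. (zres ?x n t - zlin n \<omega> t)\<^sup>2 \<partial>wmeasure \<beta>)"
      using L2_triangle_diff[of "wmeasure \<beta>" "zres ?x n" "zlin n \<omega>"] zL c
      by (intro mult_left_mono) (simp_all add: wnorm_eq wL2_measurable wL2_iff[symmetric])
    also have "\<dots> \<le> sqrt c * sqrt (5 * (5 * L\<^sup>2) ^ 4 / real n * \<Phi>)"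
    proof (intro mult_left_mono real_sqrt_le_mono)
      have "(\<integral>t. (zres ?x n t - zlin n \<omega> t)\<^sup>2 \<partial>wmeasure \<beta>) \<le> (\<integral>t. 5 * (5 * L\<^sup>2) ^ 4 / real n * errdom \<epsilon> ?x n t \<partial>wmeasure \<beta>)"
        using bound by (intro integral_mono sq_integrable_square[OF dL] integrable_mult_right int)
      then show "(\<integral>t. (zres ?x n t - zlin n \<omega> t)\<^sup>2 \<partial>wmeasure \<beta>) \<le> 5 * (5 * L\<^sup>2) ^ 4 / real n * \<Phi>"
        by (simp only: integral_mult_right_zero \<Phi>_def)
    qed (use c in simp)
    also have "\<dots> = ?C * sqrt \<Phi>"
      by (simp add: real_sqrt_mult real_sqrt_divide)
    also have "\<dots> \<le> ?C * (1 + \<Phi>)"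
    proof (rule mult_left_mono[OF _ C])
      \<comment> \<open>Trading \<open>sqrt \<Phi>\<close> for \<open>1 + \<Phi>\<close> leaves a
        bound that is linear in \<open>\<Phi>\<close>, whose mean is known.\<close>
      have "\<Phi> \<le> (1 + \<Phi>)\<^sup>2" using \<Phi> by (simp add: power2_sum)
      then show "sqrt \<Phi> \<le> 1 + \<Phi>" using \<Phi> by (intro real_le_lsqrt) auto
    qed
    finally show ?thesis using P by linarith
  qed
qed

text \<open>The variances of \<open>x\<close> and \<open>x^2 - 1\<close> under the standard normal
  law are 1 and 2.\<close>

lemma nsum_sample_moments:
  assumes "n > 0"
  shows "has_bochner_integral M (\<lambda>\<omega>. (nsum (\<lambda>x. x) n \<omega>)\<^sup>2 + (nsum (\<lambda>x. x\<^sup>2 - 1) n \<omega>)\<^sup>2) 3"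
proof -
  have p: "has_bochner_integral std_normal_distribution (\<lambda>x. x) 0"
    "has_bochner_integral std_normal_distribution (\<lambda>x. x\<^sup>2) 1"
    "has_bochner_integral std_normal_distribution (\<lambda>x. x\<^sup>2 - 1) 0"
    using std_normal_poly[of 0 1 0 0 0] std_normal_poly[of 0 0 1 0 0] std_normal_poly[of "-1" 0 1 0 0] by simp_all
  have "(x\<^sup>2 - 1)\<^sup>2 = 1 + 0 * x + (-2) * x\<^sup>2 + 0 * x ^ 3 + 1 * x ^ 4" for x :: real
    by (simp add: power2_diff)
  then have p4: "has_bochner_integral std_normal_distribution (\<lambda>x. (x\<^sup>2 - 1)\<^sup>2) 2"
    using std_normal_poly[of 1 0 "-2" 0 1] by simp
  have "has_bochner_integral M (\<lambda>\<omega>. (nsum (\<lambda>x. x) n \<omega>)\<^sup>2 + (nsum (\<lambda>x. x\<^sup>2 - 1) n \<omega>)\<^sup>2) (1 + 2)"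
    by (intro has_bochner_integral_add nsum_has_second_moment p p4 assms) simp_all
  then show ?thesis by simp
qed

lemma T_stat_nonneg: "T_stat \<beta> x n \<ge> 0"
  by (simp add: T_stat_def)

text \<open>The level \<open>L\<close> is fixed first, to make \<open>3 / L^2\<close> small; the
  second error then vanishes as \<open>n\<close> grows, since its mean involves \<open>n\<close>
  only through \<open>1 / sqrt n\<close>.\<close>

theorem linearisation:
  assumes \<beta>: "\<beta> > 2" and c: "c \<ge> 0"
  shows "(\<lambda>n. (\<integral>\<omega>. exp (- c * T_stat \<beta> (\<lambda>j. \<xi> j \<omega>) n) \<partial>M)
    - (\<integral>\<omega>. exp (- c * (wnorm \<beta> (zlin n \<omega>))\<^sup>2) \<partial>M)) \<longlonglongrightarrow> 0" (is "?D \<longlonglongrightarrow> 0")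
proof -
  \<comment> \<open>The rate equals 2 at \<open>\<epsilon> = 0\<close>, so by continuity it stays
    below \<open>\<beta>\<close> for small positive \<open>\<epsilon>\<close>.\<close>
  have "continuous (at_right 0) (\<lambda>\<epsilon>::real. (2 + 3 * \<epsilon>)\<^sup>2 / 2)" by (intro continuous_intros) simp
  then have "((\<lambda>\<epsilon>::real. (2 + 3 * \<epsilon>)\<^sup>2 / 2) \<longlongrightarrow> 2) (at_right 0)" by (simp add: continuous_within)
  then have "eventually (\<lambda>\<epsilon>. (2 + 3 * \<epsilon>)\<^sup>2 / 2 < \<beta>) (at_right 0)" using \<beta> by (rule order_tendstoD)
  then obtain \<epsilon>0 where \<epsilon>0: "\<epsilon>0 > 0" "\<And>\<epsilon>. 0 < \<epsilon> \<Longrightarrow> \<epsilon> < \<epsilon>0 \<Longrightarrow> (2 + 3 * \<epsilon>)\<^sup>2 / 2 < \<beta>"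
    by (auto simp: eventually_at_right_field)
  then have \<epsilon>: "\<epsilon>0 / 2 > 0" "(2 + 3 * (\<epsilon>0 / 2))\<^sup>2 / 2 < \<beta>" using \<epsilon>0(2)[of "\<epsilon>0 / 2"] by linarith+
  define \<epsilon> where "\<epsilon> = \<epsilon>0 / 2"
  note \<epsilon> = \<epsilon>[folded \<epsilon>_def]
  define \<kappa> where "\<kappa> = (\<integral>t. errmean \<epsilon> t \<partial>wmeasure \<beta>)"
  have bound: "\<bar>?D n\<bar> \<le> 3 / L\<^sup>2 + sqrt (c * 5 * (5 * L\<^sup>2) ^ 4) * (1 + \<kappa>) / sqrt (real n)"
    if L: "L \<ge> 1" and n: "n > 0" and small: "8 * L \<le> sqrt (real n)" "5 * L\<^sup>2 / sqrt (real n) \<le> \<epsilon>" for L n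
  proof -
    let ?C = "sqrt (c * 5 * (5 * L\<^sup>2) ^ 4) / sqrt (real n)"
    let ?P = "\<lambda>\<omega>. (nsum (\<lambda>x. x) n \<omega>)\<^sup>2 + (nsum (\<lambda>x. x\<^sup>2 - 1) n \<omega>)\<^sup>2"
    let ?\<Phi> = "\<lambda>\<omega>. \<integral>t. errdom \<epsilon> (\<lambda>j. \<xi> j \<omega>) n t \<partial>wmeasure \<beta>"
    note [measurable] = T_stat_measurable zlin_norm_measurable[OF \<beta>]
    have i: "integrable M (\<lambda>\<omega>. exp (- c * T_stat \<beta> (\<lambda>j. \<xi> j \<omega>) n))"
      "integrable M (\<lambda>\<omega>. exp (- c * (wnorm \<beta> (zlin n \<omega>))\<^sup>2))"
      by (rule integrable_const_bound[of _ 1], use c T_stat_nonneg in auto)+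
    have P: "integrable M ?P" "(\<integral>\<omega>. ?P \<omega> \<partial>M) = 3"
      using nsum_sample_moments[OF n] by (simp_all only: has_bochner_integral_iff)
    note \<Phi> = errdom_integrable[OF \<epsilon> \<beta> n]
    have "\<bar>?D n\<bar> = \<bar>\<integral>\<omega>. exp (- c * T_stat \<beta> (\<lambda>j. \<xi> j \<omega>) n) - exp (- c * (wnorm \<beta> (zlin n \<omega>))\<^sup>2) \<partial>M\<bar>"
      by (simp only: Bochner_Integration.integral_diff[OF i])
    also have "\<dots> \<le> (\<integral>\<omega>. \<bar>exp (- c * T_stat \<beta> (\<lambda>j. \<xi> j \<omega>) n) - exp (- c * (wnorm \<beta> (zlin n \<omega>))\<^sup>2)\<bar> \<partial>M)"
      by (rule integral_abs_bound)
    also have "\<dots> \<le> (\<integral>\<omega>. ?P \<omega> / L\<^sup>2 + ?C * (1 + ?\<Phi> \<omega>) \<partial>M)"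
    proof (rule integral_mono_AE)
      show "AE \<omega> in M. \<bar>exp (- c * T_stat \<beta> (\<lambda>j. \<xi> j \<omega>) n) - exp (- c * (wnorm \<beta> (zlin n \<omega>))\<^sup>2)\<bar>
          \<le> ?P \<omega> / L\<^sup>2 + ?C * (1 + ?\<Phi> \<omega>)"
        using \<Phi>(1)
      proof eventually_elim
        case (elim \<omega>)
        show ?case using pathwise_bound[OF \<epsilon>(1) \<beta> n c elim L small] by simp
      qed
      show "integrable M (\<lambda>\<omega>. ?P \<omega> / L\<^sup>2 + ?C * (1 + ?\<Phi> \<omega>))"
        by (intro Bochner_Integration.integrable_add integrable_mult_right integrable_divide P \<Phi> integrable_const)
    qed (intro integrable_abs Bochner_Integration.integrable_diff i)
    also have "\<dots> = 3 / L\<^sup>2 + ?C * (1 + \<kappa>)"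
    proof -
      have "(\<integral>\<omega>. 1 + ?\<Phi> \<omega> \<partial>M) = 1 + \<kappa>"
        using \<Phi> by (simp add: prob_space \<kappa>_def)
      moreover have "integrable M (\<lambda>\<omega>. 1 + ?\<Phi> \<omega>)"
        by (intro Bochner_Integration.integrable_add \<Phi> integrable_const)
      ultimately show ?thesis
        by (subst Bochner_Integration.integral_add)
          (simp_all only: integral_mult_right_zero integral_divide_zero P integrable_divide integrable_mult_right)
    qed
    finally show ?thesis by simp
  qed
  show ?thesis
  proof (rule LIMSEQ_I)
    fix e :: real assume e: "e > 0"
    \<comment> \<open>Chosen so that \<open>L\<^sup>2 > 6 / e\<close>, whence
      \<open>3 / L\<^sup>2 < e / 2\<close>.\<close>
    define L where "L = max 1 (sqrt (6 / e) + 1)"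
    have L: "L \<ge> 1" by (simp add: L_def)
    have "sqrt (6 / e) < L" by (simp add: L_def)
    then have "(sqrt (6 / e))\<^sup>2 < L\<^sup>2" using e by (intro power_strict_mono) auto
    then have "6 / e < L\<^sup>2" using e by simp
    then have L3: "3 / L\<^sup>2 < e / 2" using e L by (simp add: field_simps)
    have lim: "filterlim (\<lambda>n. sqrt (real n)) at_top sequentially"
      by (rule filterlim_compose[OF sqrt_at_top filterlim_real_sequentially])
    have "((\<lambda>n. C / sqrt (real n)) \<longlongrightarrow> 0) sequentially" for C
      by (rule tendsto_divide_0[OF tendsto_const filterlim_at_top_imp_at_infinity[OF lim]])
    then have ev: "eventually (\<lambda>n. C / sqrt (real n) < d) sequentially" if "d > 0" for C d
      using that by (rule order_tendstoD)
    have "eventually (\<lambda>n. 8 * L \<le> sqrt (real n)) sequentially"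
      using lim by (simp add: filterlim_at_top)
    moreover have "eventually (\<lambda>n. 5 * L\<^sup>2 / sqrt (real n) < \<epsilon>) sequentially"
      by (rule ev[OF \<epsilon>(1)])
    moreover have "eventually (\<lambda>n. sqrt (c * 5 * (5 * L\<^sup>2) ^ 4) * (1 + \<kappa>) / sqrt (real n) < e / 2) sequentially"
      using e by (intro ev) simp
    moreover note eventually_gt_at_top[of "0 :: nat"]
    ultimately have "eventually (\<lambda>n. norm (?D n - 0) < e) sequentially"
    proof eventually_elim
      case (elim n)
      then have "\<bar>?D n\<bar> \<le> 3 / L\<^sup>2 + sqrt (c * 5 * (5 * L\<^sup>2) ^ 4) * (1 + \<kappa>) / sqrt (real n)"
        by (intro bound[OF L]) auto
      then show ?case using elim(3) L3 unfolding real_norm_def diff_0_right by linarith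
    qed
    then show "\<exists>no. \<forall>n\<ge>no. norm (?D n - 0) < e" by (simp only: eventually_sequentially)
  qed
qed

end

section \<open>Measurability in the weighted space\<close>

lemma L2_norm_sum_le:
  assumes "finite J" "\<And>i. i \<in> J \<Longrightarrow> sq_integrable M (f i)"
  shows "sqrt (\<integral>x. (\<Sum>i\<in>J. f i x)\<^sup>2 \<partial>M) \<le> (\<Sum>i\<in>J. sqrt (\<integral>x. (f i x)\<^sup>2 \<partial>M))"
  using assms
proof (induction J rule: finite_induct)
  case (insert i J)
  have "sqrt (\<integral>x. (f i x + (\<Sum>i\<in>J. f i x))\<^sup>2 \<partial>M) \<le> sqrt (\<integral>x. (f i x)\<^sup>2 \<partial>M) + sqrt (\<integral>x. (\<Sum>i\<in>J. f i x)\<^sup>2 \<partial>M)"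
    using insert.prems by (intro L2_triangle sq_integrable_sum) auto
  then show ?case using insert by (simp add: order.trans)
qed simp

text \<open>A countable dense set, witnessing separability. Extensional coefficient functions are
  used because over all functions on the integers the index set would be uncountable.\<close>

definition rational_steps :: "real \<Rightarrow> (real \<Rightarrow> real) set" where
  "rational_steps \<beta> = (\<Union>m. (\<lambda>q t. \<Sum>i\<in>cells m. q i * cell_fun \<beta> m i t) ` (cells m \<rightarrow>\<^sub>E \<rat>))"

lemma countable_rational_steps: "countable (rational_steps \<beta>)"
  unfolding rational_steps_def by (intro countable_UN countable_image countable_PiE countable_rat) auto

lemma rational_steps_wL2: "\<beta> > 0 \<Longrightarrow> d \<in> rational_steps \<beta> \<Longrightarrow> d \<in> wL2 \<beta>"
  unfolding rational_steps_def by (auto intro!: wL2_sum cell_fun_wL2)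

lemma rational_steps_dense:
  assumes \<beta>: "\<beta> > 0" and f: "f \<in> wL2 \<beta>" and e: "e > 0"
  obtains d where "d \<in> rational_steps \<beta>" "wnorm \<beta> (\<lambda>t. f t - d t) < e"
proof -
  have "eventually (\<lambda>m. wnorm \<beta> (\<lambda>t. f t - cell_avg \<beta> m f t) < e / 2 \<and> m > 0) sequentially"
    using order_tendstoD(2)[OF cell_avg_tendsto[OF \<beta> f], of "e / 2"] e eventually_gt_at_top[of 0]
    by (intro eventually_conj) auto
  then obtain m where m: "wnorm \<beta> (\<lambda>t. f t - cell_avg \<beta> m f t) < e / 2" "m > 0"
    unfolding eventually_sequentially by blast
  \<comment> \<open>The errors of the cells add up; the \<open>+ 1\<close> makes
    \<open>card (cells m) * \<delta>\<close> strictly less than \<open>e / 2\<close>.\<close>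
  define \<delta> where "\<delta> = e / (2 * (real (card (cells m)) + 1))"
  have \<delta>: "\<delta> > 0" using e by (simp add: \<delta>_def)
  have "\<exists>q\<in>\<rat>. \<bar>coef \<beta> m i f - q\<bar> < \<delta>" for i
  proof -
    obtain q where "q \<in> \<rat>" "coef \<beta> m i f - \<delta> < q" "q < coef \<beta> m i f"
      using Rats_dense_in_real[of "coef \<beta> m i f - \<delta>" "coef \<beta> m i f"] \<delta> by auto
    then show ?thesis by (intro bexI[of _ q]) auto
  qed
  then obtain q where q: "\<And>i. q i \<in> \<rat>" "\<And>i. \<bar>coef \<beta> m i f - q i\<bar> < \<delta>" by metis
  \<comment> \<open>The restriction makes the coefficient function extensional without changing the
    sum.\<close>
  define d where "d t = (\<Sum>i\<in>cells m. restrict q (cells m) i * cell_fun \<beta> m i t)" for t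
  have dD: "d \<in> rational_steps \<beta>"
  proof -
    have "restrict q (cells m) \<in> cells m \<rightarrow>\<^sub>E \<rat>" using q(1) by auto
    then show ?thesis unfolding rational_steps_def d_def[abs_def] by blast
  qed
  have dL: "d \<in> wL2 \<beta>" by (rule rational_steps_wL2[OF \<beta> dD])
  note e2 = sq_integrable_cmult[OF cell_fun_wL2[OF \<beta>, unfolded wL2_iff]]
  have "wnorm \<beta> (\<lambda>t. cell_avg \<beta> m f t - d t) = sqrt (\<integral>t. (\<Sum>i\<in>cells m. (coef \<beta> m i f - q i) * cell_fun \<beta> m i t)\<^sup>2 \<partial>wmeasure \<beta>)"
  proof -
    have "cell_avg \<beta> m f t - d t = (\<Sum>i\<in>cells m. (coef \<beta> m i f - q i) * cell_fun \<beta> m i t)" for t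
      unfolding cell_avg_def d_def sum_subtractf[symmetric] by (intro sum.cong) (simp_all add: left_diff_distrib)
    moreover have "(\<lambda>t. cell_avg \<beta> m f t - d t) \<in> borel_measurable borel"
      using cell_avg_wL2[OF \<beta>] dL by (intro borel_measurable_diff) (auto intro: wL2_measurable)
    ultimately show ?thesis by (simp add: wnorm_eq)
  qed
  also have "\<dots> \<le> (\<Sum>i\<in>cells m. sqrt (\<integral>t. ((coef \<beta> m i f - q i) * cell_fun \<beta> m i t)\<^sup>2 \<partial>wmeasure \<beta>))"
    by (intro L2_norm_sum_le e2) auto
  also have "\<dots> = (\<Sum>i\<in>cells m. \<bar>coef \<beta> m i f - q i\<bar>)"
    using cell_fun_orthonormal[OF \<beta> m(2)] by (simp add: power_mult_distrib power2_eq_square[of "cell_fun _ _ _ _"])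
  also have "\<dots> \<le> (\<Sum>i\<in>cells m. \<delta>)"
    using q(2) by (intro sum_mono) (simp add: less_imp_le)
  also have "\<dots> < e / 2" using e by (simp add: \<delta>_def field_simps)
  finally have 2: "wnorm \<beta> (\<lambda>t. cell_avg \<beta> m f t - d t) < e / 2" .
  have "wnorm \<beta> (\<lambda>t. f t - d t) < e"
    using wnorm_triangle_diff[OF f cell_avg_wL2[OF \<beta>] dL, of m f] m(1) 2 by linarith
  with dD show ?thesis by (rule that)
qed

text \<open>By separability every open set is a countable union of balls with centres in
  \<open>rational_steps\<close> and rational radii, so it is enough that distances to fixed elements
  are measurable.\<close>

lemma measurable_borel_wL2I:
  assumes \<beta>: "\<beta> > 0" and W: "\<And>\<omega>. \<omega> \<in> space N \<Longrightarrow> W \<omega> \<in> wL2 \<beta>"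
    and meas: "\<And>d. d \<in> wL2 \<beta> \<Longrightarrow> (\<lambda>\<omega>. wnorm \<beta> (\<lambda>t. W \<omega> t - d t)) \<in> borel_measurable N"
  shows "W \<in> measurable N (borel_wL2 \<beta>)"
  unfolding borel_wL2_def
proof (rule measurable_measure_of)
  show "{U. wopen \<beta> U} \<subseteq> Pow (wL2 \<beta>)" by (auto simp: wopen_def)
  show "W \<in> space N \<rightarrow> wL2 \<beta>" using W by auto
  fix U assume "U \<in> {U. wopen \<beta> U}"
  then have U: "U \<subseteq> wL2 \<beta>" "\<And>f. f \<in> U \<Longrightarrow> \<exists>r>0. \<forall>g\<in>wL2 \<beta>. wnorm \<beta> (\<lambda>t. g t - f t) < r \<longrightarrow> g \<in> U"
    by (auto simp: wopen_def)
  define B where "B d q = {f \<in> wL2 \<beta>. wnorm \<beta> (\<lambda>t. f t - d t) < q}" for d and q :: real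
  define I where "I = {(d, q) \<in> rational_steps \<beta> \<times> \<rat>. B d q \<subseteq> U}"
  have "I \<subseteq> rational_steps \<beta> \<times> \<rat>" by (auto simp: I_def)
  then have "countable I"
    by (rule countable_subset) (intro countable_SIGMA countable_rational_steps countable_rat)
  have "U = (\<Union>(d, q)\<in>I. B d q)"
  proof
    show "U \<subseteq> (\<Union>(d, q)\<in>I. B d q)"
    proof
      fix f assume fU: "f \<in> U"
      then have f: "f \<in> wL2 \<beta>" using U(1) by auto
      obtain r where r: "r > 0" "\<And>g. g \<in> wL2 \<beta> \<Longrightarrow> wnorm \<beta> (\<lambda>t. g t - f t) < r \<Longrightarrow> g \<in> U"
        using U(2)[OF fU] by blast
      \<comment> \<open>With \<open>q < r / 2\<close>, a ball of radius \<open>q\<close> whose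
        centre lies within \<open>q\<close> of \<open>f\<close> contains \<open>f\<close> and stays
        inside the ball of radius \<open>r\<close> about \<open>f\<close>.\<close>
      obtain q where q: "q \<in> \<rat>" "0 < q" "q < r / 2"
        using Rats_dense_in_real[of 0 "r / 2"] r(1) by auto
      obtain d where d: "d \<in> rational_steps \<beta>" "wnorm \<beta> (\<lambda>t. f t - d t) < q"
        using rational_steps_dense[OF \<beta> f q(2)] .
      have dL: "d \<in> wL2 \<beta>" by (rule rational_steps_wL2[OF \<beta> d(1)])
      have comm: "wnorm \<beta> (\<lambda>t. d t - f t) = wnorm \<beta> (\<lambda>t. f t - d t)"
        by (simp add: wnorm_def winner_def algebra_simps)
      have "B d q \<subseteq> U"
      proof
        fix g assume "g \<in> B d q"
        then have g: "g \<in> wL2 \<beta>" "wnorm \<beta> (\<lambda>t. g t - d t) < q" by (auto simp: B_def)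
        have "wnorm \<beta> (\<lambda>t. g t - f t) < r"
          using wnorm_triangle_diff[OF g(1) dL f] g(2) d(2) q(3) comm by linarith
        then show "g \<in> U" by (rule r(2)[OF g(1)])
      qed
      then show "f \<in> (\<Union>(d, q)\<in>I. B d q)"
        using d q f by (auto simp: I_def B_def)
    qed
  qed (auto simp: I_def)
  then have "W -` U \<inter> space N = (\<Union>(d, q)\<in>I. {\<omega> \<in> space N. wnorm \<beta> (\<lambda>t. W \<omega> t - d t) < q})"
    using W by (auto simp: B_def)
  also have "\<dots> \<in> sets N"
  proof (rule sets.countable_UN'[OF \<open>countable I\<close>], clarsimp)
    fix d and q :: real assume "(d, q) \<in> I"
    then have "d \<in> wL2 \<beta>" using rational_steps_wL2[OF \<beta>] by (auto simp: I_def)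
    note [measurable] = meas[OF this]
    show "{\<omega> \<in> space N. wnorm \<beta> (\<lambda>t. W \<omega> t - d t) < q} \<in> sets N" by measurable
  qed
  finally show "W -` U \<inter> space N \<in> sets N" .
qed

section \<open>Existence of the Gaussian element\<close>

text \<open>Levy's uniqueness theorem identifies the law, after division by the standard deviation
  if \<open>v > 0\<close> and as the point mass at 0 if \<open>v = 0\<close>.\<close>

lemma (in prob_space) centred_normalI:
  assumes [measurable]: "Z \<in> borel_measurable M" and v: "v \<ge> 0"
    and char: "\<And>s. (CLINT \<omega>|M. iexp (s * Z \<omega>)) = complex_of_real (exp (- (s\<^sup>2 / 2) * v))"
  shows "centred_normal M Z" and "has_bochner_integral M (\<lambda>\<omega>. (Z \<omega>)\<^sup>2) v"
proof -
  have char': "char (distr M borel (\<lambda>\<omega>. Z \<omega> / c)) s = complex_of_real (exp (- ((s / c)\<^sup>2 / 2) * v))" for s c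
    unfolding char_def char[symmetric] by (subst integral_distr) auto
  have "centred_normal M Z \<and> has_bochner_integral M (\<lambda>\<omega>. (Z \<omega>)\<^sup>2) v"
  proof (cases "v = 0")
    case True
    have "distr M borel (\<lambda>\<omega>. Z \<omega> / 1) = return borel 0"
    proof (rule Levy_uniqueness)
      show "real_distribution (distr M borel (\<lambda>\<omega>. Z \<omega> / 1))" by (rule real_distribution_distr) simp
      have "prob_space (return borel (0::real))" by (rule prob_space_return) simp
      then show "real_distribution (return borel (0::real))"
        by (simp add: real_distribution_def real_distribution_axioms_def)
      show "char (distr M borel (\<lambda>\<omega>. Z \<omega> / 1)) = char (return borel 0)"
        using char'[of 1] by (auto simp: True char_def integral_return fun_eq_iff)
    qed
    then have eq: "distr M borel Z = return borel 0" by simp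
    have "AE x in distr M borel Z. x = 0" unfolding eq by (simp add: AE_return)
    then have 0: "AE \<omega> in M. Z \<omega> = 0" by (subst (asm) AE_distr_iff) auto
    have "has_bochner_integral M (\<lambda>\<omega>. (Z \<omega>)\<^sup>2) 0 \<longleftrightarrow> has_bochner_integral M (\<lambda>\<omega>. 0) (0::real)"
      by (rule has_bochner_integral_cong_AE) (use 0 in auto)
    moreover have "has_bochner_integral M (\<lambda>\<omega>. 0) (0::real)" by (rule has_bochner_integral_zero)
    ultimately show ?thesis using 0 by (simp add: True centred_normal_def)
  next
    case False
    define \<sigma> where "\<sigma> = sqrt v"
    have \<sigma>: "\<sigma> > 0" "\<sigma>\<^sup>2 = v" using False v by (auto simp: \<sigma>_def)
    have "distr M borel (\<lambda>\<omega>. Z \<omega> / \<sigma>) = std_normal_distribution"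
    proof (rule Levy_uniqueness)
      show "real_distribution (distr M borel (\<lambda>\<omega>. Z \<omega> / \<sigma>))" by (rule real_distribution_distr) simp
      show "char (distr M borel (\<lambda>\<omega>. Z \<omega> / \<sigma>)) = char std_normal_distribution"
      proof
        fix s
        have "(s / \<sigma>)\<^sup>2 * v = s\<^sup>2" using \<sigma> False by (simp add: power_divide)
        then have "- ((s / \<sigma>)\<^sup>2 / 2) * v = - s\<^sup>2 / 2" by simp
        then show "char (distr M borel (\<lambda>\<omega>. Z \<omega> / \<sigma>)) s = char std_normal_distribution s"
          by (simp only: char' char_std_normal_distribution)
      qed
    qed (rule real_dist_normal_dist)
    then have "distr M lborel (\<lambda>\<omega>. Z \<omega> / \<sigma>) = std_normal_distribution"
      using distr_cong[of M M borel lborel "\<lambda>\<omega>. Z \<omega> / \<sigma>" "\<lambda>\<omega>. Z \<omega> / \<sigma>"] by simp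
    then have "distributed M lborel (\<lambda>\<omega>. (Z \<omega> - 0) / \<sigma>) std_normal_density"
      by (simp add: distributed_def)
    then have D: "distributed M lborel Z (\<lambda>x. ennreal (normal_density 0 \<sigma> x))"
      using normal_standard_normal_convert[OF \<sigma>(1), of Z 0] by simp
    have "(\<integral>\<omega>. (Z \<omega>)\<^sup>2 \<partial>M) = v"
      using normal_distributed_variance[OF \<sigma>(1) D] normal_distributed_expectation[OF \<sigma>(1) D] \<sigma>(2) by simp
    moreover have "integrable M (\<lambda>\<omega>. (Z \<omega>)\<^sup>2)"
    proof (subst distributed_integrable[OF D, symmetric])
      show "integrable lborel (\<lambda>x. normal_density 0 \<sigma> x * x\<^sup>2)"
        using integrable_normal_moment[OF \<sigma>(1), of 0 2] by (simp only: diff_zero)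
    qed auto
    ultimately show ?thesis using D \<sigma>(1) by (auto simp: centred_normal_def has_bochner_integral_iff)
  qed
  then show "centred_normal M Z" "has_bochner_integral M (\<lambda>\<omega>. (Z \<omega>)\<^sup>2) v" by auto
qed

text \<open>The coefficient functions of the normalised Hermite polynomials in the expansion of
  \<open>hker\<close>; the Gaussian element replaces these polynomials by independent normals. Low
  degrees are set to zero instead of shifting the index, so that \<open>k\<close> remains the
  degree.\<close>

definition psi :: "nat \<Rightarrow> real \<Rightarrow> real" where
  "psi k t = (if k < 3 then 0 else t ^ k / sqrt (fact k)) * exp (t\<^sup>2 / 2)"

lemma psi_wL2: "\<beta> > 2 \<Longrightarrow> psi k \<in> wL2 \<beta>"
proof -
  assume \<beta>: "\<beta> > 2"
  have "(\<lambda>t. (if k < 3 then 0 else 1 / sqrt (fact k)) * (t ^ k * exp (0 * t + 1 / 2 * t\<^sup>2))) \<in> wL2 \<beta>"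
    unfolding wL2_iff by (intro sq_integrable_cmult; unfold wL2_iff[symmetric], rule power_exp_wL2) (use \<beta> in simp)
  moreover have "(\<lambda>t. (if k < 3 then 0 else 1 / sqrt (fact k)) * (t ^ k * exp (0 * t + 1 / 2 * t\<^sup>2))) = psi k"
    by (auto simp: psi_def fun_eq_iff)
  ultimately show ?thesis by simp
qed

lemma psi_measurable [measurable]: "psi k \<in> borel_measurable borel"
  unfolding psi_def[abs_def] by measurable

lemma psi_product: "psi k s * psi k t = exp ((t\<^sup>2 + s\<^sup>2) / 2) * (if k < 3 then 0 else (t * s) ^ k / fact k)"
proof -
  have "sqrt (fact k) * sqrt (fact k) = (fact k :: real)" by simp
  then show ?thesis
    by (simp add: psi_def power_mult_distrib add_divide_distrib exp_add)
qed

lemma psi_sums: "(\<lambda>k. psi k s * psi k t) sums K_cov s t"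
proof -
  have "(\<lambda>k. (t * s) ^ k / fact k) sums exp (t * s)"
    using exp_converges[of "t * s"] by (simp add: divide_inverse mult.commute)
  then have "(\<lambda>k. (t * s) ^ (k + 3) / fact (k + 3)) sums (exp (t * s) - (\<Sum>k<3. (t * s) ^ k / fact k))"
    by (rule sums_split_initial_segment)
  then have "(\<lambda>k. if k + 3 < 3 then 0 else (t * s) ^ (k + 3) / fact (k + 3)) sums (exp (t * s) - (\<Sum>k<3. (t * s) ^ k / fact k))"
    by simp
  then have "(\<lambda>k. if k < 3 then 0 else (t * s) ^ k / fact k) sums
      ((exp (t * s) - (\<Sum>k<3. (t * s) ^ k / fact k)) + (\<Sum>k<3. if k < 3 then 0 else (t * s) ^ k / fact k))"
    by (subst (asm) sums_iff_shift)
  moreover have "(\<Sum>k<3. (t * s) ^ k / fact k) = 1 + t * s + t\<^sup>2 * s\<^sup>2 / 2"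
    by (simp add: numeral_3_eq_3 power_mult_distrib power2_eq_square)
  ultimately have "(\<lambda>k. if k < 3 then 0 else (t * s) ^ k / fact k) sums (exp (t * s) - 1 - t * s - t\<^sup>2 * s\<^sup>2 / 2)"
    by (simp add: diff_diff_eq)
  then show ?thesis unfolding psi_product K_cov_def by (rule sums_mult)
qed

text \<open>From \<open>\<bar>t * s\<bar> \<le> (t^2 + s^2) / 2\<close>. The bound is a product of
  functions of one variable, each in \<open>wL2 \<beta>\<close> for \<open>\<beta> > 2\<close>, and
  so it can dominate in \<open>s\<close> and in \<open>t\<close> separately.\<close>

lemma psi_abs_sum: "(\<Sum>k<m. \<bar>psi k s\<bar> * \<bar>psi k t\<bar>) \<le> exp (s\<^sup>2) * exp (t\<^sup>2)"
proof -
  let ?u = "\<bar>t * s\<bar>"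
  have "(\<Sum>k<m. \<bar>psi k s\<bar> * \<bar>psi k t\<bar>) \<le> (\<Sum>k<m. exp ((t\<^sup>2 + s\<^sup>2) / 2) * (?u ^ k / fact k))"
  proof (rule sum_mono)
    fix k
    have "\<bar>psi k s\<bar> * \<bar>psi k t\<bar> = \<bar>psi k s * psi k t\<bar>" by (rule abs_mult[symmetric])
    also have "\<dots> \<le> exp ((t\<^sup>2 + s\<^sup>2) / 2) * (?u ^ k / fact k)"
      unfolding psi_product by (simp add: abs_mult power_mult_distrib power_abs)
    finally show "\<bar>psi k s\<bar> * \<bar>psi k t\<bar> \<le> exp ((t\<^sup>2 + s\<^sup>2) / 2) * (?u ^ k / fact k)" .
  qed
  also have "\<dots> = exp ((t\<^sup>2 + s\<^sup>2) / 2) * (\<Sum>k<m. ?u ^ k / fact k)" by (simp add: sum_distrib_left)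
  also have "\<dots> \<le> exp ((t\<^sup>2 + s\<^sup>2) / 2) * exp ?u"
  proof (rule mult_left_mono)
    have "(\<lambda>k. ?u ^ k / fact k) sums exp ?u"
      using exp_converges[of ?u] by (simp add: divide_inverse mult.commute)
    then show "(\<Sum>k<m. ?u ^ k / fact k) \<le> exp ?u"
      by (metis (no_types, lifting) sums_iff sum_le_suminf finite_lessThan abs_ge_zero divide_nonneg_pos fact_gt_zero zero_le_power)
  qed simp
  also have "\<dots> \<le> exp ((t\<^sup>2 + s\<^sup>2) / 2) * exp ((t\<^sup>2 + s\<^sup>2) / 2)"
  proof -
    have "2 * (\<bar>t\<bar> * \<bar>s\<bar>) \<le> t\<^sup>2 + s\<^sup>2" using sum_squares_bound[of "\<bar>t\<bar>" "\<bar>s\<bar>"] by (simp add: mult.assoc)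
    then have "2 * ?u \<le> t\<^sup>2 + s\<^sup>2" by (simp only: abs_mult)
    moreover have "a \<le> X / 2" if "2 * a \<le> X" for a X :: real using that by simp
    ultimately have "?u \<le> (t\<^sup>2 + s\<^sup>2) / 2" by blast
    then show ?thesis by simp
  qed
  also have "\<dots> = exp (s\<^sup>2) * exp (t\<^sup>2)" by (simp add: exp_add[symmetric])
  finally show ?thesis .
qed

lemma exp_square_wL2: "\<beta> > 2 \<Longrightarrow> (\<lambda>t. exp (t\<^sup>2)) \<in> wL2 \<beta>"
  using exp_quadratic_in_wL2[of 1 \<beta> 0] by simp

text \<open>Dominated convergence is applied twice to the partial sums of the kernel: in
  \<open>s\<close> for fixed \<open>t\<close>, and then in \<open>t\<close> with the bound
  \<open>exp (t^2) * I\<close> that the first application leaves.\<close>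

lemma covform_sums:
  assumes \<beta>: "\<beta> > 2" and f: "f \<in> wL2 \<beta>" and g: "g \<in> wL2 \<beta>"
  shows "(\<lambda>k. winner \<beta> (psi k) f * winner \<beta> (psi k) g) sums covform \<beta> f g"
proof -
  have [measurable]: "f \<in> borel_measurable borel" "g \<in> borel_measurable borel"
    using f g by (auto intro: wL2_measurable)
  have [measurable]: "(\<lambda>s. K_cov s t) \<in> borel_measurable borel" for t
    unfolding K_cov_def by measurable
  have int: "integrable (wmeasure \<beta>) (\<lambda>s. u s * h s)" if "u \<in> wL2 \<beta>" "h \<in> wL2 \<beta>" for u h
    using that by (auto simp: wL2_iff intro: sq_integrable_mult)
  have intE: "integrable (wmeasure \<beta>) (\<lambda>s. exp (s\<^sup>2) * \<bar>h s\<bar>)" if "h \<in> wL2 \<beta>" for h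
    using integrable_abs[OF int[OF exp_square_wL2[OF \<beta>] that]] by (simp add: abs_mult)
  have c: "winner \<beta> (psi k) h = (\<integral>s. psi k s * h s \<partial>wmeasure \<beta>)" if "h \<in> wL2 \<beta>" for k h
    by (rule winner_eq) (use that in \<open>auto intro: wL2_measurable\<close>)
  define F where "F m t = (\<Sum>k<m. winner \<beta> (psi k) f * psi k t)" for m t
  have F_eq: "F m t = (\<integral>s. (\<Sum>k<m. psi k s * psi k t) * f s \<partial>wmeasure \<beta>)" for m t
  proof -
    have "(\<integral>s. (\<Sum>k<m. psi k s * psi k t) * f s \<partial>wmeasure \<beta>) = (\<integral>s. (\<Sum>k<m. psi k t * (psi k s * f s)) \<partial>wmeasure \<beta>)"
      by (simp add: sum_distrib_left sum_distrib_right mult_ac)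
    also have "\<dots> = (\<Sum>k<m. psi k t * (\<integral>s. psi k s * f s \<partial>wmeasure \<beta>))"
      by (subst Bochner_Integration.integral_sum) (auto intro!: integrable_mult_right int psi_wL2[OF \<beta>] f)
    finally show ?thesis by (simp add: F_def c[OF f] mult.commute)
  qed
  have P_bound: "\<bar>(\<Sum>k<m. psi k s * psi k t) * h\<bar> \<le> exp (t\<^sup>2) * (exp (s\<^sup>2) * \<bar>h\<bar>)" for m s t h
  proof -
    have "\<bar>\<Sum>k<m. psi k s * psi k t\<bar> \<le> exp (s\<^sup>2) * exp (t\<^sup>2)"
      by (rule order.trans[OF sum_abs]) (simp only: abs_mult psi_abs_sum)
    then have "\<bar>\<Sum>k<m. psi k s * psi k t\<bar> * \<bar>h\<bar> \<le> (exp (s\<^sup>2) * exp (t\<^sup>2)) * \<bar>h\<bar>" by (rule mult_right_mono) simp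
    then show ?thesis by (simp add: abs_mult mult_ac)
  qed
  define I where "I = (\<integral>s. exp (s\<^sup>2) * \<bar>f s\<bar> \<partial>wmeasure \<beta>)"
  have F_bound: "\<bar>F m t\<bar> \<le> exp (t\<^sup>2) * I" for m t
  proof -
    have "\<bar>F m t\<bar> \<le> (\<integral>s. \<bar>(\<Sum>k<m. psi k s * psi k t) * f s\<bar> \<partial>wmeasure \<beta>)"
      unfolding F_eq by (rule integral_abs_bound)
    also have "\<dots> \<le> (\<integral>s. exp (t\<^sup>2) * (exp (s\<^sup>2) * \<bar>f s\<bar>) \<partial>wmeasure \<beta>)"
    proof (rule integral_mono)
      show "integrable (wmeasure \<beta>) (\<lambda>s. \<bar>(\<Sum>k<m. psi k s * psi k t) * f s\<bar>)"
        by (rule Bochner_Integration.integrable_bound[OF integrable_mult_right[OF intE[OF f], of "exp (t\<^sup>2)"]])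
          (use P_bound in auto)
    qed (auto intro!: integrable_mult_right intE f simp: P_bound simp del: abs_mult)
    finally show ?thesis by (simp add: I_def)
  qed
  have F_lim: "(\<lambda>m. F m t) \<longlonglongrightarrow> (\<integral>s. K_cov s t * f s \<partial>wmeasure \<beta>)" for t
    unfolding F_eq
  proof (rule integral_dominated_convergence[where w = "\<lambda>s. exp (t\<^sup>2) * (exp (s\<^sup>2) * \<bar>f s\<bar>)"])
    show "AE s in wmeasure \<beta>. (\<lambda>m. (\<Sum>k<m. psi k s * psi k t) * f s) \<longlonglongrightarrow> K_cov s t * f s"
      using psi_sums unfolding sums_def by (intro AE_I2 tendsto_mult tendsto_const) auto
  qed (use P_bound in \<open>auto intro!: integrable_mult_right intE f\<close>)
  have [measurable]: "F m \<in> borel_measurable borel" for m unfolding F_def[abs_def] by measurable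
  have Klim: "(\<lambda>t. \<integral>s. K_cov s t * f s \<partial>wmeasure \<beta>) \<in> borel_measurable borel"
    by (rule borel_measurable_LIMSEQ_real[OF F_lim]) simp
  have "(\<lambda>m. \<integral>t. F m t * g t \<partial>wmeasure \<beta>) \<longlonglongrightarrow> (\<integral>t. (\<integral>s. K_cov s t * f s \<partial>wmeasure \<beta>) * g t \<partial>wmeasure \<beta>)"
  proof (rule integral_dominated_convergence[where w = "\<lambda>t. I * (exp (t\<^sup>2) * \<bar>g t\<bar>)"])
    show "AE t in wmeasure \<beta>. norm (F m t * g t) \<le> I * (exp (t\<^sup>2) * \<bar>g t\<bar>)" for m
      using F_bound mult_right_mono[OF F_bound, of "\<bar>g _\<bar>" m] by (intro AE_I2) (simp add: abs_mult mult_ac)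
    show "AE t in wmeasure \<beta>. (\<lambda>m. F m t * g t) \<longlonglongrightarrow> (\<integral>s. K_cov s t * f s \<partial>wmeasure \<beta>) * g t"
      by (intro AE_I2 tendsto_mult tendsto_const F_lim)
  qed (use Klim in \<open>auto intro!: integrable_mult_right intE g\<close>)
  moreover have "(\<integral>t. F m t * g t \<partial>wmeasure \<beta>) = (\<Sum>k<m. winner \<beta> (psi k) f * winner \<beta> (psi k) g)" for m
  proof -
    have "(\<integral>t. F m t * g t \<partial>wmeasure \<beta>) = (\<integral>t. (\<Sum>k<m. winner \<beta> (psi k) f * (psi k t * g t)) \<partial>wmeasure \<beta>)"
      by (simp add: F_def sum_distrib_right mult.assoc)
    also have "\<dots> = (\<Sum>k<m. winner \<beta> (psi k) f * (\<integral>t. psi k t * g t \<partial>wmeasure \<beta>))"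
      by (subst Bochner_Integration.integral_sum) (auto intro!: integrable_mult_right int psi_wL2[OF \<beta>] g)
    finally show ?thesis by (simp add: c[OF g])
  qed
  ultimately show ?thesis by (simp add: sums_def covform_eq[OF f g])
qed

section \<open>The random series\<close>

lemma gauss_PiM_UNIV_iexp:
  assumes J: "finite J"
  shows "(CLINT \<omega>|gauss_PiM (UNIV :: 'i set). iexp (s * (\<Sum>i\<in>J. \<omega> i * v i)))
    = complex_of_real (exp (- (s\<^sup>2 / 2) * (\<Sum>i\<in>J. (v i)\<^sup>2)))"
proof -
  interpret product_prob_space "\<lambda>_ :: 'i. std_normal_distribution" UNIV by unfold_locales
  have [measurable]: "(\<lambda>\<omega>. \<omega> i) \<in> borel_measurable (gauss_PiM J)" if "i \<in> J" for i
  proof -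
    have "(\<lambda>\<omega>. \<omega> i) \<in> measurable (gauss_PiM J) std_normal_distribution"
      using that by (rule measurable_component_singleton)
    then show ?thesis by simp
  qed
  have "(CLINT g|gauss_PiM J. iexp (s * (\<Sum>i\<in>J. g i * v i)))
    = (CLINT \<omega>|gauss_PiM UNIV. iexp (s * (\<Sum>i\<in>J. restrict \<omega> J i * v i)))"
    by (subst distr_PiM_restrict_finite[OF J, symmetric], simp)
      (rule integral_distr, simp_all add: measurable_restrict_subset)
  also have "\<dots> = (CLINT \<omega>|gauss_PiM UNIV. iexp (s * (\<Sum>i\<in>J. \<omega> i * v i)))"
    by (intro Bochner_Integration.integral_cong refl arg_cong[where f = iexp]
      arg_cong[where f = "\<lambda>x. s * x"] sum.cong) simp
  finally show ?thesis by (simp only: gauss_PiM_iexp[OF J])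
qed

text \<open>One event, independent of \<open>t\<close>, on which the series converges at every
  point. The geometric weights make it almost sure for \<open>\<rho> < 1\<close>, while the
  factorials in \<open>psi\<close> compensate the inverse weights. In extended reals the event is
  visibly measurable.\<close>

definition converges_at :: "real \<Rightarrow> (nat \<Rightarrow> real) \<Rightarrow> bool" where
  "converges_at \<rho> \<omega> \<longleftrightarrow> (\<Sum>k. ennreal (\<rho> ^ k * (\<omega> k)\<^sup>2)) \<noteq> \<top>"

text \<open>The value 0 off the convergence event puts every path, not just almost every one, into
  \<open>wL2 \<beta>\<close>, as measurability into \<open>borel_wL2\<close> demands.\<close>

definition gauss_series :: "real \<Rightarrow> (nat \<Rightarrow> real) \<Rightarrow> real \<Rightarrow> real" where
  "gauss_series \<rho> \<omega> t = (if converges_at \<rho> \<omega> then \<Sum>k. \<omega> k * psi k t else 0)"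

lemma gauss_coordinate_measurable [measurable]:
  "(\<lambda>\<omega>. \<omega> k) \<in> borel_measurable (gauss_PiM (UNIV :: nat set))"
proof -
  have "(\<lambda>\<omega>. \<omega> k) \<in> measurable (gauss_PiM (UNIV :: nat set)) std_normal_distribution"
    by (rule measurable_component_singleton) simp
  then show ?thesis by simp
qed

lemma converges_at_measurable [measurable]:
  "Measurable.pred (gauss_PiM (UNIV :: nat set)) (converges_at \<rho>)"
  unfolding converges_at_def[abs_def] by measurable

lemma gauss_series_measurable [measurable]:
  "(\<lambda>p. gauss_series \<rho> (fst p) (snd p)) \<in> borel_measurable (gauss_PiM (UNIV :: nat set) \<Otimes>\<^sub>M borel)"
proof -
  have [measurable]: "(\<lambda>p. fst p k) \<in> borel_measurable (gauss_PiM (UNIV :: nat set) \<Otimes>\<^sub>M borel)" for k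
    by (rule measurable_compose[OF measurable_fst gauss_coordinate_measurable])
  have [measurable]: "Measurable.pred (gauss_PiM (UNIV :: nat set) \<Otimes>\<^sub>M borel) (\<lambda>p. converges_at \<rho> (fst p))"
    by (rule measurable_compose[OF measurable_fst converges_at_measurable])
  show ?thesis unfolding gauss_series_def by measurable
qed

text \<open>The expected value of the weighted sum is the geometric series in \<open>\<rho>\<close>,
  and a nonnegative variable with finite mean is almost surely finite.\<close>

lemma AE_converges_at:
  assumes \<rho>: "0 < \<rho>" "\<rho> < 1"
  shows "AE \<omega> in gauss_PiM (UNIV :: nat set). converges_at \<rho> \<omega>"
proof -
  interpret product_prob_space "\<lambda>_ :: nat. std_normal_distribution" UNIV by unfold_locales
  have "(\<integral>\<^sup>+\<omega>. ennreal (\<rho> ^ k * (\<omega> k)\<^sup>2) \<partial>gauss_PiM (UNIV :: nat set)) = ennreal (\<rho> ^ k)" for k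
  proof -
    have "(\<integral>\<^sup>+\<omega>. ennreal (\<rho> ^ k * (\<omega> k)\<^sup>2) \<partial>gauss_PiM (UNIV :: nat set))
        = (\<integral>\<^sup>+x. ennreal (\<rho> ^ k * x\<^sup>2) \<partial>distr (gauss_PiM UNIV) std_normal_distribution (\<lambda>\<omega>. \<omega> k))"
      by (rule nn_integral_distr[symmetric]) (auto intro: measurable_component_singleton)
    also have "\<dots> = (\<integral>\<^sup>+x. ennreal (\<rho> ^ k * x\<^sup>2) \<partial>std_normal_distribution)"
      by (subst PiM_component) simp_all
    also have "\<dots> = ennreal (\<integral>x. \<rho> ^ k * x\<^sup>2 \<partial>std_normal_distribution)"
      using integrable_std_normal_distribution_moment[of 2] \<rho>
      by (intro nn_integral_eq_integral integrable_mult_right) auto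
    also have "(\<integral>x. \<rho> ^ k * x\<^sup>2 \<partial>std_normal_distribution) = \<rho> ^ k"
      using std_normal_distribution_even_moments(1)[of 1] by (simp only: integral_mult_right_zero) (simp add: fact_numeral)
    finally show ?thesis .
  qed
  then have "(\<integral>\<^sup>+\<omega>. (\<Sum>k. ennreal (\<rho> ^ k * (\<omega> k)\<^sup>2)) \<partial>gauss_PiM (UNIV :: nat set)) = (\<Sum>k. ennreal (\<rho> ^ k))"
    by (subst nn_integral_suminf) auto
  also have "\<dots> \<noteq> \<top>"
    using \<rho> by (intro ennreal_suminf_neq_top summable_geometric) auto
  finally have "AE \<omega> in gauss_PiM (UNIV :: nat set). (\<Sum>k. ennreal (\<rho> ^ k * (\<omega> k)\<^sup>2)) \<noteq> \<infinity>"
    by (intro nn_integral_PInf_AE) auto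
  then show ?thesis by (simp add: converges_at_def)
qed

text \<open>The summand \<open>0 * \<bar>t\<bar>\<close> gives the exponent the shape expected by
  \<open>exp_quadratic_in_wL2\<close>.\<close>

definition series_bound :: "real \<Rightarrow> (nat \<Rightarrow> real) \<Rightarrow> real \<Rightarrow> real" where
  "series_bound \<rho> \<omega> t = sqrt (\<Sum>k. \<rho> ^ k * (\<omega> k)\<^sup>2) * exp (0 * \<bar>t\<bar> + (1 + 1 / \<rho>) / 2 * t\<^sup>2)"

text \<open>Cauchy-Schwarz with the weights \<open>\<rho> ^ k\<close>.\<close>

lemma series_abs_bound:
  assumes \<rho>: "0 < \<rho>" and conv: "converges_at \<rho> \<omega>"
  shows "(\<Sum>k<m. \<bar>\<omega> k * psi k t\<bar>) \<le> series_bound \<rho> \<omega> t"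
proof -
  have summable: "summable (\<lambda>k. \<rho> ^ k * (\<omega> k)\<^sup>2)"
    using conv \<rho> unfolding converges_at_def by (intro summable_suminf_not_top) auto
  define a where "a k = sqrt (\<rho> ^ k) * \<bar>\<omega> k\<bar>" for k
  define b where "b k = \<bar>psi k t\<bar> / sqrt (\<rho> ^ k)" for k
  have ab: "\<bar>\<omega> k * psi k t\<bar> = a k * b k" for k
    using \<rho> by (simp add: a_def b_def abs_mult)
  have "(\<Sum>k<m. (a k)\<^sup>2) = (\<Sum>k<m. \<rho> ^ k * (\<omega> k)\<^sup>2)"
    using \<rho> by (intro sum.cong refl) (simp add: a_def power_mult_distrib)
  also have "\<dots> \<le> (\<Sum>k. \<rho> ^ k * (\<omega> k)\<^sup>2)"
    using \<rho> by (intro sum_le_suminf summable) auto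
  finally have 1: "(\<Sum>k<m. (a k)\<^sup>2) \<le> (\<Sum>k. \<rho> ^ k * (\<omega> k)\<^sup>2)" .
  have "(\<Sum>k<m. (b k)\<^sup>2) \<le> (\<Sum>k<m. exp (t\<^sup>2) * ((t\<^sup>2 / \<rho>) ^ k / fact k))"
  proof (rule sum_mono)
    fix k
    have "(psi k t)\<^sup>2 \<le> exp (t\<^sup>2) * ((t\<^sup>2) ^ k / fact k)"
      unfolding power2_eq_square[of "psi k t"] psi_product by (simp add: power2_eq_square)
    then have "(psi k t)\<^sup>2 / \<rho> ^ k \<le> exp (t\<^sup>2) * ((t\<^sup>2) ^ k / fact k) / \<rho> ^ k"
      using \<rho> by (intro divide_right_mono) auto
    then show "(b k)\<^sup>2 \<le> exp (t\<^sup>2) * ((t\<^sup>2 / \<rho>) ^ k / fact k)"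
      using \<rho> by (simp add: b_def power_divide mult.commute)
  qed
  also have "\<dots> = exp (t\<^sup>2) * (\<Sum>k<m. (t\<^sup>2 / \<rho>) ^ k / fact k)" by (simp add: sum_distrib_left)
  also have "\<dots> \<le> exp (t\<^sup>2) * exp (t\<^sup>2 / \<rho>)"
  proof (rule mult_left_mono)
    have "(\<lambda>k. (t\<^sup>2 / \<rho>) ^ k / fact k) sums exp (t\<^sup>2 / \<rho>)"
      using exp_converges[of "t\<^sup>2 / \<rho>"] by (simp add: divide_inverse mult.commute)
    moreover have "0 \<le> (t\<^sup>2 / \<rho>) ^ k / fact k" for k using \<rho> by simp
    ultimately show "(\<Sum>k<m. (t\<^sup>2 / \<rho>) ^ k / fact k) \<le> exp (t\<^sup>2 / \<rho>)"
      by (metis (no_types, lifting) sums_iff sum_le_suminf finite_lessThan)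
  qed simp
  also have "\<dots> = (exp ((1 + 1 / \<rho>) / 2 * t\<^sup>2))\<^sup>2"
    by (simp add: exp_add[symmetric] exp_double[symmetric] distrib_right)
  finally have 2: "(\<Sum>k<m. (b k)\<^sup>2) \<le> (exp ((1 + 1 / \<rho>) / 2 * t\<^sup>2))\<^sup>2" .
  have A0: "0 \<le> (\<Sum>k. \<rho> ^ k * (\<omega> k)\<^sup>2)" using \<rho> summable by (intro suminf_nonneg) auto
  have "(\<Sum>k<m. a k * b k)\<^sup>2 \<le> (\<Sum>k<m. (a k)\<^sup>2) * (\<Sum>k<m. (b k)\<^sup>2)" by (rule Cauchy_Schwarz_ineq_sum)
  also have "\<dots> \<le> (\<Sum>k. \<rho> ^ k * (\<omega> k)\<^sup>2) * (exp ((1 + 1 / \<rho>) / 2 * t\<^sup>2))\<^sup>2"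
    by (intro mult_mono 1 2 A0 sum_nonneg) auto
  also have "\<dots> = (series_bound \<rho> \<omega> t)\<^sup>2" using A0 by (simp add: series_bound_def power_mult_distrib)
  finally have "(\<Sum>k<m. a k * b k) \<le> series_bound \<rho> \<omega> t"
    by (rule power2_le_imp_le) (simp add: series_bound_def A0)
  then show ?thesis by (simp only: ab)
qed

lemma
  assumes \<rho>: "0 < \<rho>" and conv: "converges_at \<rho> \<omega>"
  shows gauss_series_LIMSEQ: "(\<lambda>m. \<Sum>k<m. \<omega> k * psi k t) \<longlonglongrightarrow> gauss_series \<rho> \<omega> t"
    and gauss_series_bound: "\<bar>gauss_series \<rho> \<omega> t\<bar> \<le> series_bound \<rho> \<omega> t"
proof -
  note b = series_abs_bound[OF \<rho> conv]
  have "summable (\<lambda>k. \<bar>\<omega> k * psi k t\<bar>)" by (rule summableI_nonneg_bounded[OF _ b]) simp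
  then have "summable (\<lambda>k. \<omega> k * psi k t)" by (rule summable_rabs_cancel)
  then show lim: "(\<lambda>m. \<Sum>k<m. \<omega> k * psi k t) \<longlonglongrightarrow> gauss_series \<rho> \<omega> t"
    using conv by (simp add: gauss_series_def summable_LIMSEQ)
  have "(\<lambda>m. \<bar>\<Sum>k<m. \<omega> k * psi k t\<bar>) \<longlonglongrightarrow> \<bar>gauss_series \<rho> \<omega> t\<bar>" by (intro tendsto_rabs lim)
  then show "\<bar>gauss_series \<rho> \<omega> t\<bar> \<le> series_bound \<rho> \<omega> t"
    by (rule LIMSEQ_le_const2) (intro exI allI impI order.trans[OF sum_abs b])
qed

lemma gauss_series_borel [measurable]: "gauss_series \<rho> \<omega> \<in> borel_measurable borel"
  unfolding gauss_series_def by measurable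

lemma series_bound_wL2:
  assumes "1 + 1 / \<rho> < \<beta>"
  shows "series_bound \<rho> \<omega> \<in> wL2 \<beta>"
proof -
  have "(\<lambda>t. exp (0 * \<bar>t\<bar> + (1 + 1 / \<rho>) / 2 * t\<^sup>2)) \<in> wL2 \<beta>"
    using assms by (intro exp_quadratic_in_wL2) simp
  then show ?thesis
    unfolding series_bound_def[abs_def] wL2_iff by (rule sq_integrable_cmult)
qed

lemma gauss_series_wL2:
  assumes \<rho>: "0 < \<rho>" "1 + 1 / \<rho> < \<beta>"
  shows "gauss_series \<rho> \<omega> \<in> wL2 \<beta>"
proof (cases "converges_at \<rho> \<omega>")
  case True
  show ?thesis
    using series_bound_wL2[OF \<rho>(2), of \<omega>] unfolding wL2_iff
    by (rule sq_integrable_bound) (simp, rule order.trans[OF gauss_series_bound[OF \<rho>(1) True] abs_ge_self])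
next
  case False
  then have "gauss_series \<rho> \<omega> = (\<lambda>t. 0)" by (simp add: gauss_series_def fun_eq_iff)
  then show ?thesis by (simp add: wL2_iff sq_integrable_zero)
qed

lemma winner_gauss_series:
  assumes \<rho>: "0 < \<rho>" "1 + 1 / \<rho> < \<beta>" and \<beta>: "\<beta> > 2" and conv: "converges_at \<rho> \<omega>" and f: "f \<in> wL2 \<beta>"
  shows "(\<lambda>m. \<Sum>k<m. \<omega> k * winner \<beta> (psi k) f) \<longlonglongrightarrow> winner \<beta> (gauss_series \<rho> \<omega>) f"
proof -
  have [measurable]: "f \<in> borel_measurable borel" using f by (rule wL2_measurable)
  have "(\<lambda>m. \<integral>t. (\<Sum>k<m. \<omega> k * psi k t) * f t \<partial>wmeasure \<beta>) \<longlonglongrightarrow> (\<integral>t. gauss_series \<rho> \<omega> t * f t \<partial>wmeasure \<beta>)"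
  proof (rule integral_dominated_convergence[where w = "\<lambda>t. \<bar>series_bound \<rho> \<omega> t * f t\<bar>"])
    show "integrable (wmeasure \<beta>) (\<lambda>t. \<bar>series_bound \<rho> \<omega> t * f t\<bar>)"
      using series_bound_wL2[OF \<rho>(2)] f by (intro integrable_abs sq_integrable_mult) (auto simp: wL2_iff)
    show "AE t in wmeasure \<beta>. (\<lambda>m. (\<Sum>k<m. \<omega> k * psi k t) * f t) \<longlonglongrightarrow> gauss_series \<rho> \<omega> t * f t"
      by (intro AE_I2 tendsto_mult tendsto_const gauss_series_LIMSEQ[OF \<rho>(1) conv])
    show "AE t in wmeasure \<beta>. norm ((\<Sum>k<m. \<omega> k * psi k t) * f t) \<le> \<bar>series_bound \<rho> \<omega> t * f t\<bar>" for m
    proof (intro AE_I2)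
      fix t
      have "\<bar>\<Sum>k<m. \<omega> k * psi k t\<bar> \<le> \<bar>series_bound \<rho> \<omega> t\<bar>"
        by (rule order.trans[OF order.trans[OF sum_abs series_abs_bound[OF \<rho>(1) conv]] abs_ge_self])
      then show "norm ((\<Sum>k<m. \<omega> k * psi k t) * f t) \<le> \<bar>series_bound \<rho> \<omega> t * f t\<bar>"
        unfolding real_norm_def abs_mult by (rule mult_right_mono) simp
    qed
  qed auto
  moreover have "(\<integral>t. (\<Sum>k<m. \<omega> k * psi k t) * f t \<partial>wmeasure \<beta>) = (\<Sum>k<m. \<omega> k * winner \<beta> (psi k) f)" for m
  proof -
    have "winner \<beta> f (\<lambda>t. \<Sum>k<m. \<omega> k * psi k t) = (\<Sum>k<m. \<omega> k * winner \<beta> f (psi k))"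
      by (intro winner_sum_right f psi_wL2 \<beta>)
    moreover have "winner \<beta> (\<lambda>t. \<Sum>k<m. \<omega> k * psi k t) f = (\<integral>t. (\<Sum>k<m. \<omega> k * psi k t) * f t \<partial>wmeasure \<beta>)"
      by (rule winner_eq) simp_all
    ultimately show ?thesis by (simp add: winner_commute[of \<beta> f])
  qed
  ultimately show ?thesis by (simp add: winner_eq)
qed

lemma winner_add_right:
  assumes "u \<in> wL2 \<beta>" "f \<in> wL2 \<beta>" "g \<in> wL2 \<beta>"
  shows "winner \<beta> u (\<lambda>t. f t + c * g t) = winner \<beta> u f + c * winner \<beta> u g"
  using winner_sum_right[of u \<beta> UNIV "\<lambda>b. if b then f else g" "\<lambda>b. if b then 1 else c"] assms
  by (simp add: UNIV_bool add.commute)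

theorem gaussian_element_exists:
  assumes \<beta>: "\<beta> > 2"
  shows "\<exists>(N :: (nat \<Rightarrow> real) measure) W. prob_space N \<and> centred_gaussian_element \<beta> K_cov N W"
proof -
  have \<beta>0: "\<beta> > 0" using \<beta> by simp
  \<comment> \<open>The interval is nonempty because \<open>\<beta> > 2\<close>. The lower bound
    gives \<open>1 + 1 / \<rho> < \<beta>\<close>, so that paths lie in the space; the upper bound
    gives almost sure convergence.\<close>
  obtain \<rho> where \<rho>': "1 / (\<beta> - 1) < \<rho>" "\<rho> < 1" using dense[of "1 / (\<beta> - 1)" 1] \<beta> by auto
  moreover have "0 < 1 / (\<beta> - 1)" using \<beta> by simp
  ultimately have \<rho>0: "0 < \<rho>" by linarith
  have "1 < \<rho> * (\<beta> - 1)" using \<rho>'(1) \<beta> by (simp add: divide_less_eq)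
  then have "1 / \<rho> < \<beta> - 1" using \<rho>0 by (simp add: divide_less_eq mult.commute)
  then have \<rho>: "0 < \<rho>" "1 + 1 / \<rho> < \<beta>" using \<rho>0 by auto
  let ?N = "gauss_PiM (UNIV :: nat set)" and ?W = "gauss_series \<rho>"
  interpret N: prob_space ?N by (rule prob_space_PiM) unfold_locales
  interpret \<nu>: finite_measure "wmeasure \<beta>" using \<beta>0 by (rule finite_measure_wmeasure)
  note WL = gauss_series_wL2[OF \<rho>]
  have Wm: "?W \<in> measurable ?N (borel_wL2 \<beta>)"
  proof (rule measurable_borel_wL2I[OF \<beta>0 WL])
    fix d assume "d \<in> wL2 \<beta>"
    then have [measurable]: "d \<in> borel_measurable borel" by (rule wL2_measurable)
    have [measurable]: "(\<lambda>p. gauss_series \<rho> (fst p) (snd p)) \<in> borel_measurable (?N \<Otimes>\<^sub>M wmeasure \<beta>)"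
      using gauss_series_measurable by (simp cong: measurable_cong_sets sets_pair_measure_cong)
    have [measurable]: "(\<lambda>p. d (snd p)) \<in> borel_measurable (?N \<Otimes>\<^sub>M wmeasure \<beta>)"
      by (rule measurable_compose[OF measurable_snd]) simp
    have "(\<lambda>\<omega>. \<integral>t. (?W \<omega> t - d t)\<^sup>2 \<partial>wmeasure \<beta>) \<in> borel_measurable ?N"
      by (rule \<nu>.borel_measurable_lebesgue_integral) (unfold split_beta', measurable)
    then show "(\<lambda>\<omega>. wnorm \<beta> (\<lambda>t. ?W \<omega> t - d t)) \<in> borel_measurable ?N"
      by (simp add: wnorm_eq)
  qed
  have coef_measurable: "(\<lambda>\<omega>. winner \<beta> (?W \<omega>) f) \<in> borel_measurable ?N" if "f \<in> wL2 \<beta>" for f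
  proof -
    have [measurable]: "f \<in> borel_measurable borel" using that by (rule wL2_measurable)
    have [measurable]: "(\<lambda>p. gauss_series \<rho> (fst p) (snd p)) \<in> borel_measurable (?N \<Otimes>\<^sub>M wmeasure \<beta>)"
      using gauss_series_measurable by (simp cong: measurable_cong_sets sets_pair_measure_cong)
    have [measurable]: "(\<lambda>p. f (snd p)) \<in> borel_measurable (?N \<Otimes>\<^sub>M wmeasure \<beta>)"
      by (rule measurable_compose[OF measurable_snd]) simp
    have "(\<lambda>\<omega>. \<integral>t. ?W \<omega> t * f t \<partial>wmeasure \<beta>) \<in> borel_measurable ?N"
      by (rule \<nu>.borel_measurable_lebesgue_integral) (unfold split_beta', measurable)
    then show ?thesis by (simp add: winner_eq)
  qed
  \<comment> \<open>Partial sums are finite Gaussian combinations with explicit characteristic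
    functions. Their limit is computed once from the paths and once from the variances.\<close>
  have char: "(CLINT \<omega>|?N. iexp (s * winner \<beta> (?W \<omega>) f)) = complex_of_real (exp (- (s\<^sup>2 / 2) * covform \<beta> f f))"
    if f: "f \<in> wL2 \<beta>" for s f
  proof (rule LIMSEQ_unique)
    note [measurable] = coef_measurable[OF f]
    show "(\<lambda>m. CLINT \<omega>|?N. iexp (s * (\<Sum>k<m. \<omega> k * winner \<beta> (psi k) f))) \<longlonglongrightarrow> (CLINT \<omega>|?N. iexp (s * winner \<beta> (?W \<omega>) f))"
    proof (rule integral_dominated_convergence[where w = "\<lambda>_. 1"])
      show "AE \<omega> in ?N. (\<lambda>m. iexp (s * (\<Sum>k<m. \<omega> k * winner \<beta> (psi k) f))) \<longlonglongrightarrow> iexp (s * winner \<beta> (?W \<omega>) f)"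
        using AE_converges_at[OF \<rho>(1) \<rho>'(2)]
      proof eventually_elim
        case (elim \<omega>)
        show ?case by (intro tendsto_intros winner_gauss_series[OF \<rho> \<beta> elim f])
      qed
    qed auto
    have "(\<lambda>m. \<Sum>k<m. (winner \<beta> (psi k) f)\<^sup>2) \<longlonglongrightarrow> covform \<beta> f f"
      using covform_sums[OF \<beta> f f] by (simp add: sums_def power2_eq_square)
    then show "(\<lambda>m. CLINT \<omega>|?N. iexp (s * (\<Sum>k<m. \<omega> k * winner \<beta> (psi k) f)))
        \<longlonglongrightarrow> complex_of_real (exp (- (s\<^sup>2 / 2) * covform \<beta> f f))"
      unfolding gauss_PiM_UNIV_iexp[OF finite_lessThan] by (intro tendsto_intros)
  qed
  have nonneg: "covform \<beta> f f \<ge> 0" if "f \<in> wL2 \<beta>" for f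
    using covform_sums[OF \<beta> that that] by (rule sums_le[OF _ sums_zero, rotated]) simp
  have normal: "centred_normal ?N (\<lambda>\<omega>. winner \<beta> (?W \<omega>) f)"
    and var: "has_bochner_integral ?N (\<lambda>\<omega>. (winner \<beta> (?W \<omega>) f)\<^sup>2) (covform \<beta> f f)" if "f \<in> wL2 \<beta>" for f
    using N.centred_normalI[OF coef_measurable[OF that] nonneg[OF that] char[OF that]] by auto
  have cov: "(\<integral>\<omega>. winner \<beta> (?W \<omega>) f * winner \<beta> (?W \<omega>) g \<partial>?N) = covform \<beta> f g"
    if f: "f \<in> wL2 \<beta>" and g: "g \<in> wL2 \<beta>" for f g
  proof -
    \<comment> \<open>Polarisation: covariances are recovered from the variances of inner products
      with \<open>f + g\<close> and \<open>f - g\<close>.\<close>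
    let ?p = "\<lambda>t. f t + 1 * g t" and ?m = "\<lambda>t. f t + (-1) * g t"
    have comb: "(\<lambda>t. f t + c * g t) \<in> wL2 \<beta>" for c
      using f g by (simp add: wL2_iff sq_integrable_add sq_integrable_cmult)
    have "has_bochner_integral ?N (\<lambda>\<omega>. ((winner \<beta> (?W \<omega>) ?p)\<^sup>2 - (winner \<beta> (?W \<omega>) ?m)\<^sup>2) / 4)
      ((covform \<beta> ?p ?p - covform \<beta> ?m ?m) / 4)"
      by (intro has_bochner_integral_divide_zero has_bochner_integral_diff var comb)
    moreover have "((winner \<beta> u ?p)\<^sup>2 - (winner \<beta> u ?m)\<^sup>2) / 4
        = winner \<beta> u f * winner \<beta> u g" if "u \<in> wL2 \<beta>" for u
      unfolding winner_add_right[OF that f g] by (simp add: power2_eq_square algebra_simps)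
    \<comment> \<open>The same polarisation identity for \<open>covform\<close>, obtained term by
      term from its series instead of from bilinearity of the double integral.\<close>
    moreover have "(covform \<beta> ?p ?p - covform \<beta> ?m ?m) / 4
        = covform \<beta> f g"
    proof (rule sums_unique2)
      show "(\<lambda>k. ((winner \<beta> (psi k) ?p * winner \<beta> (psi k) ?p)
          - (winner \<beta> (psi k) ?m * winner \<beta> (psi k) ?m)) / 4)
        sums ((covform \<beta> ?p ?p - covform \<beta> ?m ?m) / 4)"
        by (intro sums_divide sums_diff covform_sums \<beta> comb)
      have "((winner \<beta> (psi k) ?p * winner \<beta> (psi k) ?p)
          - (winner \<beta> (psi k) ?m * winner \<beta> (psi k) ?m)) / 4
        = winner \<beta> (psi k) f * winner \<beta> (psi k) g" for k
        unfolding winner_add_right[OF psi_wL2[OF \<beta>] f g] by (simp add: algebra_simps)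
      then show "(\<lambda>k. ((winner \<beta> (psi k) ?p * winner \<beta> (psi k) ?p)
          - (winner \<beta> (psi k) ?m * winner \<beta> (psi k) ?m)) / 4) sums covform \<beta> f g"
        using covform_sums[OF \<beta> f g] by (simp only:)
    qed
    ultimately show ?thesis using WL by (simp only: has_bochner_integral_iff)
  qed
  have "centred_gaussian_element \<beta> K_cov ?N ?W"
    unfolding centred_gaussian_element_def using Wm normal cov by (auto simp: covform_def)
  then show ?thesis using N.prob_space_axioms by blast
qed

section \<open>The limit theorem\<close>

text \<open>Location cancels and the positive scale factors out of numerator and denominator alike.
  A constant sample is covered, since both sides are then 0.\<close>

lemma scaled_residual_affine:
  assumes \<sigma>: "\<sigma> > 0" and n: "n > 0"
  shows "scaled_residual (\<lambda>j. \<mu> + \<sigma> * x j) n j = scaled_residual x n j"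
proof -
  have mean: "sample_mean (\<lambda>j. \<mu> + \<sigma> * x j) n = \<mu> + \<sigma> * sample_mean x n"
    using n by (simp add: sample_mean_def sum.distrib sum_distrib_left add_divide_distrib)
  have "(\<mu> + \<sigma> * x j - (\<mu> + \<sigma> * sample_mean x n))\<^sup>2 = \<sigma>\<^sup>2 * (x j - sample_mean x n)\<^sup>2" for j
    by (simp add: right_diff_distrib[symmetric] power_mult_distrib)
  then have "sample_var (\<lambda>j. \<mu> + \<sigma> * x j) n = \<sigma>\<^sup>2 * sample_var x n"
    by (simp add: sample_var_def mean sum_distrib_left[symmetric])
  then have "sqrt (sample_var (\<lambda>j. \<mu> + \<sigma> * x j) n) = \<sigma> * sqrt (sample_var x n)"
    using \<sigma> by (simp add: real_sqrt_mult)
  then show ?thesis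
    using \<sigma> by (simp add: scaled_residual_def mean right_diff_distrib[symmetric])
qed

lemma T_stat_affine:
  assumes "\<sigma> > 0"
  shows "T_stat \<beta> (\<lambda>j. \<mu> + \<sigma> * x j) n = T_stat \<beta> x n"
  by (cases "n = 0") (simp_all add: T_stat_def emp_mgf_def scaled_residual_affine assms)

theorem (in normal_sample) T_stat_weak_conv:
  assumes \<beta>: "\<beta> > 2" and N: "prob_space N" and W: "centred_gaussian_element \<beta> K_cov N W"
  shows "weak_conv_m (\<lambda>n. distr M borel (\<lambda>\<omega>. T_stat \<beta> (\<lambda>j. \<xi> j \<omega>) n))
    (distr N borel (\<lambda>\<omega>. (wnorm \<beta> (W \<omega>))\<^sup>2))"
proof (rule weak_conv_of_Laplace[OF prob_space_axioms N])
  show "(\<lambda>\<omega>. T_stat \<beta> (\<lambda>j. \<xi> j \<omega>) n) \<in> borel_measurable M" for n by (rule T_stat_measurable)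
  show "(\<lambda>\<omega>. (wnorm \<beta> (W \<omega>))\<^sup>2) \<in> borel_measurable N"
    using \<beta> by (intro gaussian_element_norm_measurable[OF _ W]) simp
  fix k :: nat
  \<comment> \<open>With \<open>s = sqrt (2 * real k)\<close> the rate \<open>s\<^sup>2 / 2\<close>
    becomes the integer \<open>k\<close>.\<close>
  have "(\<lambda>n. ((\<integral>\<omega>. exp (- real k * T_stat \<beta> (\<lambda>j. \<xi> j \<omega>) n) \<partial>M) - (\<integral>\<omega>. exp (- real k * (wnorm \<beta> (zlin n \<omega>))\<^sup>2) \<partial>M))
      + (\<integral>\<omega>. exp (- real k * (wnorm \<beta> (zlin n \<omega>))\<^sup>2) \<partial>M)) \<longlonglongrightarrow> 0 + (\<integral>\<omega>. exp (- real k * (wnorm \<beta> (W \<omega>))\<^sup>2) \<partial>N)"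
    using zlin_Laplace_tendsto[OF \<beta> N W, of "sqrt (2 * real k)"]
    by (intro tendsto_add linearisation \<beta>) simp_all
  then show "(\<lambda>n. \<integral>\<omega>. exp (- real k * T_stat \<beta> (\<lambda>j. \<xi> j \<omega>) n) \<partial>M)
      \<longlonglongrightarrow> (\<integral>\<omega>. exp (- real k * (wnorm \<beta> (W \<omega>))\<^sup>2) \<partial>N)"
    by simp
qed (simp_all add: T_stat_nonneg)

text \<open>The first conjunct ensures that a limit element exists. The second concerns every such
  element on any probability space, so the limit law does not depend on the representation.\<close>

theorem corollary1:
  fixes \<beta> \<mu> \<sigma> :: real
    and M :: "'a measure"
    and X :: "nat \<Rightarrow> 'a \<Rightarrow> real"
  assumes "\<beta> > 2"
    and "\<sigma> > 0"
    and "prob_space M"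
    and "prob_space.indep_vars M (\<lambda>_. borel) X {1..}"
    and "\<And>j. j \<ge> 1 \<Longrightarrow> distributed M lborel (X j) (\<lambda>x. ennreal (normal_density \<mu> \<sigma> x))"
  shows "(\<exists>(N :: (nat \<Rightarrow> real) measure) W.
            prob_space N \<and> centred_gaussian_element \<beta> K_cov N W) \<and>
         (\<forall>(N :: 'b measure) W.
            prob_space N \<and> centred_gaussian_element \<beta> K_cov N W \<longrightarrow>
            weak_conv_m (\<lambda>n. distr M borel (\<lambda>\<omega>. T_stat \<beta> (\<lambda>j. X j \<omega>) n))
                        (distr N borel (\<lambda>\<omega>. (wnorm \<beta> (W \<omega>))\<^sup>2)))"
proof (intro conjI allI impI)
  show "\<exists>(N :: (nat \<Rightarrow> real) measure) W. prob_space N \<and> centred_gaussian_element \<beta> K_cov N W"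
    using assms(1) by (rule gaussian_element_exists)
next
  interpret prob_space M by (rule assms(3))
  \<comment> \<open>Standardised observations; their residuals, and hence the statistic, agree with
    those of \<open>X\<close>.\<close>
  define \<xi> where "\<xi> j \<omega> = (X j \<omega> - \<mu>) / \<sigma>" for j \<omega>
  interpret normal_sample M \<xi>
  proof
    show "indep_vars (\<lambda>_. borel) \<xi> {1..}"
      unfolding \<xi>_def by (rule indep_vars_compose2[OF assms(4)]) simp
    fix j :: nat assume "j \<ge> 1"
    then have "distributed M lborel (\<xi> j) std_normal_density"
      using assms(5)[of j] normal_standard_normal_convert[OF assms(2), of "X j" \<mu>] by (simp add: \<xi>_def[abs_def])
    then have "distr M lborel (\<xi> j) = std_normal_distribution" by (simp add: distributed_def)
    then show "distr M borel (\<xi> j) = std_normal_distribution"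
      using distr_cong[of M M borel lborel "\<xi> j" "\<xi> j"] by simp
  qed
  fix N :: "'b measure" and W
  assume "prob_space N \<and> centred_gaussian_element \<beta> K_cov N W"
  then have "weak_conv_m (\<lambda>n. distr M borel (\<lambda>\<omega>. T_stat \<beta> (\<lambda>j. \<xi> j \<omega>) n)) (distr N borel (\<lambda>\<omega>. (wnorm \<beta> (W \<omega>))\<^sup>2))"
    using assms(1) by (intro T_stat_weak_conv) auto
  moreover have "T_stat \<beta> (\<lambda>j. X j \<omega>) n = T_stat \<beta> (\<lambda>j. \<xi> j \<omega>) n" for \<omega> n
    using T_stat_affine[OF assms(2), of \<beta> \<mu> "\<lambda>j. \<xi> j \<omega>" n] assms(2) by (simp add: \<xi>_def)
  ultimately show "weak_conv_m (\<lambda>n. distr M borel (\<lambda>\<omega>. T_stat \<beta> (\<lambda>j. X j \<omega>) n))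
      (distr N borel (\<lambda>\<omega>. (wnorm \<beta> (W \<omega>))\<^sup>2))"
    by simp
qed

end
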